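(* Let $i$ be a nonzero integer. There exists a structure of non-commutative and non-cocommutative Hopf algebra $(U(W)[[t]], m, \Delta, S, \varepsilon)$ on $U(W)[[t]]$ which leaves the product of $U(W)[[t]]$ undeformed and whose (deformed) comultiplication, antipode and counit are given, for all $k\in\mathbb{Z}$, by $$\Delta(L_k) = L_k\otimes (1-et)^{\frac{k}{i}} + \sum_{l=0}^{\infty} (-1)^l\, i^l\, \frac{\prod_{j=-1}^{l-2}(k+ji)}{l!}\; h^{(l)}\otimes (1-et)^{-l} L_{k+li}\, t^l ,$$ $$S(L_k) = -(1-et)^{-\frac{k}{i}} \sum_{l=0}^{\infty} i^l\, \frac{\prod_{j=-1}^{l-2}(k+ji)}{l!}\; L_{k+li}\,(h+1)^{(l)}\, t^l ,$$ $$\varepsilon(L_k)=0 .$$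
   Context: $W$ is the $\mathbb{Q}$-Lie algebra with basis $L_r$, $r\in\mathbb{Z}$, and bracket $[L_r,L_s]=(s-r)L_{r+s}$ (the Witt algebra). $U(W)$ is its enveloping algebra, $m$ its product, and $t$ is a formal variable. Hopf algebra structures on $U(W)[[t]]$ are understood over $\mathbb{Q}[[t]]$ in the usual topological sense: $\Delta$ takes values in $(U(W)\otimes U(W))[[t]]$. Set $h:=\frac{1}{i}L_0$ and $e:=iL_i$. For an element $x$ of a unital algebra and $n\ge 0$, $x^{(n)}:=x(x+1)\cdots(x+n-1)$, with $x^{(0)}=1$. For $c\in\mathbb{Q}$, $(1-et)^c:=\sum_{n\ge 0}(-1)^n\binom{c}{n}e^n t^n\in U(W)[[t]]$. The empty product (case $l=0$) equals $1$. *)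

theory Defs
  imports
    "HOL-Library.Poly_Mapping"
    "HOL-Computational_Algebra.Formal_Power_Series"
begin

section \<open>Rational vector spaces and algebras\<close>

class rat_vector = ab_group_add +
  fixes scaleQ :: "rat \<Rightarrow> 'a \<Rightarrow> 'a"  (infixr \<open>*\<^sub>Q\<close> 75)
  assumes scaleQ_add_right: "c *\<^sub>Q (x + y) = c *\<^sub>Q x + c *\<^sub>Q y"
    and scaleQ_add_left: "(c + d) *\<^sub>Q x = c *\<^sub>Q x + d *\<^sub>Q x"
    and scaleQ_scaleQ: "c *\<^sub>Q (d *\<^sub>Q x) = (c * d) *\<^sub>Q x"
    and scaleQ_one: "1 *\<^sub>Q x = x"

global_interpretation rat_vector: vector_space "scaleQ :: rat \<Rightarrow> 'a \<Rightarrow> 'a::rat_vector"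
  by unfold_locales (simp_all add: scaleQ_add_right scaleQ_add_left scaleQ_scaleQ scaleQ_one)

abbreviation rat_linear :: "('a::rat_vector \<Rightarrow> 'b::rat_vector) \<Rightarrow> bool"
  where "rat_linear \<equiv> Vector_Spaces.linear scaleQ scaleQ"

definition rat_bilinear :: "('a::rat_vector \<Rightarrow> 'b::rat_vector \<Rightarrow> 'c::rat_vector) \<Rightarrow> bool"
  where "rat_bilinear F \<longleftrightarrow> (\<forall>a. rat_linear (F a)) \<and> (\<forall>b. rat_linear (\<lambda>a. F a b))"

lemma rat_linearI:
  assumes "\<And>x y. f (x + y) = f x + f y" and "\<And>c x. f (c *\<^sub>Q x) = c *\<^sub>Q f x"
  shows "rat_linear f"
  using assms by unfold_locales

lemma rat_linear_add: "rat_linear f \<Longrightarrow> f (x + y) = f x + f y"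
  and rat_linear_scale: "rat_linear f \<Longrightarrow> f (c *\<^sub>Q x) = c *\<^sub>Q f x"
  and rat_linear_zero: "rat_linear f \<Longrightarrow> f 0 = 0"
  and rat_linear_diff: "rat_linear f \<Longrightarrow> f (x - y) = f x - f y"
  and rat_linear_sum: "rat_linear f \<Longrightarrow> f (sum g A) = (\<Sum>a\<in>A. f (g a))"
  by (simp_all add: module_hom_iff_linear[symmetric] module_hom.add module_hom.scale
      module_hom.zero module_hom.diff module_hom.sum)

lemma rat_bilinearI:
  assumes "\<And>a x y. F a (x + y) = F a x + F a y" and "\<And>a c x. F a (c *\<^sub>Q x) = c *\<^sub>Q F a x"
    and "\<And>a x y. F (x + y) a = F x a + F y a" and "\<And>a c x. F (c *\<^sub>Q x) a = c *\<^sub>Q F x a"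
  shows "rat_bilinear F"
  unfolding rat_bilinear_def using assms by (auto intro!: rat_linearI)

class rat_algebra_1 = rat_vector + ring_1 +
  assumes mult_scaleQ_left: "(c *\<^sub>Q x) * y = c *\<^sub>Q (x * y)"
    and mult_scaleQ_right: "x * (c *\<^sub>Q y) = c *\<^sub>Q (x * y)"

instantiation rat :: rat_algebra_1
begin
definition scaleQ_rat :: "rat \<Rightarrow> rat \<Rightarrow> rat" where "scaleQ_rat = (*)"
instance by standard (simp_all add: scaleQ_rat_def algebra_simps)
end

instantiation poly_mapping :: (type, rat_vector) rat_vector
begin
lift_definition scaleQ_poly_mapping :: "rat \<Rightarrow> ('a \<Rightarrow>\<^sub>0 'b) \<Rightarrow> 'a \<Rightarrow>\<^sub>0 'b"
  is "\<lambda>c p x. c *\<^sub>Q p x"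
  by (erule rev_finite_subset) auto
instance
  by standard (transfer, simp add: fun_eq_iff scaleQ_add_right scaleQ_add_left scaleQ_scaleQ scaleQ_one)+
end

instantiation fps :: (rat_vector) rat_vector
begin
definition scaleQ_fps :: "rat \<Rightarrow> 'a fps \<Rightarrow> 'a fps"
  where "c *\<^sub>Q x = Abs_fps (\<lambda>n. c *\<^sub>Q fps_nth x n)"
instance
  by standard (simp_all add: fps_eq_iff scaleQ_fps_def scaleQ_add_right scaleQ_add_left
      scaleQ_scaleQ scaleQ_one)
end

instance fps :: (rat_algebra_1) rat_algebra_1
  by standard (simp_all add: fps_eq_iff scaleQ_fps_def fps_mult_nth mult_scaleQ_left
      mult_scaleQ_right rat_vector.scale_sum_right)

text \<open>The linear extension of a map on \<open>X\<close> to the vector space with basis \<open>X\<close>.\<close>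

definition free_lift :: "('x \<Rightarrow> 'v::rat_vector) \<Rightarrow> ('x \<Rightarrow>\<^sub>0 rat) \<Rightarrow> 'v"
  where "free_lift f p = (\<Sum>x\<in>Poly_Mapping.keys p. Poly_Mapping.lookup p x *\<^sub>Q f x)"

lemma free_lift_superset:
  "finite A \<Longrightarrow> Poly_Mapping.keys p \<subseteq> A \<Longrightarrow> free_lift f p = (\<Sum>x\<in>A. Poly_Mapping.lookup p x *\<^sub>Q f x)"
  unfolding free_lift_def by (rule sum.mono_neutral_left) (auto simp: in_keys_iff)

lemma free_lift_linear: "rat_linear (free_lift f)"
proof (rule rat_linearI)
  fix p q :: "'a \<Rightarrow>\<^sub>0 rat"
  let ?A = "Poly_Mapping.keys p \<union> Poly_Mapping.keys q"
  have A: "finite ?A" by simp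
  have "free_lift f (p + q) = (\<Sum>x\<in>?A. Poly_Mapping.lookup (p + q) x *\<^sub>Q f x)"
    by (rule free_lift_superset[OF A]) (rule Poly_Mapping.keys_add)
  moreover have "free_lift f p = (\<Sum>x\<in>?A. Poly_Mapping.lookup p x *\<^sub>Q f x)"
    by (rule free_lift_superset[OF A]) simp
  moreover have "free_lift f q = (\<Sum>x\<in>?A. Poly_Mapping.lookup q x *\<^sub>Q f x)"
    by (rule free_lift_superset[OF A]) simp
  ultimately show "free_lift f (p + q) = free_lift f p + free_lift f q"
    by (simp add: lookup_add scaleQ_add_left sum.distrib)
next
  fix c and p :: "'a \<Rightarrow>\<^sub>0 rat"
  have "Poly_Mapping.keys (c *\<^sub>Q p) \<subseteq> Poly_Mapping.keys p"
    by (auto simp: in_keys_iff scaleQ_poly_mapping.rep_eq)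
  then show "free_lift f (c *\<^sub>Q p) = c *\<^sub>Q free_lift f p"
    by (simp add: free_lift_superset[OF finite_keys, of "c *\<^sub>Q p" p] free_lift_def[of f p] scaleQ_poly_mapping.rep_eq
        rat_vector.scale_sum_right scaleQ_rat_def)
qed

lemma free_lift_single [simp]: "free_lift f (Poly_Mapping.single x c) = c *\<^sub>Q f x"
  by (simp add: free_lift_def lookup_single)

lemma scaleQ_single: "c *\<^sub>Q Poly_Mapping.single x d = Poly_Mapping.single x (c * d :: rat)"
  by transfer (auto simp: fun_eq_iff when_def scaleQ_rat_def)

lemma poly_mapping_rat_expand: "p = (\<Sum>x\<in>Poly_Mapping.keys p. Poly_Mapping.single x (Poly_Mapping.lookup p x :: rat))"
  by (rule poly_mapping_eqI)
    (auto simp: lookup_sum lookup_single when_def sum.delta in_keys_iff)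

lemma sum_single_mult:
  "(\<Sum>x\<in>A. Poly_Mapping.single x (f x)) * (\<Sum>y\<in>B. Poly_Mapping.single y (g y)) =
   (\<Sum>x\<in>A. \<Sum>y\<in>B. Poly_Mapping.single (x + y) (f x * g y :: rat))"
  by (simp only: sum_product mult_single)

lemma poly_mapping_rat_mult: "p * q =
    (\<Sum>x\<in>Poly_Mapping.keys p. \<Sum>y\<in>Poly_Mapping.keys q.
      Poly_Mapping.single (x + y) (Poly_Mapping.lookup p x * Poly_Mapping.lookup q y))"
  for p q :: "'m::monoid_add \<Rightarrow>\<^sub>0 rat"
  by (simp only: sum_single_mult[symmetric] poly_mapping_rat_expand[symmetric])


section \<open>Tensor products\<close>

inductive_set tensor_relators :: "('a::rat_vector \<times> 'b::rat_vector \<Rightarrow>\<^sub>0 rat) set"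
  where
    add_left: "Poly_Mapping.single (a + a', b) 1 - (Poly_Mapping.single (a, b) 1
      + Poly_Mapping.single (a', b) 1) \<in> tensor_relators"
  | add_right: "Poly_Mapping.single (a, b + b') 1 - (Poly_Mapping.single (a, b) 1
      + Poly_Mapping.single (a, b') 1) \<in> tensor_relators"
  | scale_left: "Poly_Mapping.single (c *\<^sub>Q a, b) 1 - c *\<^sub>Q Poly_Mapping.single (a, b) 1
      \<in> tensor_relators"
  | scale_right: "Poly_Mapping.single (a, c *\<^sub>Q b) 1 - c *\<^sub>Q Poly_Mapping.single (a, b) 1
      \<in> tensor_relators"

quotient_type (overloaded) ('a, 'b) tensor =
  "'a::rat_vector \<times> 'b::rat_vector \<Rightarrow>\<^sub>0 rat" / "\<lambda>p q. p - q \<in> rat_vector.span tensor_relators"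
proof (rule equivpI)
  show "reflp (\<lambda>p q :: 'a \<times> 'b \<Rightarrow>\<^sub>0 rat. p - q \<in> rat_vector.span tensor_relators)"
    by (rule reflpI) (simp add: rat_vector.span_zero)
  show "symp (\<lambda>p q :: 'a \<times> 'b \<Rightarrow>\<^sub>0 rat. p - q \<in> rat_vector.span tensor_relators)"
    by (rule sympI) (metis minus_diff_eq rat_vector.span_neg)
  show "transp (\<lambda>p q :: 'a \<times> 'b \<Rightarrow>\<^sub>0 rat. p - q \<in> rat_vector.span tensor_relators)"
    by (rule transpI) (drule (1) rat_vector.span_add, simp)
qed

instantiation tensor :: (rat_vector, rat_vector) rat_vector
begin

lift_definition zero_tensor :: "('a, 'b) tensor" is 0 .

lift_definition plus_tensor :: "('a, 'b) tensor \<Rightarrow> ('a, 'b) tensor \<Rightarrow> ('a, 'b) tensor" is "(+)"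
  by (drule (1) rat_vector.span_add) (simp add: algebra_simps)

lift_definition minus_tensor :: "('a, 'b) tensor \<Rightarrow> ('a, 'b) tensor \<Rightarrow> ('a, 'b) tensor" is "(-)"
proof -
  fix p p' q q' :: "'a \<times> 'b \<Rightarrow>\<^sub>0 rat"
  have "(p - q) - (p' - q') = (p - p') - (q - q')" by (simp add: algebra_simps)
  moreover assume "p - p' \<in> rat_vector.span tensor_relators"
    "q - q' \<in> rat_vector.span tensor_relators"
  ultimately show "(p - q) - (p' - q') \<in> rat_vector.span tensor_relators"
    by (metis rat_vector.span_diff)
qed

lift_definition uminus_tensor :: "('a, 'b) tensor \<Rightarrow> ('a, 'b) tensor" is uminus
  by (metis minus_diff_minus rat_vector.span_neg)

lift_definition scaleQ_tensor :: "rat \<Rightarrow> ('a, 'b) tensor \<Rightarrow> ('a, 'b) tensor" is scaleQ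
  by (metis rat_vector.scale_right_diff_distrib rat_vector.span_scale)

instance
  by standard (transfer, simp add: algebra_simps rat_vector.span_zero
      scaleQ_add_right scaleQ_add_left scaleQ_scaleQ scaleQ_one)+

end

lift_definition tensor :: "'a::rat_vector \<Rightarrow> 'b::rat_vector \<Rightarrow> ('a, 'b) tensor"  (infixr \<open>\<otimes>\<close> 76)
  is "\<lambda>a b. Poly_Mapping.single (a, b) 1" .

text \<open>Extension of a bilinear map to the tensor product; the choice of a representative is
  immaterial for bilinear \<open>F\<close>, see \<open>tensor_lift_tensor\<close>.\<close>

definition tensor_lift ::
    "('a::rat_vector \<Rightarrow> 'b::rat_vector \<Rightarrow> 'v::rat_vector) \<Rightarrow> ('a, 'b) tensor \<Rightarrow> 'v"
  where "tensor_lift F z = free_lift (case_prod F) (rep_tensor z)"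

lemma tensor_bilinear: "rat_bilinear (tensor :: 'a::rat_vector \<Rightarrow> 'b::rat_vector \<Rightarrow> _)"
proof (rule rat_bilinearI)
  fix a a' :: 'a and b b' :: 'b and c
  show "(a + a') \<otimes> b = a \<otimes> b + a' \<otimes> b"
    by transfer (rule rat_vector.span_base[OF tensor_relators.add_left])
  show "a \<otimes> (b + b') = a \<otimes> b + a \<otimes> b'"
    by transfer (rule rat_vector.span_base[OF tensor_relators.add_right])
  show "(c *\<^sub>Q a) \<otimes> b = c *\<^sub>Q (a \<otimes> b)"
    by transfer (rule rat_vector.span_base[OF tensor_relators.scale_left])
  show "a \<otimes> (c *\<^sub>Q b) = c *\<^sub>Q (a \<otimes> b)"
    by transfer (rule rat_vector.span_base[OF tensor_relators.scale_right])
qed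

lemma rat_bilinearD:
  assumes "rat_bilinear F"
  shows "F a (x + y) = F a x + F a y" "F a (c *\<^sub>Q x) = c *\<^sub>Q F a x"
    "F (x' + y') b = F x' b + F y' b" "F (c *\<^sub>Q x') b = c *\<^sub>Q F x' b"
proof -
  have "rat_linear (F a)" "rat_linear (\<lambda>a. F a b)"
    using assms unfolding rat_bilinear_def by blast+
  note this[THEN rat_linear_add] this[THEN rat_linear_scale]
  then show "F a (x + y) = F a x + F a y" "F a (c *\<^sub>Q x) = c *\<^sub>Q F a x"
    "F (x' + y') b = F x' b + F y' b" "F (c *\<^sub>Q x') b = c *\<^sub>Q F x' b"
    by blast+
qed

lemma rat_bilinear_add:
  assumes "rat_bilinear F" "rat_bilinear G"
  shows "rat_bilinear (\<lambda>a b. F a b + G a b)"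
  by (rule rat_bilinearI)
    (simp_all add: rat_bilinearD[OF assms(1)] rat_bilinearD[OF assms(2)] scaleQ_add_right)

lemma free_lift_relators:
  assumes "rat_bilinear F" "p \<in> rat_vector.span tensor_relators"
  shows "free_lift (case_prod F) p = 0"
  using assms(2)
proof (induction rule: rat_vector.span_induct_alt)
  case base
  show ?case by (rule rat_linear_zero[OF free_lift_linear])
next
  case (step c x y)
  note L = free_lift_linear[of "case_prod F"]
  have "free_lift (case_prod F) x = 0"
    using step(1)
    by induction (simp_all add: rat_linear_add[OF L] rat_linear_diff[OF L] rat_linear_scale[OF L]
        rat_bilinearD[OF assms(1)] scaleQ_one)
  with step(2) show ?case
    by (simp add: rat_linear_add[OF L] rat_linear_scale[OF L])
qed

lemmas abs_rep_tensor = Quotient3_abs_rep[OF Quotient3_tensor]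

lemma tensor_lift_abs:
  assumes "rat_bilinear F"
  shows "tensor_lift F (abs_tensor p) = free_lift (case_prod F) p"
proof -
  have "rep_tensor (abs_tensor p) - p \<in> rat_vector.span tensor_relators"
    by (simp only: tensor.abs_eq_iff[symmetric] abs_rep_tensor)
  from free_lift_relators[OF assms this] show ?thesis
    by (simp add: tensor_lift_def rat_linear_diff[OF free_lift_linear])
qed

lemma tensor_lift_tensor [simp]: "rat_bilinear F \<Longrightarrow> tensor_lift F (a \<otimes> b) = F a b"
  by (simp add: tensor.abs_eq tensor_lift_abs scaleQ_one)

lemma tensor_lift_linear:
  assumes "rat_bilinear F"
  shows "rat_linear (tensor_lift F)"
proof (rule rat_linearI)
  fix x y :: "('a, 'b) tensor" and c
  note L = free_lift_linear[of "case_prod F"]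
  obtain p q where "x = abs_tensor p" "y = abs_tensor q"
    using abs_rep_tensor by metis
  then show "tensor_lift F (x + y) = tensor_lift F x + tensor_lift F y"
    and "tensor_lift F (c *\<^sub>Q x) = c *\<^sub>Q tensor_lift F x"
    by (simp_all add: plus_tensor.abs_eq scaleQ_tensor.abs_eq tensor_lift_abs[OF assms]
        rat_linear_add[OF L] rat_linear_scale[OF L])
qed

lemma tensor_induct [case_names tensor add]:
  assumes "\<And>a b. P (a \<otimes> b)" and "\<And>x y. P x \<Longrightarrow> P y \<Longrightarrow> P (x + y)"
  shows "P z"
proof -
  obtain p where z: "z = abs_tensor p"
    using abs_rep_tensor by metis
  have single: "P (abs_tensor (Poly_Mapping.single x c))" for x c
  proof -
    have "abs_tensor (Poly_Mapping.single x c) = (c *\<^sub>Q fst x) \<otimes> snd x"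
      using rat_bilinearD(4)[OF tensor_bilinear, of c "fst x" "snd x"]
      by (simp add: tensor.abs_eq scaleQ_tensor.abs_eq scaleQ_single)
    then show ?thesis by (simp add: assms(1))
  qed
  have "P (abs_tensor (\<Sum>x\<in>A. Poly_Mapping.single x (Poly_Mapping.lookup p x)))" if "finite A" for A
    using that
  proof induction
    case empty
    show ?case using single[of _ 0] by simp
  next
    case (insert x A)
    then show ?case using assms(2)[OF single insert(3)] by (simp add: plus_tensor.abs_eq)
  qed
  from this[of "Poly_Mapping.keys p"] show ?thesis
    by (simp only: z finite_keys simp_thms poly_mapping_rat_expand[symmetric])
qed

lemma tensor_map_bilinear:
  fixes f :: "'a::rat_vector \<Rightarrow> 'c::rat_vector" and g :: "'b::rat_vector \<Rightarrow> 'd::rat_vector"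
  assumes "rat_linear f" "rat_linear g"
  shows "rat_bilinear (\<lambda>a b. f a \<otimes> g b)"
  by (rule rat_bilinearI)
    (simp_all add: rat_linear_add[OF assms(1)] rat_linear_add[OF assms(2)]
      rat_linear_scale[OF assms(1)] rat_linear_scale[OF assms(2)] rat_bilinearD[OF tensor_bilinear])

lemma mult_left_linear: "rat_linear ((*) (a :: 'a::rat_algebra_1))"
  by (rule rat_linearI) (simp_all add: distrib_left mult_scaleQ_right)

lemma rat_linear_functional_exists:
  fixes v :: "'a::rat_vector"
  assumes "v \<noteq> 0"
  obtains f :: "'a \<Rightarrow> rat" where "rat_linear f" "f v = 1"
proof -
  interpret vector_space_pair "scaleQ :: rat \<Rightarrow> 'a \<Rightarrow> 'a" "scaleQ :: rat \<Rightarrow> rat \<Rightarrow> rat" ..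
  have "\<not> rat_vector.dependent {v}"
    using assms by (simp add: rat_vector.dependent_single)
  from linear_independent_extend[OF this, of "\<lambda>_. 1"] show thesis
    using that by auto
qed

lemma tensor_times_bilinear_right:
  "rat_bilinear (\<lambda>c d. (a * c) \<otimes> (b * d))" for a :: "'a::rat_algebra_1" and b :: "'b::rat_algebra_1"
  by (intro tensor_map_bilinear mult_left_linear)

lemma tensor_times_bilinear_left:
  fixes y :: "('a::rat_algebra_1, 'b::rat_algebra_1) tensor"
  shows "rat_bilinear (\<lambda>a b. tensor_lift (\<lambda>c d. (a * c) \<otimes> (b * d)) y)"
proof (induction y rule: tensor_induct)
  case (tensor c d)
  show ?case
    unfolding tensor_lift_tensor[OF tensor_times_bilinear_right]
    by (rule rat_bilinearI) (simp_all add: algebra_simps rat_bilinearD[OF tensor_bilinear]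
        mult_scaleQ_left mult_scaleQ_right)
next
  case (add x y)
  then show ?case
    unfolding rat_linear_add[OF tensor_lift_linear[OF tensor_times_bilinear_right]]
    by (rule rat_bilinear_add)
qed

instantiation tensor :: (rat_algebra_1, rat_algebra_1) rat_algebra_1
begin

definition one_tensor :: "('a, 'b) tensor" where "1 = 1 \<otimes> 1"

definition times_tensor :: "('a, 'b) tensor \<Rightarrow> ('a, 'b) tensor \<Rightarrow> ('a, 'b) tensor"
  where "x * y = tensor_lift (\<lambda>a b. tensor_lift (\<lambda>c d. (a * c) \<otimes> (b * d)) y) x"

instance
proof
  note B1 = tensor_times_bilinear_right and B2 = tensor_times_bilinear_left
  note L1 = tensor_lift_linear[OF B1] and L2 = tensor_lift_linear[OF B2]
  have mult: "(a \<otimes> b) * (c \<otimes> d) = (a * c) \<otimes> (b * d)" for a c :: 'a and b d :: 'b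
    unfolding times_tensor_def tensor_lift_tensor[OF B2] by (rule tensor_lift_tensor[OF B1])
  fix x y z :: "('a, 'b) tensor" and q :: rat
  show dr: "(x + y) * z = x * z + y * z" for x y z :: "('a, 'b) tensor"
    by (simp add: times_tensor_def rat_linear_add[OF L2])
  show sl: "(q *\<^sub>Q x) * y = q *\<^sub>Q (x * y)" for x y :: "('a, 'b) tensor"
    by (simp add: times_tensor_def rat_linear_scale[OF L2])
  show dl: "x * (y + z) = x * y + x * z" for x y z :: "('a, 'b) tensor"
  proof (induction x rule: tensor_induct)
    case (tensor a b)
    show ?case
      unfolding times_tensor_def tensor_lift_tensor[OF B2] by (rule rat_linear_add[OF L1])
  next
    case (add x x')
    then show ?case by (simp add: dr)
  qed
  show "x * (q *\<^sub>Q y) = q *\<^sub>Q (x * y)"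
  proof (induction x rule: tensor_induct)
    case (tensor a b)
    show ?case
      unfolding times_tensor_def tensor_lift_tensor[OF B2] by (rule rat_linear_scale[OF L1])
  next
    case (add x x')
    then show ?case by (simp add: dr scaleQ_add_right)
  qed
  show "x * y * z = x * (y * z)"
  proof (induction x rule: tensor_induct)
    case (tensor a b)
    show ?case
    proof (induction y rule: tensor_induct)
      case (tensor c d)
      show ?case
        by (induction z rule: tensor_induct) (simp_all add: mult mult.assoc dl)
    qed (simp add: dr dl)
  qed (simp add: dr)
  show "1 * x = x"
    by (induction x rule: tensor_induct) (simp_all add: one_tensor_def mult dl)
  show "x * 1 = x"
    by (induction x rule: tensor_induct) (simp_all add: one_tensor_def mult dr)
  show "(0 :: ('a, 'b) tensor) \<noteq> 1"
  proof
    assume eq: "(0 :: ('a, 'b) tensor) = 1"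
    obtain f :: "'a \<Rightarrow> rat" where f: "rat_linear f" "f 1 = 1"
      using rat_linear_functional_exists[OF one_neq_zero] .
    obtain g :: "'b \<Rightarrow> rat" where g: "rat_linear g" "g 1 = 1"
      using rat_linear_functional_exists[OF one_neq_zero] .
    have B: "rat_bilinear (\<lambda>a b. f a * g b)"
      by (rule rat_bilinearI)
        (simp_all add: rat_linear_add[OF f(1)] rat_linear_add[OF g(1)] rat_linear_scale[OF f(1)]
          rat_linear_scale[OF g(1)] scaleQ_rat_def algebra_simps)
    have "tensor_lift (\<lambda>a b. f a * g b) (1 \<otimes> 1) = 1"
      by (simp add: tensor_lift_tensor[OF B] f g)
    then show False
      using rat_linear_zero[OF tensor_lift_linear[OF B]]
      by (simp only: one_tensor_def[symmetric] eq[symmetric] zero_neq_one)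
  qed
qed

end

lemma tensor_times: "(a \<otimes> b) * (c \<otimes> d) = (a * c) \<otimes> (b * d)"
  unfolding times_tensor_def tensor_lift_tensor[OF tensor_times_bilinear_left]
  by (rule tensor_lift_tensor[OF tensor_times_bilinear_right])


section \<open>Lie algebras and enveloping algebras\<close>

class rat_lie_algebra = rat_vector +
  fixes lie_bracket :: "'a \<Rightarrow> 'a \<Rightarrow> 'a"
  assumes lie_add_left: "lie_bracket (x + y) z = lie_bracket x z + lie_bracket y z"
    and lie_add_right: "lie_bracket x (y + z) = lie_bracket x y + lie_bracket x z"
    and lie_scale_left: "lie_bracket (c *\<^sub>Q x) y = c *\<^sub>Q lie_bracket x y"
    and lie_scale_right: "lie_bracket x (c *\<^sub>Q y) = c *\<^sub>Q lie_bracket x y"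
    and lie_self: "lie_bracket x x = 0"
    and lie_jacobi: "lie_bracket x (lie_bracket y z) + lie_bracket y (lie_bracket z x)
          + lie_bracket z (lie_bracket x y) = 0"

text \<open>
  With the convolution product, \<open>'a free_monoid \<Rightarrow>\<^sub>0 rat\<close> is the free associative unital
  algebra on the underlying set of \<open>'a\<close>.  Dividing by the additivity and homogeneity relations
  gives the tensor algebra of \<open>'a\<close>, so that the relations below present the enveloping algebra.
\<close>

datatype 'a free_monoid = Word "'a list"

instantiation free_monoid :: (type) monoid_add
begin

definition zero_free_monoid :: "'a free_monoid" where "0 = Word []"

fun plus_free_monoid :: "'a free_monoid \<Rightarrow> 'a free_monoid \<Rightarrow> 'a free_monoid"
  where "Word u + Word v = Word (u @ v)"

instance
proof
  fix a b c :: "'a free_monoid"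
  show "a + b + c = a + (b + c)" by (cases a; cases b; cases c) simp
  show "0 + a = a" "a + 0 = a" by (cases a; simp add: zero_free_monoid_def)+
qed

end

definition free_gen :: "'a \<Rightarrow> 'a free_monoid \<Rightarrow>\<^sub>0 rat"
  where "free_gen x = Poly_Mapping.single (Word [x]) 1"

inductive_set envelope_ideal :: "('a::rat_lie_algebra free_monoid \<Rightarrow>\<^sub>0 rat) set"
  where
    gen_add: "free_gen (x + y) - free_gen x - free_gen y \<in> envelope_ideal"
  | gen_scale: "free_gen (c *\<^sub>Q x) - c *\<^sub>Q free_gen x \<in> envelope_ideal"
  | gen_bracket: "free_gen x * free_gen y - free_gen y * free_gen x - free_gen (lie_bracket x y)
      \<in> envelope_ideal"
  | zero: "0 \<in> envelope_ideal"
  | add: "p \<in> envelope_ideal \<Longrightarrow> q \<in> envelope_ideal \<Longrightarrow> p + q \<in> envelope_ideal"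
  | mult_left: "p \<in> envelope_ideal \<Longrightarrow> a * p \<in> envelope_ideal"
  | mult_right: "p \<in> envelope_ideal \<Longrightarrow> p * a \<in> envelope_ideal"

lemma envelope_ideal_minus: "p \<in> envelope_ideal \<Longrightarrow> - p \<in> envelope_ideal"
  using envelope_ideal.mult_left[of p "- 1"] by simp

lemma envelope_ideal_diff:
  "p \<in> envelope_ideal \<Longrightarrow> q \<in> envelope_ideal \<Longrightarrow> p - q \<in> envelope_ideal"
  using envelope_ideal.add[OF _ envelope_ideal_minus, of p q] by simp

lemma scaleQ_free_algebra:
  fixes p :: "'m::monoid_add \<Rightarrow>\<^sub>0 rat"
  shows "c *\<^sub>Q p = Poly_Mapping.single 0 c * p" and "c *\<^sub>Q p = p * Poly_Mapping.single 0 c"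
proof -
  let ?s = "\<Sum>x\<in>Poly_Mapping.keys p. Poly_Mapping.single x (Poly_Mapping.lookup p x)"
  have "c *\<^sub>Q ?s = Poly_Mapping.single 0 c * ?s" "c *\<^sub>Q ?s = ?s * Poly_Mapping.single 0 c"
    by (simp_all only: rat_vector.scale_sum_right scaleQ_single sum_distrib_left sum_distrib_right
        mult_single add_0_left add_0_right mult.commute)
  then show "c *\<^sub>Q p = Poly_Mapping.single 0 c * p" "c *\<^sub>Q p = p * Poly_Mapping.single 0 c"
    by (simp_all only: poly_mapping_rat_expand[symmetric])
qed

lemma envelope_ideal_scale: "p \<in> envelope_ideal \<Longrightarrow> c *\<^sub>Q p \<in> envelope_ideal"
  unfolding scaleQ_free_algebra(1) by (rule envelope_ideal.mult_left)

quotient_type (overloaded) 'a envelope =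
  "'a::rat_lie_algebra free_monoid \<Rightarrow>\<^sub>0 rat" / "\<lambda>p q. p - q \<in> envelope_ideal"
proof (rule equivpI)
  show "reflp (\<lambda>p q :: 'a free_monoid \<Rightarrow>\<^sub>0 rat. p - q \<in> envelope_ideal)"
    by (rule reflpI) (simp add: envelope_ideal.zero)
  show "symp (\<lambda>p q :: 'a free_monoid \<Rightarrow>\<^sub>0 rat. p - q \<in> envelope_ideal)"
    by (rule sympI) (metis minus_diff_eq envelope_ideal_minus)
  show "transp (\<lambda>p q :: 'a free_monoid \<Rightarrow>\<^sub>0 rat. p - q \<in> envelope_ideal)"
    by (rule transpI) (drule (1) envelope_ideal.add, simp)
qed

lemma lookup_times_zero_free_monoid:
  fixes p q :: "'a free_monoid \<Rightarrow>\<^sub>0 rat"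
  shows "Poly_Mapping.lookup (p * q) 0 = Poly_Mapping.lookup p 0 * Poly_Mapping.lookup q 0"
proof -
  have zero: "x + y = 0 \<longleftrightarrow> x = 0 \<and> y = 0" for x y :: "'a free_monoid"
    by (cases x; cases y) (simp add: zero_free_monoid_def)
  have "Poly_Mapping.lookup (p * q) 0 =
      (\<Sum>x\<in>Poly_Mapping.keys p. \<Sum>y\<in>Poly_Mapping.keys q.
        if x = 0 \<and> y = 0 then Poly_Mapping.lookup p x * Poly_Mapping.lookup q y else 0)"
    by (subst poly_mapping_rat_mult) (simp add: lookup_sum lookup_single when_def zero)
  also have "\<dots> = (\<Sum>x\<in>Poly_Mapping.keys p. if x = 0 then Poly_Mapping.lookup p x *
       (\<Sum>y\<in>Poly_Mapping.keys q. if y = 0 then Poly_Mapping.lookup q y else 0) else 0)"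
    by (intro sum.cong) (auto simp: sum_distrib_left intro!: sum.cong)
  also have "\<dots> = Poly_Mapping.lookup p 0 * Poly_Mapping.lookup q 0"
    by (auto simp: sum.delta in_keys_iff)
  finally show ?thesis .
qed

lemma free_gen_0: "Poly_Mapping.lookup (free_gen x) 0 = 0"
  by (simp add: free_gen_def lookup_single zero_free_monoid_def)

lemma lookup_zero_envelope_ideal: "p \<in> envelope_ideal \<Longrightarrow> Poly_Mapping.lookup p 0 = 0"
proof (induction rule: envelope_ideal.induct)
qed (simp_all add: lookup_minus lookup_add lookup_times_zero_free_monoid free_gen_0
      scaleQ_poly_mapping.rep_eq scaleQ_rat_def)

instantiation envelope :: (rat_lie_algebra) rat_algebra_1
begin

lift_definition zero_envelope :: "'a envelope" is 0 .

lift_definition one_envelope :: "'a envelope" is 1 .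

lift_definition plus_envelope :: "'a envelope \<Rightarrow> 'a envelope \<Rightarrow> 'a envelope" is "(+)"
  by (drule (1) envelope_ideal.add) (simp add: algebra_simps)

lift_definition minus_envelope :: "'a envelope \<Rightarrow> 'a envelope \<Rightarrow> 'a envelope" is "(-)"
proof -
  fix p p' q q' :: "'a free_monoid \<Rightarrow>\<^sub>0 rat"
  have "(p - q) - (p' - q') = (p - p') - (q - q')" by (simp add: algebra_simps)
  moreover assume "p - p' \<in> envelope_ideal" "q - q' \<in> envelope_ideal"
  ultimately show "(p - q) - (p' - q') \<in> envelope_ideal"
    by (metis envelope_ideal_diff)
qed

lift_definition uminus_envelope :: "'a envelope \<Rightarrow> 'a envelope" is uminus
  by (metis minus_diff_minus envelope_ideal_minus)

lift_definition times_envelope :: "'a envelope \<Rightarrow> 'a envelope \<Rightarrow> 'a envelope" is "(*)"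
proof -
  fix p p' q q' :: "'a free_monoid \<Rightarrow>\<^sub>0 rat"
  have "p * q - p' * q' = (p - p') * q + p' * (q - q')" by (simp add: algebra_simps)
  moreover assume "p - p' \<in> envelope_ideal" "q - q' \<in> envelope_ideal"
  ultimately show "p * q - p' * q' \<in> envelope_ideal"
    by (metis envelope_ideal.add envelope_ideal.mult_left envelope_ideal.mult_right)
qed

lift_definition scaleQ_envelope :: "rat \<Rightarrow> 'a envelope \<Rightarrow> 'a envelope" is scaleQ
  by (metis rat_vector.scale_right_diff_distrib envelope_ideal_scale)

instance
proof
  show "(0 :: 'a envelope) \<noteq> 1"
    by transfer (auto dest!: lookup_zero_envelope_ideal simp: lookup_one lookup_minus)
  fix c and x y :: "'a envelope"
  show "(c *\<^sub>Q x) * y = c *\<^sub>Q (x * y)"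
    by transfer (simp add: scaleQ_free_algebra(1) mult.assoc envelope_ideal.zero)
  show "x * (c *\<^sub>Q y) = c *\<^sub>Q (x * y)"
    by transfer (simp add: scaleQ_free_algebra(2) mult.assoc envelope_ideal.zero)
qed (transfer, simp add: algebra_simps envelope_ideal.zero
      scaleQ_add_right scaleQ_add_left scaleQ_scaleQ scaleQ_one)+

end

lift_definition env :: "'a::rat_lie_algebra \<Rightarrow> 'a envelope" is free_gen .

lemma env_linear: "rat_linear (env :: 'a::rat_lie_algebra \<Rightarrow> 'a envelope)"
proof (rule rat_linearI)
  fix x y :: 'a and c
  show "env (x + y) = env x + env y"
    using envelope_ideal.gen_add[of x y] by transfer (simp only: diff_diff_eq)
  show "env (c *\<^sub>Q x) = c *\<^sub>Q env x"
    by transfer (rule envelope_ideal.gen_scale)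
qed

lemma env_bracket: "env (lie_bracket x y) = env x * env y - env y * env x"
  using envelope_ideal_minus[OF envelope_ideal.gen_bracket[of x y]]
  by transfer (simp only: minus_diff_eq)


section \<open>The Witt algebra\<close>

typedef witt = "UNIV :: (int \<Rightarrow>\<^sub>0 rat) set"
  morphisms witt_coeffs Witt ..

setup_lifting type_definition_witt

definition witt_bracket :: "(int \<Rightarrow>\<^sub>0 rat) \<Rightarrow> (int \<Rightarrow>\<^sub>0 rat) \<Rightarrow> (int \<Rightarrow>\<^sub>0 rat)"
  where "witt_bracket p q =
    (\<Sum>r\<in>Poly_Mapping.keys p. \<Sum>s\<in>Poly_Mapping.keys q. Poly_Mapping.single (r + s)
       (Poly_Mapping.lookup p r * Poly_Mapping.lookup q s * of_int (s - r)))"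

text \<open>\<open>x d/dx\<close> on Laurent polynomials, used only to verify the Jacobi identity.\<close>

definition euler_deriv :: "(int \<Rightarrow>\<^sub>0 rat) \<Rightarrow> (int \<Rightarrow>\<^sub>0 rat)"
  where "euler_deriv = free_lift (\<lambda>r. Poly_Mapping.single r (of_int r))"

lemma euler_deriv_linear: "rat_linear euler_deriv"
  unfolding euler_deriv_def by (rule free_lift_linear)

lemma euler_deriv_single:
  "euler_deriv (Poly_Mapping.single r c) = Poly_Mapping.single r (c * of_int r)"
  by (simp add: euler_deriv_def scaleQ_single)

lemma euler_deriv_eq: "euler_deriv p =
    (\<Sum>r\<in>Poly_Mapping.keys p. Poly_Mapping.single r (Poly_Mapping.lookup p r * of_int r))"
  by (simp add: euler_deriv_def free_lift_def scaleQ_single)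

lemma laurent_mult_euler_eq: "p * euler_deriv q =
    (\<Sum>r\<in>Poly_Mapping.keys p. \<Sum>s\<in>Poly_Mapping.keys q. Poly_Mapping.single (r + s)
      (Poly_Mapping.lookup p r * (Poly_Mapping.lookup q s * of_int s)))"
  by (simp only: sum_single_mult[symmetric] poly_mapping_rat_expand[symmetric] euler_deriv_eq)

lemma laurent_euler_mult_eq: "euler_deriv p * q =
    (\<Sum>r\<in>Poly_Mapping.keys p. \<Sum>s\<in>Poly_Mapping.keys q. Poly_Mapping.single (r + s)
      (Poly_Mapping.lookup p r * of_int r * Poly_Mapping.lookup q s))"
  by (simp only: sum_single_mult[symmetric] poly_mapping_rat_expand[symmetric] euler_deriv_eq)

lemma euler_deriv_mult: "euler_deriv (p * q) = euler_deriv p * q + p * euler_deriv q"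
  unfolding laurent_mult_euler_eq laurent_euler_mult_eq
  by (subst poly_mapping_rat_mult)
    (simp add: rat_linear_sum[OF euler_deriv_linear] sum.distrib[symmetric] single_add[symmetric]
      euler_deriv_single algebra_simps)

lemma witt_bracket_eq: "witt_bracket p q = p * euler_deriv q - euler_deriv p * q"
  unfolding laurent_mult_euler_eq laurent_euler_mult_eq witt_bracket_def
  by (simp add: sum_subtractf[symmetric] single_diff[symmetric] algebra_simps)

instantiation witt :: rat_lie_algebra
begin

lift_definition zero_witt :: witt is 0 .
lift_definition plus_witt :: "witt \<Rightarrow> witt \<Rightarrow> witt" is "(+)" .
lift_definition minus_witt :: "witt \<Rightarrow> witt \<Rightarrow> witt" is "(-)" .
lift_definition uminus_witt :: "witt \<Rightarrow> witt" is uminus .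
lift_definition scaleQ_witt :: "rat \<Rightarrow> witt \<Rightarrow> witt" is scaleQ .
lift_definition lie_bracket_witt :: "witt \<Rightarrow> witt \<Rightarrow> witt" is witt_bracket .

instance
proof
  note E = rat_linear_add[OF euler_deriv_linear] rat_linear_diff[OF euler_deriv_linear]
    rat_linear_scale[OF euler_deriv_linear] euler_deriv_mult
  fix x y z :: witt and c
  show "lie_bracket (c *\<^sub>Q x) y = c *\<^sub>Q lie_bracket x y"
    by transfer (simp add: witt_bracket_eq E euler_deriv_single scaleQ_free_algebra(1) algebra_simps)
  show "lie_bracket x (c *\<^sub>Q y) = c *\<^sub>Q lie_bracket x y"
    by transfer (simp add: witt_bracket_eq E euler_deriv_single scaleQ_free_algebra(1) algebra_simps)
  show "lie_bracket (x + y) z = lie_bracket x z + lie_bracket y z"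
    by transfer (simp add: witt_bracket_eq E algebra_simps)
  show "lie_bracket x (y + z) = lie_bracket x y + lie_bracket x z"
    by transfer (simp add: witt_bracket_eq E algebra_simps)
  show "lie_bracket x x = 0"
    by transfer (simp add: witt_bracket_eq)
  show "lie_bracket x (lie_bracket y z) + lie_bracket y (lie_bracket z x)
          + lie_bracket z (lie_bracket x y) = 0"
    by transfer (simp add: witt_bracket_eq E algebra_simps)
qed (transfer, simp add: algebra_simps scaleQ_add_right scaleQ_add_left scaleQ_scaleQ scaleQ_one)+

end

lift_definition witt_basis :: "int \<Rightarrow> witt" is "\<lambda>r. Poly_Mapping.single r 1" .

lemma lie_bracket_witt_basis:
  "lie_bracket (witt_basis r) (witt_basis s) = of_int (s - r) *\<^sub>Q witt_basis (r + s)"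
  by transfer (simp add: witt_bracket_def scaleQ_single lookup_single)

abbreviation L :: "int \<Rightarrow> witt envelope"
  where "L r \<equiv> env (witt_basis r)"


section \<open>Topological Hopf algebras over \<open>\<rat>[[t]]\<close>\<close>

text \<open>
  The completed tensor product of \<open>A[[t]]\<close> and \<open>B[[t]]\<close> over \<open>\<rat>[[t]]\<close> is \<open>(A \<otimes> B)[[t]]\<close>.
  Linear maps over \<open>\<rat>[[t]]\<close> between such modules are automatically \<open>t\<close>-adically continuous, and
  hence determined by their values on constant series.  The topology on \<open>'a fps\<close> (as used by
  \<open>sums\<close>) is the \<open>t\<close>-adic one, and \<open>t\<close> is \<open>fps_X\<close>.
\<close>

definition fps_scale :: "rat fps \<Rightarrow> 'a::rat_vector fps \<Rightarrow> 'a fps"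
  where "fps_scale c x = Abs_fps (\<lambda>n. \<Sum>k=0..n. fps_nth c k *\<^sub>Q fps_nth x (n - k))"

lemma fps_scale_module: "module (fps_scale :: rat fps \<Rightarrow> 'a::rat_vector fps \<Rightarrow> 'a fps)"
proof
  fix a b :: "rat fps" and x y :: "'a fps"
  show "fps_scale a (x + y) = fps_scale a x + fps_scale a y"
    by (simp add: fps_eq_iff fps_scale_def scaleQ_add_right sum.distrib)
  show "fps_scale (a + b) x = fps_scale a x + fps_scale b x"
    by (simp add: fps_eq_iff fps_scale_def scaleQ_add_left sum.distrib)
  show "fps_scale 1 x = x"
  proof (rule fps_ext)
    fix n
    have "fps_nth (fps_scale 1 x) n = (\<Sum>k=0..n. if k = 0 then fps_nth x n else 0)"
      unfolding fps_scale_def fps_nth_Abs_fps by (intro sum.cong) auto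
    then show "fps_nth (fps_scale 1 x) n = fps_nth x n" by simp
  qed
  show "fps_scale a (fps_scale b x) = fps_scale (a * b) x"
  proof (rule fps_ext)
    fix n
    have "fps_nth (fps_scale a (fps_scale b x)) n = (\<Sum>k=0..n. \<Sum>j=0..n - k.
        (fps_nth a k * fps_nth b j) *\<^sub>Q fps_nth x (n - k - j))"
      by (simp add: fps_scale_def rat_vector.scale_sum_right)
    also have "\<dots> = (\<Sum>m=0..n. \<Sum>k=0..m.
        (fps_nth a k * fps_nth b (m - k)) *\<^sub>Q fps_nth x (n - m))"
      by (subst sum.Sigma, simp, simp, subst sum.Sigma, simp, simp)
        (intro sum.reindex_bij_witness[where i = "\<lambda>(m, k). (k, m - k)"
          and j = "\<lambda>(k, j). (k + j, k)"]; auto simp: diff_diff_eq)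
    also have "\<dots> = fps_nth (fps_scale (a * b) x) n"
      by (simp add: fps_scale_def fps_mult_nth rat_vector.scale_sum_left)
    finally show "fps_nth (fps_scale a (fps_scale b x)) n = fps_nth (fps_scale (a * b) x) n" .
  qed
qed

definition fps_map :: "('a::zero \<Rightarrow> 'b::zero) \<Rightarrow> 'a fps \<Rightarrow> 'b fps"
  where "fps_map f x = Abs_fps (\<lambda>n. f (fps_nth x n))"

definition fps_tensor :: "'a::rat_vector fps \<Rightarrow> 'b::rat_vector fps \<Rightarrow> ('a, 'b) tensor fps"
    (infixr \<open>\<otimes>\<^sub>t\<close> 76)
  where "x \<otimes>\<^sub>t y = Abs_fps (\<lambda>n. \<Sum>k=0..n. fps_nth x k \<otimes> fps_nth y (n - k))"

text \<open>The continuous \<open>\<rat>[[t]]\<close>-linear extension \<open>\<Sum>a\<^sub>k t\<^sup>k \<mapsto> \<Sum>F(a\<^sub>k) t\<^sup>k\<close> of a linear map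
  \<open>F : A \<rightarrow> B[[t]]\<close>.\<close>

definition fps_extend :: "('a::rat_vector \<Rightarrow> 'b::rat_vector fps) \<Rightarrow> 'a fps \<Rightarrow> 'b fps"
  where "fps_extend F x = Abs_fps (\<lambda>n. \<Sum>k=0..n. fps_nth (F (fps_nth x k)) (n - k))"

text \<open>The completed tensor product of two \<open>\<rat>[[t]]\<close>-linear maps.\<close>

definition fps_tensor_map ::
    "('a::rat_vector fps \<Rightarrow> 'c::rat_vector fps) \<Rightarrow> ('b::rat_vector fps \<Rightarrow> 'd::rat_vector fps) \<Rightarrow>
     ('a, 'b) tensor fps \<Rightarrow> ('c, 'd) tensor fps"
  where "fps_tensor_map f g =
    fps_extend (tensor_lift (\<lambda>a b. f (fps_const a) \<otimes>\<^sub>t g (fps_const b)))"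

definition tensor_assoc :: "(('a::rat_vector, 'b::rat_vector) tensor, 'c::rat_vector) tensor
    \<Rightarrow> ('a, ('b, 'c) tensor) tensor"
  where "tensor_assoc = tensor_lift (\<lambda>u c. tensor_lift (\<lambda>a b. a \<otimes> (b \<otimes> c)) u)"

definition tensor_flip :: "('a::rat_vector, 'b::rat_vector) tensor \<Rightarrow> ('b, 'a) tensor"
  where "tensor_flip = tensor_lift (\<lambda>a b. b \<otimes> a)"

text \<open>The canonical isomorphisms of \<open>\<rat> \<otimes> A\<close> and \<open>A \<otimes> \<rat>\<close> with \<open>A\<close>.\<close>

definition tensor_unit_left :: "(rat, 'a::rat_vector) tensor \<Rightarrow> 'a"
  where "tensor_unit_left = tensor_lift (\<lambda>c a. c *\<^sub>Q a)"

definition tensor_unit_right :: "('a::rat_vector, rat) tensor \<Rightarrow> 'a"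
  where "tensor_unit_right = tensor_lift (\<lambda>a c. c *\<^sub>Q a)"

definition tensor_mult :: "('a::rat_algebra_1, 'a) tensor \<Rightarrow> 'a"
  where "tensor_mult = tensor_lift (*)"

locale fps_hopf_algebra =
  fixes comult :: "'a::rat_algebra_1 fps \<Rightarrow> ('a, 'a) tensor fps"
    and antipode :: "'a fps \<Rightarrow> 'a fps"
    and counit :: "'a fps \<Rightarrow> rat fps"
  assumes comult_linear: "module_hom fps_scale fps_scale comult"
    and comult_one: "comult 1 = 1"
    and comult_mult: "comult (x * y) = comult x * comult y"
    and counit_linear: "module_hom fps_scale fps_scale counit"
    and counit_one: "counit 1 = 1"
    and counit_mult: "counit (x * y) = counit x * counit y"
    and antipode_linear: "module_hom fps_scale fps_scale antipode"
    and coassoc: "fps_map tensor_assoc (fps_tensor_map comult id (comult x)) =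
          fps_tensor_map id comult (comult x)"
    and counit_left: "fps_map tensor_unit_left (fps_tensor_map counit id (comult x)) = x"
    and counit_right: "fps_map tensor_unit_right (fps_tensor_map id counit (comult x)) = x"
    and antipode_left:
      "fps_map tensor_mult (fps_tensor_map antipode id (comult x)) = fps_scale (counit x) 1"
    and antipode_right:
      "fps_map tensor_mult (fps_tensor_map id antipode (comult x)) = fps_scale (counit x) 1"

definition fps_cocommutative :: "('a::rat_vector fps \<Rightarrow> ('a, 'a) tensor fps) \<Rightarrow> bool"
  where "fps_cocommutative comult \<longleftrightarrow> (\<forall>x. fps_map tensor_flip (comult x) = comult x)"


section \<open>The elements occurring in the deformed structure\<close>

text \<open>\<open>pochhammer\<close> requires a commutative ring.\<close>

fun rising :: "'a::ring_1 \<Rightarrow> nat \<Rightarrow> 'a"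
  where
    "rising x 0 = 1"
  | "rising x (Suc n) = rising x n * (x + of_nat n)"

text \<open>The binomial series of \<open>(1 - a t)\<^sup>c\<close>.\<close>

definition one_minus_pow :: "'a::rat_algebra_1 \<Rightarrow> rat \<Rightarrow> 'a fps"
  where "one_minus_pow a c = Abs_fps (\<lambda>n. ((- 1) ^ n * (c gchoose n)) *\<^sub>Q a ^ n)"

definition witt_h :: "int \<Rightarrow> witt envelope"
  where "witt_h i = (1 / of_int i) *\<^sub>Q L 0"

definition witt_e :: "int \<Rightarrow> witt envelope"
  where "witt_e i = of_int i *\<^sub>Q L i"

definition witt_coeff :: "int \<Rightarrow> int \<Rightarrow> nat \<Rightarrow> rat"
  where "witt_coeff i k l =
    of_int i ^ l * (\<Prod>j = -1..int l - 2. of_int (k + j * i)) / fact l"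

end

theory Submission
  imports Defs
begin

text \<open>
  The structure is a Drinfeld twist of the standard one.  Since \<open>[h, e] = e\<close>, the element
  \<open>F = (1 - 1 \<otimes> et)\<^bsup>h \<otimes> 1\<^esup> = \<Sum>\<^sub>n (-1)\<^sup>n (h choose n) \<otimes> e\<^sup>n t\<^sup>n\<close> satisfies the
  2-cocycle identity, so that \<open>\<Delta> x = F \<Delta>\<^sub>0(x) F\<^sup>-\<^sup>1\<close> is a coassociative homomorphism with antipode
  \<open>S x = Q S\<^sub>0(x) Q\<^sup>-\<^sup>1\<close>, where \<open>Q = m(id \<otimes> S\<^sub>0)(F) = \<Sum>\<^sub>n (h choose n) e\<^sup>n t\<^sup>n\<close> and
  \<open>Q\<^sup>-\<^sup>1 = \<Sum>\<^sub>n (-1)\<^sup>n (h choose n) e\<^sup>n t\<^sup>n\<close>.  The closed formulas come from commuting \<open>L\<^sub>k\<close> past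
  \<open>e\<^sup>n\<close>, which produces \<open>ad(e)\<^sup>l(L\<^sub>k) / l!\<close>, a multiple of \<open>L\<^bsub>k + li\<^esub>\<close>, and recollecting the
  binomial series.
\<close>

section \<open>Sums of the form \<open>\<Sum>x\<^sub>n t\<^sup>n\<close>\<close>

text \<open>The Hopf structure rests on [h, e] = e alone, so it is built for any Lie algebra with
  such a pair \<open>H\<close>, \<open>E\<close>. W itself enters the formulas through two facts.
  L_k has weight k/i under ad(h), so moving F past L_k \<otimes> 1 shifts the exponent by k/i and
  leaves (1 - et)^(k/i). And [i L_i, L_{k+li}] = i (k + (l-1) i) L_{k+(l+1)i}, whose case l = 0
  explains why the product in \<open>witt_coeff\<close> starts at j = -1.

  The two legs of F commute, so F is inverted by changing the sign of h. In Q the letters h and e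
  live in one algebra, and e h = (h - 1) e has the effect that the inverse changes the sign of e and
  keeps the exponent h.

  S0 reverses products, so identities for Q cannot be obtained by applying a homomorphism to those
  for F. They are phrased instead through the actions m \<mapsto> S0(a) m b and m \<mapsto> a m
  S0(b) of U(W) \<otimes> U(W) on U(W), under which the factors of F \<Delta>0(x) F^-1 can be
  applied one at a time.\<close>

definition fps_tsum :: "(nat \<Rightarrow> 'a::comm_monoid_add fps) \<Rightarrow> 'a fps"
  where "fps_tsum x = Abs_fps (\<lambda>n. \<Sum>k=0..n. fps_nth (x k) (n - k))"

lemma fps_tsum_nth: "fps_nth (fps_tsum x) n = (\<Sum>k=0..n. fps_nth (x k) (n - k))"
  by (simp add: fps_tsum_def)

lemma fps_tsum_nth_0: "fps_nth (fps_tsum x) 0 = fps_nth (x 0) 0"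
  by (simp add: fps_tsum_nth)

lemma fps_tsum_nth_Suc:
  "fps_nth (fps_tsum x) (Suc n) = fps_nth (x 0) (Suc n) + fps_nth (fps_tsum (\<lambda>k. x (Suc k))) n"
  by (simp add: fps_tsum_nth sum.atLeast0_atMost_Suc_shift del: sum.cl_ivl_Suc)

text \<open>Only summands with k <= n reach the coefficient of t^n, so each coefficient of the
  partial sums is eventually constant, which is t-adic convergence. This ties the finite-sum
  definition to the \<open>sums\<close> in the theorem.\<close>

lemma fps_tsum_sums:
  fixes x :: "nat \<Rightarrow> 'a::rat_algebra_1 fps"
  shows "(\<lambda>n. x n * fps_X ^ n) sums fps_tsum x"
  unfolding sums_def
proof (rule tendsto_fpsI)
  fix n
  have "fps_nth (\<Sum>k<m. x k * fps_X ^ k) n = fps_nth (fps_tsum x) n" if "m > n" for m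
  proof -
    have "fps_nth (\<Sum>k<m. x k * fps_X ^ k) n
        = (\<Sum>k<m. if n < k then 0 else fps_nth (x k) (n - k))"
      by (simp add: fps_sum_nth fps_X_power_mult_right_nth)
    also have "\<dots> = fps_nth (fps_tsum x) n"
      unfolding fps_tsum_nth using that by (intro sum.mono_neutral_cong_right) auto
    finally show ?thesis .
  qed
  then show "\<forall>\<^sub>F m in sequentially. fps_nth (\<Sum>k<m. x k * fps_X ^ k) n = fps_nth (fps_tsum x) n"
    by (auto simp: eventually_sequentially intro!: exI[of _ "Suc n"])
qed

lemma fps_tsum_cong: "(\<And>n. x n = y n) \<Longrightarrow> fps_tsum x = fps_tsum y"
  by presburger

lemma fps_tsum_add: "fps_tsum (\<lambda>n. x n + y n) = fps_tsum x + fps_tsum y"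
  by (simp add: fps_eq_iff fps_tsum_nth sum.distrib)

lemma fps_tsum_const: "fps_tsum (\<lambda>n. fps_const (u n)) = Abs_fps u"
proof (rule fps_ext)
  fix n
  have "fps_nth (fps_tsum (\<lambda>n. fps_const (u n))) n = (\<Sum>k=0..n. if k = n then u k else 0)"
    unfolding fps_tsum_nth by (intro sum.cong) auto
  then show "fps_nth (fps_tsum (\<lambda>n. fps_const (u n))) n = fps_nth (Abs_fps u) n" by simp
qed

text \<open>A Horner-type recursion. Since t is central, it lets the product rules below go by
  induction on the coefficient index, generalized over the sequence.\<close>

lemma fps_tsum_X:
  "fps_tsum x = x 0 + fps_X * fps_tsum (\<lambda>n. x (Suc n))" for x :: "nat \<Rightarrow> 'a::ring_1 fps"
proof (rule fps_ext)
  fix n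
  show "fps_nth (fps_tsum x) n = fps_nth (x 0 + fps_X * fps_tsum (\<lambda>n. x (Suc n))) n"
    by (cases n) (simp_all add: fps_tsum_nth_0 fps_tsum_nth_Suc)
qed

lemma fps_mult_tsum: "y * fps_tsum x = fps_tsum (\<lambda>n. y * x n)" for y :: "'a::ring_1 fps"
proof (rule fps_ext)
  fix n
  have X: "y * fps_tsum x = y * x 0 + fps_X * (y * fps_tsum (\<lambda>n. x (Suc n)))" for x
    by (subst fps_tsum_X)
      (simp add: distrib_left mult.assoc[symmetric] fps_mult_fps_X_commute[of y, symmetric])
  show "fps_nth (y * fps_tsum x) n = fps_nth (fps_tsum (\<lambda>n. y * x n)) n"
  proof (induction n arbitrary: x)
    case 0
    show ?case by (simp add: fps_tsum_nth_0)
  next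
    case (Suc n)
    show ?case unfolding X[of x] by (simp add: fps_tsum_nth_Suc Suc)
  qed
qed

lemma fps_tsum_mult: "fps_tsum x * y = fps_tsum (\<lambda>n. x n * y)" for y :: "'a::ring_1 fps"
proof (rule fps_ext)
  fix n
  have X: "fps_tsum x * y = x 0 * y + fps_X * (fps_tsum (\<lambda>n. x (Suc n)) * y)" for x
    by (subst fps_tsum_X) (simp add: distrib_right mult.assoc)
  show "fps_nth (fps_tsum x * y) n = fps_nth (fps_tsum (\<lambda>n. x n * y)) n"
  proof (induction n arbitrary: x)
    case 0
    show ?case by (simp add: fps_tsum_nth_0)
  next
    case (Suc n)
    show ?case unfolding X[of x] by (simp add: fps_tsum_nth_Suc Suc)
  qed
qed

text \<open>Both sides group a double series by total degree. It resums a finite expansion of each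
  coefficient into a series of binomial series.\<close>

lemma fps_tsum_tsum:
  "fps_tsum (\<lambda>l. fps_tsum (y l)) = fps_tsum (\<lambda>n. \<Sum>l=0..n. y l (n - l))"
proof (rule fps_ext)
  fix n
  show "fps_nth (fps_tsum (\<lambda>l. fps_tsum (y l))) n
    = fps_nth (fps_tsum (\<lambda>n. \<Sum>l=0..n. y l (n - l))) n"
  proof (induction n arbitrary: y)
    case 0
    show ?case by (simp add: fps_tsum_nth_0)
  next
    case (Suc n)
    have "(\<lambda>k. \<Sum>l=0..Suc k. y l (Suc k - l)) = (\<lambda>k. y 0 (Suc k) + (\<Sum>l=0..k. y (Suc l) (k - l)))"
      by (simp add: sum.atLeast0_atMost_Suc_shift del: sum.cl_ivl_Suc)
    then show ?case
      by (simp add: fps_tsum_nth_Suc Suc fps_tsum_add add.assoc del: sum.cl_ivl_Suc)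
  qed
qed


section \<open>Convolution along a bilinear map\<close>

text \<open>One Cauchy product for an arbitrary pairing: multiplication, scalar action,
  \<open>\<otimes>\<^sub>t\<close> and both antipode actions are instances, and their mixed
  associativity laws come from \<open>fps_conv_assoc\<close>.\<close>

definition fps_conv :: "('a::zero \<Rightarrow> 'b::zero \<Rightarrow> 'c::comm_monoid_add) \<Rightarrow> 'a fps \<Rightarrow> 'b fps \<Rightarrow> 'c fps"
  where "fps_conv B x y = Abs_fps (\<lambda>n. \<Sum>k=0..n. B (fps_nth x k) (fps_nth y (n - k)))"

lemma fps_conv_nth: "fps_nth (fps_conv B x y) n = (\<Sum>k=0..n. B (fps_nth x k) (fps_nth y (n - k)))"
  by (simp add: fps_conv_def)

lemma rat_bilinear_sum:
  assumes "rat_bilinear B"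
  shows "B (sum f A) y = (\<Sum>a\<in>A. B (f a) y)" and "B x (sum g A) = (\<Sum>a\<in>A. B x (g a))"
proof -
  have "rat_linear (\<lambda>a. B a y)" "rat_linear (B x)"
    using assms unfolding rat_bilinear_def by blast+
  from this[THEN rat_linear_sum] show "B (sum f A) y = (\<Sum>a\<in>A. B (f a) y)"
    and "B x (sum g A) = (\<Sum>a\<in>A. B x (g a))" by simp_all
qed

lemma rat_bilinear_zero:
  assumes "rat_bilinear B"
  shows "B 0 y = 0" and "B x 0 = 0"
  using rat_bilinear_sum[OF assms, where A = "{}"] by simp_all

lemma fps_conv_assoc:
  assumes "rat_bilinear B1" "rat_bilinear B3"
    and "\<And>a b c. B1 (B2 a b) c = B3 a (B4 b c)"
  shows "fps_conv B1 (fps_conv B2 x y) z = fps_conv B3 x (fps_conv B4 y z)"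
proof (rule fps_ext)
  fix n
  have "(\<Sum>j=0..n. \<Sum>i=0..j. B3 (fps_nth x i) (B4 (fps_nth y (j - i)) (fps_nth z (n - j))))
      = (\<Sum>j=0..n. \<Sum>i=0..n - j. B3 (fps_nth x j) (B4 (fps_nth y i) (fps_nth z (n - j - i))))"
    by (rule fps_mult_assoc_lemma)
  then show "fps_nth (fps_conv B1 (fps_conv B2 x y) z) n = fps_nth (fps_conv B3 x (fps_conv B4 y z)) n"
    by (simp add: fps_conv_nth rat_bilinear_sum[OF assms(1)] rat_bilinear_sum[OF assms(2)] assms(3))
qed

lemma rat_bilinear_mult: "rat_bilinear ((*) :: 'a::rat_algebra_1 \<Rightarrow> 'a \<Rightarrow> 'a)"
  by (rule rat_bilinearI) (simp_all add: algebra_simps mult_scaleQ_left mult_scaleQ_right)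

lemma rat_bilinear_scaleQ: "rat_bilinear (scaleQ :: rat \<Rightarrow> 'a::rat_vector \<Rightarrow> 'a)"
  by (rule rat_bilinearI) (simp_all add: scaleQ_add_left scaleQ_add_right scaleQ_scaleQ scaleQ_rat_def mult.commute)

lemma fps_mult_conv: "x * y = fps_conv (*) x y"
  by (simp add: fps_eq_iff fps_conv_nth fps_mult_nth)

lemma fps_scale_conv: "fps_scale = fps_conv scaleQ"
  by (simp add: fun_eq_iff fps_eq_iff fps_conv_nth fps_scale_def)

lemma fps_tensor_conv: "fps_tensor = fps_conv tensor"
  by (simp add: fun_eq_iff fps_eq_iff fps_conv_nth fps_tensor_def)

lemma fps_conv_const_right:
  assumes "rat_bilinear B"
  shows "fps_nth (fps_conv B x (fps_const b)) n = B (fps_nth x n) b"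
proof -
  have "fps_nth (fps_conv B x (fps_const b)) n = (\<Sum>k=0..n. if k = n then B (fps_nth x k) b else 0)"
    unfolding fps_conv_nth by (intro sum.cong) (auto simp: rat_bilinear_zero[OF assms])
  then show ?thesis by simp
qed

lemma fps_conv_const_left:
  assumes "rat_bilinear B"
  shows "fps_nth (fps_conv B (fps_const a) y) n = B a (fps_nth y n)"
proof -
  have "fps_nth (fps_conv B (fps_const a) y) n = (\<Sum>k=0..n. if k = 0 then B a (fps_nth y (n - k)) else 0)"
    unfolding fps_conv_nth by (intro sum.cong) (auto simp: rat_bilinear_zero[OF assms])
  then show ?thesis by simp
qed

lemma fps_conv_tsum:
  assumes "rat_bilinear B"
  shows "fps_conv B x y = fps_tsum (\<lambda>n. fps_conv B x (fps_const (fps_nth y n)))"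
proof (rule fps_ext)
  fix n
  have "fps_nth (fps_conv B x y) n = (\<Sum>k=0..n. B (fps_nth x (n - k)) (fps_nth y k))"
    unfolding fps_conv_nth
    by (rule sum.reindex_bij_witness[where i = "\<lambda>k. n - k" and j = "\<lambda>k. n - k"]) auto
  then show "fps_nth (fps_conv B x y) n
    = fps_nth (fps_tsum (\<lambda>n. fps_conv B x (fps_const (fps_nth y n)))) n"
    by (simp add: fps_tsum_nth fps_conv_const_right[OF assms])
qed

lemma fps_conv_cong_map:
  assumes "\<And>a b. B a b = C (f a) (g b)"
  shows "fps_conv B x y = fps_conv C (fps_map f x) (fps_map g y)"
  by (simp add: fps_eq_iff fps_conv_nth fps_map_def assms)

lemma fps_map_nth [simp]: "fps_nth (fps_map f x) n = f (fps_nth x n)"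
  by (simp add: fps_map_def)

lemma fps_map_conv:
  assumes "rat_linear f"
  shows "fps_map f (fps_conv B x y) = fps_conv (\<lambda>a b. f (B a b)) x y"
  by (simp add: fps_eq_iff fps_conv_nth rat_linear_sum[OF assms])

lemma fps_map_tsum:
  assumes "rat_linear f"
  shows "fps_map f (fps_tsum x) = fps_tsum (\<lambda>n. fps_map f (x n))"
  by (simp add: fps_eq_iff fps_tsum_nth rat_linear_sum[OF assms])

lemma fps_map_comp: "fps_map f (fps_map g x) = fps_map (\<lambda>a. f (g a)) x"
  by (simp add: fps_eq_iff)

lemma fps_map_linear: "rat_linear f \<Longrightarrow> rat_linear (fps_map f)"
  by (rule rat_linearI) (simp_all add: fps_eq_iff scaleQ_fps_def rat_linear_add rat_linear_scale)

lemma fps_map_add: "rat_linear f \<Longrightarrow> fps_map f (x + y) = fps_map f x + fps_map f y"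
  by (simp add: fps_eq_iff rat_linear_add)

lemma fps_map_const: "rat_linear f \<Longrightarrow> fps_map f (fps_const a) = fps_const (f a)"
  by (auto simp: fps_eq_iff rat_linear_zero)

lemma fps_const_linear: "rat_linear fps_const"
  by (rule rat_linearI) (auto simp: fps_eq_iff scaleQ_fps_def)

lemma fps_map_scale: "rat_linear f \<Longrightarrow> fps_map f (fps_scale c x) = fps_scale c (fps_map f x)"
  by (simp add: fps_eq_iff fps_scale_def rat_linear_sum rat_linear_scale)

lemma fps_scale_mult_left: "fps_scale c x * y = fps_scale c (x * y)"
  for x y :: "'a::rat_algebra_1 fps"
  unfolding fps_scale_conv fps_mult_conv
  by (rule fps_conv_assoc[OF rat_bilinear_mult rat_bilinear_scaleQ mult_scaleQ_left])

lemma fps_scale_mult_right: "y * fps_scale c x = fps_scale c (y * x)"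
  for x y :: "'a::rat_algebra_1 fps"
proof -
  \<comment> \<open>The scalar has to jump over \<open>y\<close>, which
    \<open>fps_conv_assoc\<close> does not express; as a right factor it reduces the claim to
    associativity of the product.\<close>
  have sc: "fps_scale c x = x * fps_scale c 1" for x :: "'a fps"
  proof (rule fps_ext)
    fix n
    have *: "fps_nth (fps_scale c 1) k = fps_nth c k *\<^sub>Q (1::'a)" for k
      using fps_conv_const_right[OF rat_bilinear_scaleQ, of c 1 k] by (simp add: fps_scale_conv)
    show "fps_nth (fps_scale c x) n = fps_nth (x * fps_scale c 1) n"
      unfolding fps_mult_nth * by (simp add: fps_scale_def mult_scaleQ_right)
        (auto intro!: sum.reindex_bij_witness[where i = "\<lambda>k. n - k" and j = "\<lambda>k. n - k"])
  qed
  show ?thesis by (simp only: sc[of x] sc[of "y * x"] mult.assoc)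
qed

lemma fps_extend_tsum: "fps_extend F x = fps_tsum (\<lambda>k. F (fps_nth x k))"
  by (simp add: fps_extend_def fps_tsum_def)

lemma fps_tensor_bilinear:
  fixes f :: "'a::rat_vector \<Rightarrow> 'c::rat_vector fps" and g :: "'b::rat_vector \<Rightarrow> 'd::rat_vector fps"
  assumes "rat_linear f" "rat_linear g"
  shows "rat_bilinear (\<lambda>a b. f a \<otimes>\<^sub>t g b)"
  by (rule rat_bilinearI)
    (simp_all add: fps_eq_iff fps_tensor_def rat_linear_add[OF assms(1)] rat_linear_add[OF assms(2)]
      rat_linear_scale[OF assms(1)] rat_linear_scale[OF assms(2)] rat_bilinearD[OF tensor_bilinear]
      scaleQ_fps_def sum.distrib rat_vector.scale_sum_right)


section \<open>Algebra homomorphisms\<close>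

definition alg_hom :: "('a::rat_algebra_1 \<Rightarrow> 'b::rat_algebra_1) \<Rightarrow> bool"
  where "alg_hom f \<longleftrightarrow> rat_linear f \<and> f 1 = 1 \<and> (\<forall>x y. f (x * y) = f x * f y)"

lemma alg_homI:
  assumes "rat_linear f" "f 1 = 1" "\<And>x y. f (x * y) = f x * f y"
  shows "alg_hom f"
  using assms by (simp add: alg_hom_def)

lemma alg_homD:
  assumes "alg_hom f"
  shows "rat_linear f" "f 1 = 1" "f (x * y) = f x * f y" "f (x + y) = f x + f y"
    "f (x - y) = f x - f y" "f 0 = 0" "f (c *\<^sub>Q x) = c *\<^sub>Q f x"
  using assms
  by (auto simp: alg_hom_def rat_linear_add rat_linear_diff rat_linear_zero rat_linear_scale)

lemma alg_hom_uminus: "alg_hom f \<Longrightarrow> f (- x) = - f x"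
  using alg_homD(5)[of f 0 x] alg_homD(6)[of f] by simp

lemma alg_hom_power: "alg_hom f \<Longrightarrow> f (x ^ n) = f x ^ n"
  by (induction n) (simp_all add: alg_homD)

lemma alg_hom_comp: "alg_hom f \<Longrightarrow> alg_hom g \<Longrightarrow> alg_hom (\<lambda>x. f (g x))"
  by (intro alg_homI rat_linearI) (simp_all add: alg_homD)

lemma fps_map_alg_hom:
  assumes "alg_hom f"
  shows "alg_hom (fps_map f)"
proof (rule alg_homI)
  show "fps_map f 1 = 1"
    by (simp add: fps_eq_iff alg_homD[OF assms])
  show "fps_map f (x * y) = fps_map f x * fps_map f y" for x y
    by (simp add: fps_eq_iff fps_mult_nth rat_linear_sum[OF alg_homD(1)[OF assms]] alg_homD(3)[OF assms])
qed (intro fps_map_linear alg_homD(1) assms)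

lemma alg_hom_id: "alg_hom (\<lambda>x. x)"
  by (intro alg_homI rat_linearI) simp_all

abbreviation tensor_left :: "'a::rat_algebra_1 \<Rightarrow> ('a, 'b::rat_algebra_1) tensor"
  where "tensor_left a \<equiv> a \<otimes> 1"

abbreviation tensor_right :: "'b::rat_algebra_1 \<Rightarrow> ('a::rat_algebra_1, 'b) tensor"
  where "tensor_right b \<equiv> 1 \<otimes> b"

lemma alg_hom_tensor_left: "alg_hom tensor_left"
  by (intro alg_homI rat_linearI) (simp_all add: rat_bilinearD[OF tensor_bilinear] tensor_times one_tensor_def)

lemma alg_hom_tensor_right: "alg_hom tensor_right"
  by (intro alg_homI rat_linearI) (simp_all add: rat_bilinearD[OF tensor_bilinear] tensor_times one_tensor_def)

text \<open>The universal property of the tensor product of algebras. \<open>tensor_assoc\<close>,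
  the unit maps and the maps f \<otimes> id, id \<otimes> f are recognised as homomorphisms by
  factoring them this way.\<close>

lemma alg_hom_tensor_lift:
  assumes f: "alg_hom f" and g: "alg_hom g" and comm: "\<And>a b. f a * g b = g b * f a"
  shows "alg_hom (tensor_lift (\<lambda>a b. f a * g b))"
    and "rat_bilinear (\<lambda>a b. f a * g b)"
proof -
  show B: "rat_bilinear (\<lambda>a b. f a * g b)"
    by (rule rat_bilinearI)
      (simp_all add: alg_homD[OF f] alg_homD[OF g] algebra_simps mult_scaleQ_left mult_scaleQ_right)
  note L = tensor_lift_linear[OF B]
  show "alg_hom (tensor_lift (\<lambda>a b. f a * g b))"
  proof (rule alg_homI[OF L])
    show "tensor_lift (\<lambda>a b. f a * g b) 1 = 1"
      by (simp add: one_tensor_def B alg_homD(2)[OF f] alg_homD(2)[OF g])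
    show "tensor_lift (\<lambda>a b. f a * g b) (x * y)
      = tensor_lift (\<lambda>a b. f a * g b) x * tensor_lift (\<lambda>a b. f a * g b) y" for x y
    proof (induction x rule: tensor_induct)
      case (tensor a b)
      show ?case
      proof (induction y rule: tensor_induct)
        case (tensor c d)
        show ?case
          by (simp add: tensor_times B alg_homD(3)[OF f] alg_homD(3)[OF g])
            (metis comm mult.assoc)
      qed (simp add: rat_linear_add[OF L] distrib_left)
    qed (simp add: rat_linear_add[OF L] distrib_right)
  qed
qed

lemma tensor_left_right_commute: "tensor_left a * tensor_right b = tensor_right b * tensor_left a"
  by (simp add: tensor_times)

lemma tensor_eq_mult: "a \<otimes> b = tensor_left a * tensor_right b"
  by (simp add: tensor_times)

lemma fps_tensor_eq_mult: "x \<otimes>\<^sub>t y = fps_map tensor_left x * fps_map tensor_right y"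
  unfolding fps_tensor_conv fps_mult_conv
  by (rule fps_conv_cong_map) (rule tensor_eq_mult)


section \<open>Binomial coefficients and binomial series in an algebra\<close>

lemma of_nat_eq_scaleQ: "(of_nat n :: 'a::rat_algebra_1) = of_nat n *\<^sub>Q 1"
  by (induction n) (simp_all add: scaleQ_add_left scaleQ_one)

lemma of_nat_mult_eq_scaleQ: "of_nat n * x = of_nat n *\<^sub>Q (x :: 'a::rat_algebra_1)"
  by (subst of_nat_eq_scaleQ) (simp add: mult_scaleQ_left)

lemma mult_of_nat_eq_scaleQ: "x * of_nat n = of_nat n *\<^sub>Q (x :: 'a::rat_algebra_1)"
  by (subst of_nat_eq_scaleQ) (simp add: mult_scaleQ_right)

lemmas of_nat_scale = of_nat_mult_eq_scaleQ mult_of_nat_eq_scaleQ mult_scaleQ_left mult_scaleQ_right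

primrec alg_binomial :: "'a::rat_algebra_1 \<Rightarrow> nat \<Rightarrow> 'a"
  where
    "alg_binomial a 0 = 1"
  | "alg_binomial a (Suc n) = (1 / of_nat (Suc n)) *\<^sub>Q (alg_binomial a n * (a - of_nat n))"

lemma alg_binomial_mult:
  "alg_binomial a n * (a - of_nat n) = of_nat (Suc n) *\<^sub>Q alg_binomial a (Suc n)"
  by (simp del: of_nat_Suc add: scaleQ_scaleQ scaleQ_one)

lemma alg_hom_of_nat: "alg_hom f \<Longrightarrow> f (of_nat n) = of_nat n"
  for f :: "'a::rat_algebra_1 \<Rightarrow> 'b::rat_algebra_1"
  by (simp add: of_nat_eq_scaleQ[where 'a = 'a] of_nat_eq_scaleQ[where 'a = 'b] alg_homD)

lemma alg_hom_binomial: "alg_hom f \<Longrightarrow> f (alg_binomial a n) = alg_binomial (f a) n"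
  by (induction n) (simp_all add: alg_homD alg_hom_of_nat)

text \<open>From x a = a' x follows x p(a) = p(a') x for every rational polynomial p. With a' = a
  this is commutation, with a' = a - k the shift caused by [h, e] = e. Together with
  \<open>power_intertwine\<close> it carries most of the noncommutative bookkeeping.\<close>

lemma alg_binomial_intertwine:
  assumes "x * a = a' * x"
  shows "x * alg_binomial a n = alg_binomial a' n * x"
proof (induction n)
  case (Suc n)
  have "x * alg_binomial a (Suc n) = (1 / of_nat (Suc n)) *\<^sub>Q (x * alg_binomial a n * (a - of_nat n))"
    by (simp add: mult_scaleQ_right mult.assoc)
  also have "x * alg_binomial a n * (a - of_nat n) = alg_binomial a' n * (a' - of_nat n) * x"
    unfolding Suc by (simp add: mult.assoc right_diff_distrib left_diff_distrib assms of_nat_scale)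
  finally show ?case by (simp add: mult_scaleQ_left)
qed simp

lemma power_intertwine:
  assumes "x * b = b' * x"
  shows "x * b ^ n = b' ^ n * (x :: 'a::monoid_mult)"
proof (induction n)
  case (Suc n)
  then show ?case by (metis assms mult.assoc power_Suc)
qed simp

lemma alg_binomial_scalar: "alg_binomial (c *\<^sub>Q 1 :: 'a::rat_algebra_1) n = (c gchoose n) *\<^sub>Q 1"
proof (induction n)
  case (Suc n)
  have "(c gchoose Suc n) = (1 / of_nat (Suc n)) * ((c gchoose n) * (c - of_nat n))"
    using gbinomial_mult_1[of c n] by (simp add: field_simps)
  then show ?case
    by (simp only: alg_binomial.simps Suc of_nat_eq_scaleQ[where 'a = 'a] mult_scaleQ_left mult_1_left
        rat_vector.scale_left_diff_distrib[symmetric] scaleQ_scaleQ)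
qed (simp add: scaleQ_one)

lemma alg_binomial_zero: "alg_binomial 0 n = (if n = 0 then 1 else 0)"
  using alg_binomial_scalar[of 0 n] by (cases n) simp_all

lemma sum_shift_weighted:
  fixes f :: "nat \<Rightarrow> 'a::rat_vector"
  shows "(\<Sum>k=0..n. of_nat (Suc k) *\<^sub>Q f (Suc k)) = (\<Sum>k=0..Suc n. of_nat k *\<^sub>Q f k)"
  by (simp add: sum.atLeast0_atMost_Suc_shift del: sum.cl_ivl_Suc of_nat_Suc)

lemma alg_binomial_Vandermonde:
  assumes "a * b = b * a"
  shows "alg_binomial (a + b) n = (\<Sum>k=0..n. alg_binomial a k * alg_binomial b (n - k))"
proof (induction n)
  case (Suc n)
  let ?f = "\<lambda>k. alg_binomial a k * alg_binomial b (Suc n - k)"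
  have comm: "a * alg_binomial b k = alg_binomial b k * a" for k
    by (rule alg_binomial_intertwine[OF assms])
  have "of_nat (Suc n) *\<^sub>Q alg_binomial (a + b) (Suc n)
      = (\<Sum>k=0..n. alg_binomial a k * alg_binomial b (n - k)) * (a + b - of_nat n)"
    by (simp only: alg_binomial_mult[symmetric] Suc)
  \<comment> \<open>The factor a + b - n splits as (a - k) + (b - (n - k)); each part raises one of
    the two lower indices.\<close>
  also have "\<dots> = (\<Sum>k=0..n. alg_binomial a k * (a - of_nat k) * alg_binomial b (n - k)
      + alg_binomial a k * (alg_binomial b (n - k) * (b - of_nat (n - k))))"
    unfolding sum_distrib_right
    by (intro sum.cong refl) (simp add: algebra_simps comm of_nat_scale of_nat_diff)
  also have "\<dots> = (\<Sum>k=0..n. of_nat (Suc k) *\<^sub>Q ?f (Suc k)) + (\<Sum>k=0..n. of_nat (Suc n - k) *\<^sub>Q ?f k)"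
    unfolding alg_binomial_mult sum.distrib
    by (intro arg_cong2[where f = "(+)"] sum.cong refl)
      (auto simp: mult_scaleQ_left mult_scaleQ_right Suc_diff_le simp del: of_nat_Suc alg_binomial.simps)
  also have "(\<Sum>k=0..n. of_nat (Suc k) *\<^sub>Q ?f (Suc k)) = (\<Sum>k=0..Suc n. of_nat k *\<^sub>Q ?f k)"
    by (rule sum_shift_weighted)
  also have "(\<Sum>k=0..n. of_nat (Suc n - k) *\<^sub>Q ?f k) = (\<Sum>k=0..Suc n. of_nat (Suc n - k) *\<^sub>Q ?f k)"
    by simp
  also have "(\<Sum>k=0..Suc n. of_nat k *\<^sub>Q ?f k) + (\<Sum>k=0..Suc n. of_nat (Suc n - k) *\<^sub>Q ?f k)
      = of_nat (Suc n) *\<^sub>Q (\<Sum>k=0..Suc n. ?f k)"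
    unfolding sum.distrib[symmetric] rat_vector.scale_sum_right
    by (intro sum.cong refl) (simp only: scaleQ_add_left[symmetric] of_nat_add[symmetric], simp)
  finally show ?case
    by (simp only: rat_vector.scale_cancel_left of_nat_eq_0_iff) simp
qed simp

text \<open>Trinomial revision. It separates the part depending on l alone from the coefficient of a
  binomial series with exponent a - l.\<close>

lemma alg_binomial_split:
  "of_nat ((l + m) choose l) *\<^sub>Q alg_binomial a (l + m)
    = alg_binomial a l * alg_binomial (a - of_nat l) m"
proof (induction m)
  case (Suc m)
  have "Suc m * ((l + Suc m) choose l) = Suc (l + m) * ((l + m) choose l)"
    using binomial_absorb_comp[of "Suc (l + m)" l] by simp
  then have bin: "of_nat (Suc m) * of_nat ((l + Suc m) choose l)
      = (of_nat (Suc (l + m)) * of_nat ((l + m) choose l) :: rat)"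
    by (metis of_nat_mult)
  have "of_nat (Suc m) *\<^sub>Q (alg_binomial a l * alg_binomial (a - of_nat l) (Suc m))
      = alg_binomial a l * alg_binomial (a - of_nat l) m * (a - of_nat (l + m))"
    by (simp only: mult_scaleQ_right[symmetric] alg_binomial_mult[symmetric])
      (simp add: mult.assoc diff_diff_eq)
  also have "\<dots> = of_nat ((l + m) choose l) *\<^sub>Q (of_nat (Suc (l + m)) *\<^sub>Q alg_binomial a (Suc (l + m)))"
    by (simp only: Suc[symmetric] mult_scaleQ_left alg_binomial_mult)
  also have "\<dots> = of_nat (Suc m) *\<^sub>Q (of_nat ((l + Suc m) choose l) *\<^sub>Q alg_binomial a (l + Suc m))"
    unfolding scaleQ_scaleQ bin by (simp only: mult.commute add_Suc_right)
  finally show ?case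
    by (simp only: rat_vector.scale_cancel_left of_nat_eq_0_iff) simp
qed (simp add: scaleQ_one)

lemma alg_binomial_rising: "fact l *\<^sub>Q alg_binomial (- a) l = (- 1) ^ l *\<^sub>Q rising a l"
proof (induction l)
  case (Suc l)
  have "fact (Suc l) *\<^sub>Q alg_binomial (- a) (Suc l)
      = fact l *\<^sub>Q (of_nat (Suc l) *\<^sub>Q alg_binomial (- a) (Suc l))"
    by (simp add: scaleQ_scaleQ mult.commute del: alg_binomial.simps)
  also have "\<dots> = (fact l *\<^sub>Q alg_binomial (- a) l) * (- a - of_nat l)"
    by (simp only: alg_binomial_mult[symmetric] mult_scaleQ_left)
  also have "\<dots> = (- 1) ^ Suc l *\<^sub>Q rising a (Suc l)"
    unfolding Suc by (simp add: mult_scaleQ_left algebra_simps rat_vector.scale_left_diff_distrib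
        rat_vector.scale_right_diff_distrib)
  finally show ?case .
qed (simp add: scaleQ_one)

lemma rising_Suc_left: "rising a (Suc l) = a * rising (a + 1) l"
  by (induction l) (simp_all add: mult.assoc add.assoc)

text \<open>The falling product (a + l) ... (a + 1) is read upwards. This is the source of h + 1 in
  the antipode formula, whereas the h of the coproduct comes from
  \<open>alg_binomial_rising\<close>.\<close>

lemma alg_binomial_rising_top: "fact l *\<^sub>Q alg_binomial (a + of_nat l) l = rising (a + 1) l"
proof -
  have *: "alg_binomial a n * (a - of_nat n) = (a - of_nat n) * alg_binomial a n" for a :: 'a and n
    by (rule alg_binomial_intertwine[symmetric])
      (simp add: algebra_simps of_nat_scale)
  show ?thesis
  proof (induction l arbitrary: a)
    case (Suc l)
    have "fact (Suc l) *\<^sub>Q alg_binomial (a + of_nat (Suc l)) (Suc l)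
      = fact l *\<^sub>Q (of_nat (Suc l) *\<^sub>Q alg_binomial (a + of_nat (Suc l)) (Suc l))"
      by (simp add: scaleQ_scaleQ mult.commute del: alg_binomial.simps)
    also have "\<dots> = (a + 1) * (fact l *\<^sub>Q alg_binomial (a + 1 + of_nat l) l)"
      unfolding alg_binomial_mult[symmetric] * by (simp add: mult_scaleQ_right add.assoc)
    finally show ?case unfolding Suc rising_Suc_left[of "a + 1"] by simp
  qed (simp add: scaleQ_one)
qed

lemma binomial_commuting:
  fixes b c :: "'a::rat_algebra_1"
  assumes "b * c = c * b"
  shows "(b + c) ^ n = (\<Sum>k=0..n. of_nat (n choose k) *\<^sub>Q (b ^ k * c ^ (n - k)))"
proof (induction n)
  case (Suc n)
  let ?f = "\<lambda>k. b ^ k * c ^ (Suc n - k)"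
  have "(b + c) ^ Suc n = b * (b + c) ^ n + c * (b + c) ^ n"
    by (simp add: distrib_right)
  also have "b * (b + c) ^ n = (\<Sum>k=0..n. of_nat (n choose k) *\<^sub>Q ?f (Suc k))"
    by (simp add: Suc sum_distrib_left mult_scaleQ_right mult.assoc)
  also have "c * (b + c) ^ n = (\<Sum>k=0..n. of_nat (n choose k) *\<^sub>Q ?f k)"
    unfolding Suc sum_distrib_left
  proof (intro sum.cong refl)
    fix k assume "k \<in> {0..n}"
    moreover have "c * b ^ k = b ^ k * c" by (rule power_intertwine) (rule assms[symmetric])
    ultimately show "c * of_nat (n choose k) *\<^sub>Q (b ^ k * c ^ (n - k)) = of_nat (n choose k) *\<^sub>Q ?f k"
      by (simp add: mult_scaleQ_right mult.assoc[symmetric] Suc_diff_le)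
  qed
  also have "\<dots> = ?f 0 + (\<Sum>k=0..n. of_nat (n choose Suc k) *\<^sub>Q ?f (Suc k))"
  proof -
    have "(\<Sum>k=0..n. of_nat (n choose k) *\<^sub>Q ?f k) = (\<Sum>k=0..Suc n. of_nat (n choose k) *\<^sub>Q ?f k)"
      by (simp add: binomial_eq_0)
    then show ?thesis
      unfolding sum.atLeast0_atMost_Suc_shift by (simp add: scaleQ_one)
  qed
  finally show ?case
    by (subst sum.atLeast0_atMost_Suc_shift)
      (simp add: scaleQ_add_left sum.distrib scaleQ_one add.commute add.left_commute)
qed (simp add: scaleQ_one)

text \<open>\<open>(1 - b t)\<^sup>a\<close>; as \<open>a\<close> and \<open>b\<close> need not commute, the powers of \<open>b\<close> are written on the right.\<close>

definition binomial_series :: "'a::rat_algebra_1 \<Rightarrow> 'a \<Rightarrow> 'a fps"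
  where "binomial_series a b = Abs_fps (\<lambda>n. alg_binomial a n * (- b) ^ n)"

lemma binomial_series_tsum:
  "binomial_series a b = fps_tsum (\<lambda>n. fps_const (alg_binomial a n * (- b) ^ n))"
  by (simp add: binomial_series_def fps_tsum_const)

lemma one_minus_pow_eq: "one_minus_pow b c = binomial_series (c *\<^sub>Q 1) b"
proof -
  have "(- b) ^ n = (- 1) ^ n *\<^sub>Q b ^ n" for n
    by (induction n) (simp_all add: scaleQ_one mult_scaleQ_left mult_scaleQ_right)
  then show ?thesis
    by (simp add: fps_eq_iff one_minus_pow_def binomial_series_def alg_binomial_scalar
        mult_scaleQ_left scaleQ_scaleQ mult.commute)
qed

lemma fps_map_binomial_series:
  "alg_hom f \<Longrightarrow> fps_map f (binomial_series a b) = binomial_series (f a) (f b)"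
  by (simp add: fps_eq_iff binomial_series_def alg_homD(3) alg_hom_binomial alg_hom_power
      alg_hom_uminus)

lemma binomial_series_intertwine:
  assumes "x * a = a' * x" "x * b = b' * x"
  shows "fps_const x * binomial_series a b = binomial_series a' b' * fps_const x"
proof (rule fps_ext)
  fix n
  have "x * (- b) ^ n = (- b') ^ n * x"
    by (rule power_intertwine) (simp add: assms)
  then have "x * (alg_binomial a n * (- b) ^ n) = alg_binomial a' n * (- b') ^ n * x"
    by (metis alg_binomial_intertwine[OF assms(1)] mult.assoc)
  then show "fps_nth (fps_const x * binomial_series a b) n = fps_nth (binomial_series a' b' * fps_const x) n"
    by (simp add: binomial_series_def)
qed

lemma binomial_series_mult:
  assumes "a * a' = a' * a" "b * a' = a' * b"
  shows "binomial_series a b * binomial_series a' b = binomial_series (a + a') b"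
proof (rule fps_ext)
  fix n
  have comm: "(- b) ^ k * alg_binomial a' m = alg_binomial a' m * (- b) ^ k" for k m
    by (rule alg_binomial_intertwine, rule power_intertwine[symmetric]) (simp add: assms)
  have "alg_binomial a k * (- b) ^ k * (alg_binomial a' (n - k) * (- b) ^ (n - k))
      = alg_binomial a k * alg_binomial a' (n - k) * (- b) ^ n" if "k \<le> n" for k
  proof -
    have "alg_binomial a k * (- b) ^ k * (alg_binomial a' (n - k) * (- b) ^ (n - k))
      = alg_binomial a k * ((- b) ^ k * alg_binomial a' (n - k)) * (- b) ^ (n - k)"
      by (simp only: mult.assoc)
    also have "\<dots> = alg_binomial a k * alg_binomial a' (n - k) * ((- b) ^ k * (- b) ^ (n - k))"
      unfolding comm by (simp only: mult.assoc)
    finally show ?thesis using that by (simp only: power_add[symmetric] le_add_diff_inverse)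
  qed
  then show "fps_nth (binomial_series a b * binomial_series a' b) n = fps_nth (binomial_series (a + a') b) n"
    by (simp add: binomial_series_def fps_mult_nth alg_binomial_Vandermonde[OF assms(1)] sum_distrib_right)
qed

lemma binomial_series_0: "binomial_series 0 b = 1"
  by (simp add: fps_eq_iff binomial_series_def alg_binomial_zero)

lemma binomial_series_0_right: "binomial_series a 0 = 1"
  by (simp add: fps_eq_iff binomial_series_def power_0_left)

lemma binomial_series_inverse:
  assumes "a * b = b * a"
  shows "binomial_series a b * binomial_series (- a) b = 1"
    and "binomial_series (- a) b * binomial_series a b = 1"
  using binomial_series_mult[of a "- a" b] binomial_series_mult[of "- a" a b] assms
  by (simp_all add: binomial_series_0)

text \<open>The middle series already has its binomial coefficients in a to the left of the powers
  of b, so the coefficients of -a and a meet without any reordering, and Vandermonde yields (0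
  choose N). In the antipode axioms this says that the twist acts on
  \<open>antipode_twist_inv\<close>, and \<open>twist_inv\<close> on \<open>antipode_twist\<close>,
  with result 1.\<close>

lemma binomial_series_sandwich:
  "fps_tsum (\<lambda>n. fps_const (alg_binomial (- a) n) * binomial_series a b * fps_const ((- b) ^ n)) = 1"
proof -
  have "fps_tsum (\<lambda>n. fps_const (alg_binomial (- a) n) * binomial_series a b * fps_const ((- b) ^ n))
      = fps_tsum (\<lambda>n. fps_tsum (\<lambda>m. fps_const (alg_binomial (- a) n * alg_binomial a m * (- b) ^ (n + m))))"
    unfolding binomial_series_tsum fps_mult_tsum fps_tsum_mult
    by (simp add: mult.assoc power_add[symmetric] add.commute)
  also have "\<dots> = fps_tsum (\<lambda>N. fps_const ((\<Sum>n=0..N. alg_binomial (- a) n * alg_binomial a (N - n)) * (- b) ^ N))"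
    unfolding fps_tsum_tsum
    by (intro fps_tsum_cong) (auto simp: fps_eq_iff fps_sum_nth sum_distrib_right)
  also have "\<dots> = fps_tsum (\<lambda>N. fps_const (if N = 0 then 1 else 0))"
    by (intro fps_tsum_cong, subst alg_binomial_Vandermonde[symmetric]) (auto simp: alg_binomial_zero)
  finally show ?thesis by (simp add: fps_tsum_const fps_eq_iff)
qed

text \<open>Each b that is passed lowers a by 1. The summand c accommodates exponents such as a + j
  or a - \<kappa>.\<close>

lemma shift_intertwine:
  fixes a b :: "'a::rat_algebra_1"
  assumes "a * b - b * a = b" and that: "b * c = c * b"
  shows "b ^ k * (a + c) = (a + c - of_nat k) * b ^ k"
proof (induction k)
  case (Suc k)
  have ba: "b * a = a * b - b" using assms(1) by (simp add: algebra_simps)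
  have "b ^ Suc k * (a + c) = b * (b ^ k * (a + c))" by (simp add: mult.assoc)
  also have "\<dots> = b * (a + c - of_nat k) * b ^ k" by (simp add: Suc mult.assoc)
  also have "b * (a + c - of_nat k) = (a + c - of_nat (Suc k)) * b"
    by (simp add: algebra_simps ba that of_nat_scale)
  finally show ?case by (simp add: mult.assoc)
qed simp

text \<open>Moving (-b)^k to the right past (a choose n - k) lowers a to a - k, so every term of the
  nth coefficient is (-1)^k (n choose k) times the same element (a choose n) b^n. The alternating
  sum vanishes for n > 0.\<close>

lemma binomial_series_noncommuting_inverse:
  assumes "a * b - b * a = b"
  shows "binomial_series a b * binomial_series a (- b) = 1"
proof (rule fps_ext)
  fix n
  have comm: "(- b) ^ k * alg_binomial a m = alg_binomial (a - of_nat k) m * (- b) ^ k" for k m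
  proof (rule alg_binomial_intertwine)
    have "(- b) ^ k * (a + 0) = (a + 0 - of_nat k) * (- b) ^ k"
      by (rule shift_intertwine) (use assms in \<open>simp_all add: algebra_simps\<close>)
    then show "(- b) ^ k * a = (a - of_nat k) * (- b) ^ k" by simp
  qed
  have "alg_binomial a k * (- b) ^ k * (alg_binomial a (n - k) * b ^ (n - k))
      = ((- 1) ^ k * of_nat (n choose k)) *\<^sub>Q (alg_binomial a n * b ^ n)" if "k \<le> n" for k
  proof -
    have "alg_binomial a k * (- b) ^ k * (alg_binomial a (n - k) * b ^ (n - k))
      = alg_binomial a k * ((- b) ^ k * alg_binomial a (n - k)) * b ^ (n - k)"
      by (simp only: mult.assoc)
    also have "\<dots> = (alg_binomial a k * alg_binomial (a - of_nat k) (n - k)) * ((- b) ^ k * b ^ (n - k))"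
      unfolding comm by (simp only: mult.assoc)
    also have "(- b) ^ k * b ^ (n - k) = (- 1) ^ k *\<^sub>Q b ^ n"
    proof -
      have "(- b) ^ k = (- 1) ^ k *\<^sub>Q b ^ k"
        by (induction k) (simp_all add: scaleQ_one mult_scaleQ_left mult_scaleQ_right)
      then show ?thesis using that by (simp add: mult_scaleQ_left power_add[symmetric])
    qed
    finally show ?thesis
      using alg_binomial_split[of k "n - k" a] that
      by (simp add: mult_scaleQ_left mult_scaleQ_right scaleQ_scaleQ flip: alg_binomial_split)
  qed
  then have "fps_nth (binomial_series a b * binomial_series a (- b)) n
      = (\<Sum>k\<le>n. (- 1) ^ k * of_nat (n choose k)) *\<^sub>Q (alg_binomial a n * b ^ n)"
    by (simp add: binomial_series_def fps_mult_nth rat_vector.scale_sum_left atLeast0AtMost)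
  then show "fps_nth (binomial_series a b * binomial_series a (- b)) n = fps_nth 1 n"
    by (cases "n = 0") (simp_all add: choose_alternating_sum scaleQ_one)
qed

text \<open>The cocycle identity in abstract form. Expanding in b gives (1 - (b+c)t)^a as the sum of
  (a choose j) (-b)^j (1 - ct)^(a-j) t^j. Pulling (1 - ct)^d across b^j turns d into d + j, and the
  two shifts by j cancel.\<close>

lemma binomial_series_twist:
  assumes ab: "a * b = b * a" and ac: "a * c = c * a" and ad: "a * d = d * a"
    and bc: "b * c = c * b" and dc: "d * b - b * d = b"
  shows "binomial_series d c * binomial_series a (b + c)
    = binomial_series a b * binomial_series (a + d) c"
proof -
  let ?x = "\<lambda>j. alg_binomial a j * (- b) ^ j"
  have gen: "fps_const (alg_binomial a n * (- (b + c)) ^ n) =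
      (\<Sum>j=0..n. fps_const (?x j) * fps_const (alg_binomial (a - of_nat j) (n - j) * (- c) ^ (n - j)))" for n
  proof -
    have comm: "(- b) ^ j * alg_binomial (a - of_nat j) m = alg_binomial (a - of_nat j) m * (- b) ^ j" for j m
      by (rule alg_binomial_intertwine, rule power_intertwine[symmetric])
        (simp add: algebra_simps ab of_nat_scale)
    have step: "alg_binomial a n * of_nat (n choose j) *\<^sub>Q ((- b) ^ j * (- c) ^ (n - j))
        = ?x j * (alg_binomial (a - of_nat j) (n - j) * (- c) ^ (n - j))" if "j \<in> {0..n}" for j
    proof -
      have "alg_binomial a n * of_nat (n choose j) *\<^sub>Q ((- b) ^ j * (- c) ^ (n - j))
        = (of_nat (n choose j) *\<^sub>Q alg_binomial a n) * ((- b) ^ j * (- c) ^ (n - j))"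
        by (simp add: mult_scaleQ_left mult_scaleQ_right)
      also have "\<dots> = alg_binomial a j * (alg_binomial (a - of_nat j) (n - j) * (- b) ^ j) * (- c) ^ (n - j)"
        using alg_binomial_split[of j "n - j" a] that by (simp add: mult.assoc)
      finally show ?thesis
        unfolding comm[symmetric] by (simp only: mult.assoc)
    qed
    have "(- b) * (- c) = (- c) * (- b)" using bc by simp
    then have "(- b + - c) ^ n = (\<Sum>k=0..n. of_nat (n choose k) *\<^sub>Q ((- b) ^ k * (- c) ^ (n - k)))"
      by (rule binomial_commuting)
    then have "alg_binomial a n * (- (b + c)) ^ n
      = (\<Sum>j=0..n. ?x j * (alg_binomial (a - of_nat j) (n - j) * (- c) ^ (n - j)))"
      by (simp add: sum_distrib_left step)
    then show ?thesis
      by (simp add: rat_linear_sum[OF fps_const_linear])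
  qed
  have "binomial_series d c * binomial_series a (b + c)
      = binomial_series d c * fps_tsum (\<lambda>j. fps_const (?x j) * binomial_series (a - of_nat j) c)"
    unfolding binomial_series_tsum[of a "b + c"] gen binomial_series_tsum[of "a - of_nat _" c]
      fps_mult_tsum[of "fps_const _"] fps_tsum_tsum ..
  also have "\<dots> = fps_tsum (\<lambda>j. fps_const (?x j) * (binomial_series (d + of_nat j) c
      * binomial_series (a - of_nat j) c))"
  proof -
    have *: "binomial_series d c * fps_const (?x j) = fps_const (?x j) * binomial_series (d + of_nat j) c" for j
    proof (rule binomial_series_intertwine[symmetric])
      have "(- b) ^ j * (d + of_nat j) = (d + of_nat j - of_nat j) * (- b) ^ j"
        by (rule shift_intertwine) (use dc in \<open>simp_all add: algebra_simps of_nat_scale\<close>)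
      moreover have "d * alg_binomial a j = alg_binomial a j * d"
        by (rule alg_binomial_intertwine) (simp add: ad)
      ultimately show "?x j * (d + of_nat j) = d * ?x j"
        by (simp add: mult.assoc) (simp add: mult.assoc[symmetric])
      have "c * alg_binomial a j = alg_binomial a j * c"
        by (rule alg_binomial_intertwine) (simp add: ac)
      moreover have "c * (- b) ^ j = (- b) ^ j * c"
        by (rule power_intertwine) (simp add: bc)
      ultimately show "?x j * c = c * ?x j" by (metis mult.assoc)
    qed
    then show ?thesis unfolding fps_mult_tsum
      by (simp only: mult.assoc[symmetric] *)
  qed
  also have "\<dots> = fps_tsum (\<lambda>j. fps_const (?x j) * binomial_series (a + d) c)"
  proof (intro fps_tsum_cong arg_cong2[where f = "(*)"] refl)
    fix j
    have "binomial_series (d + of_nat j) c * binomial_series (a - of_nat j) c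
        = binomial_series (d + of_nat j + (a - of_nat j)) c"
      by (rule binomial_series_mult) (simp_all add: algebra_simps ad ac of_nat_scale)
    then show "binomial_series (d + of_nat j) c * binomial_series (a - of_nat j) c = binomial_series (a + d) c"
      by (simp add: add.commute)
  qed
  finally show ?thesis by (simp only: fps_tsum_mult[symmetric] binomial_series_tsum[of a b])
qed

text \<open>The sequence \<open>\<delta> l = ad(b)\<^sup>l(\<delta> 0) / l!\<close>.\<close>

locale divided_ad =
  fixes b :: "'a::rat_algebra_1" and \<delta> :: "nat \<Rightarrow> 'a"
  assumes ad: "b * \<delta> l - \<delta> l * b = of_nat (Suc l) *\<^sub>Q \<delta> (Suc l)"
begin

text \<open>The Leibniz expansion of x b^n in the elements ad(b)^l(x) = l! \<delta> l, for x =
  \<delta> 0. The induction step is Pascal's rule for the signed coefficients.\<close>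

lemma mult_power: "\<delta> 0 * b ^ n =
  (\<Sum>l=0..n. ((- 1) ^ l * fact l * of_nat (n choose l)) *\<^sub>Q (b ^ (n - l) * \<delta> l))"
proof (induction n)
  case (Suc n)
  let ?c = "\<lambda>n l. (- 1) ^ l * fact l * of_nat (n choose l) :: rat"
  let ?f = "\<lambda>l. b ^ (Suc n - l) * \<delta> l"
  have "\<delta> 0 * b ^ Suc n = (\<delta> 0 * b ^ n) * b"
    by (simp add: mult.assoc power_commutes)
  also have "\<dots> = (\<Sum>l=0..n. ?c n l *\<^sub>Q ?f l - (of_nat (Suc l) * ?c n l) *\<^sub>Q ?f (Suc l))"
    unfolding Suc sum_distrib_right
  proof (intro sum.cong refl)
    fix l assume "l \<in> {0..n}"
    then have pow: "b ^ (Suc n - l) = b ^ (n - l) * b"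
      by (simp add: Suc_diff_le power_commutes)
    have db: "\<delta> l * b = b * \<delta> l - of_nat (Suc l) *\<^sub>Q \<delta> (Suc l)"
      by (simp only: ad[symmetric]) simp
    have "?c n l *\<^sub>Q (b ^ (n - l) * \<delta> l) * b = ?c n l *\<^sub>Q (b ^ (n - l) * (\<delta> l * b))"
      by (simp only: mult_scaleQ_left mult.assoc)
    also have "\<dots> = ?c n l *\<^sub>Q ?f l - (of_nat (Suc l) * ?c n l) *\<^sub>Q ?f (Suc l)"
      unfolding db pow
      by (simp add: right_diff_distrib rat_vector.scale_right_diff_distrib mult.assoc
          mult_scaleQ_right scaleQ_scaleQ mult.commute del: of_nat_Suc)
    finally show "?c n l *\<^sub>Q (b ^ (n - l) * \<delta> l) * b
      = ?c n l *\<^sub>Q ?f l - (of_nat (Suc l) * ?c n l) *\<^sub>Q ?f (Suc l)" .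
  qed
  also have "\<dots> = (\<Sum>l=0..Suc n. ?c n l *\<^sub>Q ?f l) - (\<Sum>l=0..n. (of_nat (Suc l) * ?c n l) *\<^sub>Q ?f (Suc l))"
    by (simp add: sum_subtractf binomial_eq_0 del: of_nat_Suc)
  also have "\<dots> = (\<Sum>l=0..Suc n. ?c (Suc n) l *\<^sub>Q ?f l)"
  proof -
    have "?c (Suc n) (Suc l) = ?c n (Suc l) - of_nat (Suc l) * ?c n l" for l
      by (simp add: algebra_simps)
    then show ?thesis
      unfolding sum.atLeast0_atMost_Suc_shift
      by (simp add: sum_subtractf[symmetric] rat_vector.scale_left_diff_distrib[symmetric]
          add_diff_eq[symmetric] del: of_nat_Suc power_Suc fact_Suc binomial_Suc_Suc)
  qed
  finally show ?case .
qed (simp add: scaleQ_one)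

lemma mult_power_uminus: "\<delta> 0 * (- b) ^ n =
  (\<Sum>l=0..n. (fact l * of_nat (n choose l)) *\<^sub>Q ((- b) ^ (n - l) * \<delta> l))"
proof -
  have pow: "(- b) ^ k = (- 1) ^ k *\<^sub>Q b ^ k" for k
    by (induction k) (simp_all add: scaleQ_one mult_scaleQ_left mult_scaleQ_right)
  have "(- 1) ^ n * (- 1) ^ l = ((- 1) ^ (n - l) :: rat)" if "l \<le> n" for l
    using that by (simp add: minus_one_power_iff)
  then show ?thesis
    unfolding pow mult_scaleQ_right mult_power rat_vector.scale_sum_right
    by (intro sum.cong refl) (simp add: mult_scaleQ_left scaleQ_scaleQ mult.assoc)
qed

text \<open>For the case where exponent and base sit in different legs. Splitting (-a choose n) at l
  and absorbing l! turns it into (-1)^l \<open>rising a l\<close> times (-a - l choose n - l).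
  Summation over n gives (1 - bt)^(-a-l), from which (1 - bt)^(-a) is pulled to the front.\<close>

lemma conjugate_binomial_series:
  assumes "a * b = b * a" and y: "\<delta> 0 * a = a * \<delta> 0"
  shows "fps_const (\<delta> 0) * binomial_series (- a) b = binomial_series (- a) b *
    fps_tsum (\<lambda>l. (- 1) ^ l *\<^sub>Q (fps_const (rising a l)
      * binomial_series (- of_nat l) b * fps_const (\<delta> l)))"
proof -
  have comm: "\<delta> 0 * alg_binomial (- a) n = alg_binomial (- a) n * \<delta> 0" for n
    by (rule alg_binomial_intertwine) (simp add: y)
  have "fps_const (\<delta> 0) * binomial_series (- a) b
    = fps_tsum (\<lambda>n. fps_const (alg_binomial (- a) n * (\<delta> 0 * (- b) ^ n)))"
    unfolding binomial_series_tsum fps_mult_tsum by (simp add: mult.assoc[symmetric] comm)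
  also have "\<dots> = fps_tsum (\<lambda>n. \<Sum>l=0..n. fps_const (((- 1) ^ l *\<^sub>Q rising a l) *
      (alg_binomial (- a - of_nat l) (n - l) * (- b) ^ (n - l)) * \<delta> l))"
  proof (intro fps_tsum_cong)
    fix n
    have "alg_binomial (- a) n * (fact l * of_nat (n choose l)) *\<^sub>Q ((- b) ^ (n - l) * \<delta> l) =
      ((- 1) ^ l *\<^sub>Q rising a l) *
      (alg_binomial (- a - of_nat l) (n - l) * (- b) ^ (n - l)) * \<delta> l" if "l \<in> {0..n}" for l
      using alg_binomial_split[of l "n - l" "- a"] that
      by (simp only: alg_binomial_rising[symmetric])
        (simp add: mult_scaleQ_left mult_scaleQ_right scaleQ_scaleQ mult.assoc[symmetric] flip: alg_binomial_split)
    then show "fps_const (alg_binomial (- a) n * (\<delta> 0 * (- b) ^ n)) =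
      (\<Sum>l=0..n. fps_const (((- 1) ^ l *\<^sub>Q rising a l) *
      (alg_binomial (- a - of_nat l) (n - l) * (- b) ^ (n - l)) * \<delta> l))"
      by (simp add: mult_power_uminus sum_distrib_left rat_linear_sum[OF fps_const_linear])
  qed
  also have "\<dots> = fps_tsum (\<lambda>l. fps_const ((- 1) ^ l *\<^sub>Q rising a l) *
      binomial_series (- a - of_nat l) b * fps_const (\<delta> l))"
    unfolding binomial_series_tsum fps_mult_tsum fps_tsum_mult fps_tsum_tsum by simp
  also have "\<dots> = fps_tsum (\<lambda>l. binomial_series (- a) b * ((- 1) ^ l *\<^sub>Q (fps_const (rising a l)
      * binomial_series (- of_nat l) b * fps_const (\<delta> l))))"
  proof (intro fps_tsum_cong)
    fix l
    have 1: "binomial_series (- a) b * binomial_series (- of_nat l) b = binomial_series (- a - of_nat l) b"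
      using binomial_series_mult[of "- a" "- of_nat l" b]
      by (simp add: of_nat_scale)
    have 2: "fps_const (rising a l) * binomial_series (- a) b
        = binomial_series (- a) b * fps_const (rising a l)"
    proof (rule binomial_series_intertwine)
      have "x * rising a l = rising a l * x" if "x * a = a * x" for x
        by (induction l) (simp_all add: algebra_simps that of_nat_scale, metis mult.assoc that)
      from this[of b] this[of "- a"] show "rising a l * - a = - a * rising a l" "rising a l * b = b * rising a l"
        by (simp_all add: assms(1))
    qed
    have "fps_const (rising a l) * binomial_series (- a - of_nat l) b * fps_const (\<delta> l)
      = binomial_series (- a) b * (fps_const (rising a l) * binomial_series (- of_nat l) b * fps_const (\<delta> l))"
      by (simp only: 1[symmetric] mult.assoc[symmetric] 2)
    then show "fps_const ((- 1) ^ l *\<^sub>Q rising a l) *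
      binomial_series (- a - of_nat l) b * fps_const (\<delta> l) = binomial_series (- a) b * ((- 1) ^ l *\<^sub>Q (fps_const (rising a l)
      * binomial_series (- of_nat l) b * fps_const (\<delta> l)))"
      by (simp only: rat_linear_scale[OF fps_const_linear] mult_scaleQ_left mult_scaleQ_right)
  qed
  finally show ?thesis by (simp only: fps_mult_tsum)
qed

text \<open>Here [a, b] = b and \<delta> l has weight \<kappa> + l. The coefficient (a - \<kappa>
  choose n) is split at n - l, not at l, so that its factor with lower index l stands next to
  (-b)^(n-l). That factor moves across the power and then across \<delta> l, where it becomes (a + l
  choose l), and l! makes it a rising factorial.\<close>

lemma mult_binomial_series:
  assumes ab: "a * b - b * a = b" and a: "\<And>l. a * \<delta> l - \<delta> l * a = (\<kappa> + of_nat l) *\<^sub>Q \<delta> l"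
  shows "fps_const (\<delta> 0) * binomial_series a b =
    binomial_series (a - \<kappa> *\<^sub>Q 1) b * fps_tsum (\<lambda>l. fps_const (\<delta> l * rising (a + 1) l))"
proof -
  let ?a = "a - \<kappa> *\<^sub>Q 1"
  have intertwine: "(a - (\<kappa> + of_nat l) *\<^sub>Q 1) * \<delta> l = \<delta> l * a" for l
    using a[of l] by (simp add: left_diff_distrib mult_scaleQ_left algebra_simps)
  have comm: "\<delta> 0 * alg_binomial a n = alg_binomial ?a n * \<delta> 0" for n
    by (rule alg_binomial_intertwine) (use intertwine[of 0] in simp)
  have "fps_const (\<delta> 0) * binomial_series a b
    = fps_tsum (\<lambda>n. fps_const (alg_binomial ?a n * (\<delta> 0 * (- b) ^ n)))"
    unfolding binomial_series_tsum fps_mult_tsum by (simp add: mult.assoc[symmetric] comm)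
  also have "\<dots> = fps_tsum (\<lambda>n. \<Sum>l=0..n. fps_const ((alg_binomial ?a (n - l) * (- b) ^ (n - l)) *
      (\<delta> l * rising (a + 1) l)))"
  proof (intro fps_tsum_cong)
    fix n
    have "alg_binomial ?a n * (fact l * of_nat (n choose l)) *\<^sub>Q ((- b) ^ (n - l) * \<delta> l) =
      (alg_binomial ?a (n - l) * (- b) ^ (n - l)) * (\<delta> l * rising (a + 1) l)" if l: "l \<in> {0..n}" for l
    proof -
      let ?m = "n - l"
      have "(- b) ^ ?m * (a + - (\<kappa> *\<^sub>Q 1)) = (a + - (\<kappa> *\<^sub>Q 1) - of_nat ?m) * (- b) ^ ?m"
        by (rule shift_intertwine) (use ab in \<open>simp_all add: algebra_simps mult_scaleQ_left mult_scaleQ_right\<close>)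
      then have 1: "(- b) ^ ?m * alg_binomial ?a l = alg_binomial (?a - of_nat ?m) l * (- b) ^ ?m"
        by (intro alg_binomial_intertwine) simp
      have "\<delta> l * (a + of_nat l) = ?a * \<delta> l"
        using intertwine[of l] by (simp add: distrib_left of_nat_scale left_diff_distrib
            mult_scaleQ_left scaleQ_add_left of_nat_mult_eq_scaleQ algebra_simps)
      then have 2: "\<delta> l * alg_binomial (a + of_nat l) l = alg_binomial ?a l * \<delta> l"
        by (rule alg_binomial_intertwine)
      have "n choose l = (?m + l) choose ?m"
        using l binomial_symmetric[of l n] by simp
      then have split: "of_nat (n choose l) *\<^sub>Q alg_binomial ?a n = alg_binomial ?a ?m * alg_binomial (?a - of_nat ?m) l"
        using alg_binomial_split[of ?m l ?a] l by simp
      have "alg_binomial ?a n * (fact l * of_nat (n choose l)) *\<^sub>Q ((- b) ^ ?m * \<delta> l)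
        = fact l *\<^sub>Q ((of_nat (n choose l) *\<^sub>Q alg_binomial ?a n) * ((- b) ^ ?m * \<delta> l))"
        by (simp only: mult_scaleQ_left mult_scaleQ_right scaleQ_scaleQ)
      also have "\<dots> = fact l *\<^sub>Q (alg_binomial ?a ?m * (alg_binomial (?a - of_nat ?m) l * (- b) ^ ?m) * \<delta> l)"
        by (simp only: split mult.assoc)
      also have "\<dots> = fact l *\<^sub>Q (alg_binomial ?a ?m * (- b) ^ ?m * (\<delta> l * alg_binomial (a + of_nat l) l))"
        by (simp only: 1[symmetric] 2 mult.assoc)
      finally show ?thesis
        by (simp only: mult_scaleQ_right[symmetric] alg_binomial_rising_top)
    qed
    then show "fps_const (alg_binomial ?a n * (\<delta> 0 * (- b) ^ n)) =
      (\<Sum>l=0..n. fps_const ((alg_binomial ?a (n - l) * (- b) ^ (n - l)) * (\<delta> l * rising (a + 1) l)))"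
      by (simp add: mult_power_uminus sum_distrib_left rat_linear_sum[OF fps_const_linear])
  qed
  also have "\<dots> = fps_tsum (\<lambda>l. binomial_series ?a b * fps_const (\<delta> l * rising (a + 1) l))"
    unfolding binomial_series_tsum fps_mult_tsum fps_tsum_mult fps_tsum_tsum by simp
  finally show ?thesis by (simp only: fps_mult_tsum)
qed

end


section \<open>Linear maps and homomorphisms on an enveloping algebra\<close>

text \<open>The value is computed from an arbitrary representative; \<open>env_extend_abs\<close>
  shows independence of the choice under the conditions of
  \<open>envelope_functional\<close>.\<close>

definition env_extend :: "('a::rat_lie_algebra list \<Rightarrow> 'v::rat_vector) \<Rightarrow> 'a envelope \<Rightarrow> 'v"
  where "env_extend \<mu> z = free_lift (\<lambda>w. case w of Word u \<Rightarrow> \<mu> u) (rep_envelope z)"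

abbreviation env_word :: "'a::rat_lie_algebra list \<Rightarrow> 'a envelope"
  where "env_word u \<equiv> prod_list (map env u)"

lemma abs_rep_envelope: "abs_envelope (rep_envelope z) = z"
  by (rule Quotient3_abs_rep[OF Quotient3_envelope])

lemma abs_envelope_single: "abs_envelope (Poly_Mapping.single (Word u) c) = c *\<^sub>Q env_word u"
proof -
  have "abs_envelope (Poly_Mapping.single (Word u) 1) = env_word u"
  proof (induction u)
    case Nil
    show ?case
      by (simp add: one_envelope_def zero_free_monoid_def[symmetric])
  next
    case (Cons x u)
    have "Poly_Mapping.single (Word (x # u)) (1 :: rat) = free_gen x * Poly_Mapping.single (Word u) 1"
      by (simp add: free_gen_def mult_single)
    then show ?case
      by (simp only: times_envelope.abs_eq[symmetric] Cons env.abs_eq[symmetric] list.map prod_list.Cons)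
  qed
  then show ?thesis
    by (metis scaleQ_envelope.abs_eq scaleQ_single mult_1_right)
qed

lemma envelope_induct [case_names word add]:
  assumes word: "\<And>c u. P (c *\<^sub>Q env_word u)" and add: "\<And>x y. P x \<Longrightarrow> P y \<Longrightarrow> P (x + y)"
  shows "P z"
proof -
  obtain p where z: "z = abs_envelope p"
    using abs_rep_envelope by metis
  have single: "P (abs_envelope (Poly_Mapping.single w c))" for w c
    by (cases w) (simp add: abs_envelope_single word)
  have "P (abs_envelope (\<Sum>x\<in>A. Poly_Mapping.single x (Poly_Mapping.lookup p x)))" if "finite A" for A
    using that
  proof induction
    case empty
    show ?case using single[of _ 0] by simp
  next
    case (insert x A)
    then show ?case using add[OF single insert(3)] by (simp add: plus_envelope.abs_eq)
  qed
  from this[of "Poly_Mapping.keys p"] show ?thesis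
    by (simp only: z finite_keys simp_thms poly_mapping_rat_expand[symmetric])
qed

text \<open>The relations are imposed inside every context u, v because the ideal is two-sided.
  Values in a vector space suffice, so homomorphisms, antihomomorphisms and the adjoint action on a
  fixed vector are all covered.\<close>

locale envelope_functional =
  fixes \<mu> :: "'a::rat_lie_algebra list \<Rightarrow> 'v::rat_vector"
  assumes add: "\<mu> (u @ (x + y) # v) = \<mu> (u @ x # v) + \<mu> (u @ y # v)"
    and scale: "\<mu> (u @ (c *\<^sub>Q x) # v) = c *\<^sub>Q \<mu> (u @ x # v)"
    and bracket: "\<mu> (u @ lie_bracket x y # v) = \<mu> (u @ x # y # v) - \<mu> (u @ y # x # v)"
begin

abbreviation functional :: "('a free_monoid \<Rightarrow>\<^sub>0 rat) \<Rightarrow> 'v"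
  where "functional \<equiv> free_lift (\<lambda>w. case w of Word u \<Rightarrow> \<mu> u)"

lemmas functional_linear = free_lift_linear[of "\<lambda>w. case w of Word u \<Rightarrow> \<mu> u"]

text \<open>By linearity the context may be taken to consist of words; the coefficient of the right
  word is central and is merged into the left one.\<close>

lemma functional_context:
  assumes "\<And>u v c. functional (Poly_Mapping.single (Word u) c * p * Poly_Mapping.single (Word v) 1) = 0"
  shows "functional (a * p * b) = 0"
proof -
  have single: "functional (Poly_Mapping.single w c * p * Poly_Mapping.single w' d) = 0" for w w' c d
  proof -
    obtain u v where "w = Word u" "w' = Word v"
      by (cases w; cases w') blast
    moreover have "Poly_Mapping.single w' d = Poly_Mapping.single 0 d * Poly_Mapping.single w' 1"
      by (simp add: mult_single)
    moreover have "Poly_Mapping.single w c * p * (Poly_Mapping.single 0 d * Poly_Mapping.single w' 1)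
      = Poly_Mapping.single 0 d * (Poly_Mapping.single w c * p * Poly_Mapping.single w' 1)"
      using scaleQ_free_algebra[of d "Poly_Mapping.single w c * p"] by (simp add: mult.assoc[symmetric])
    moreover have "Poly_Mapping.single 0 d * Poly_Mapping.single w c = Poly_Mapping.single w (d * c)"
      by (simp add: mult_single)
    ultimately show ?thesis
      using assms[of u "d * c" v] by (simp add: mult.assoc[symmetric])
  qed
  have "functional ((\<Sum>x\<in>A. Poly_Mapping.single x (f x)) * p * (\<Sum>y\<in>B. Poly_Mapping.single y (g y))) = 0"
    for A B f g
    unfolding sum_distrib_right sum_distrib_left rat_linear_sum[OF functional_linear]
    by (simp add: single)
  from this[of "Poly_Mapping.lookup a" "Poly_Mapping.keys a" "Poly_Mapping.lookup b" "Poly_Mapping.keys b"]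
  show ?thesis
    by (simp only: poly_mapping_rat_expand[symmetric])
qed

text \<open>The context a, b is the strengthening that makes the induction work: left and right
  multiples of p are absorbed into it.\<close>

lemma functional_ideal:
  assumes "p \<in> envelope_ideal"
  shows "functional (a * p * b) = 0"
  using assms
proof (induction arbitrary: a b)
  case (gen_add x y)
  show ?case
    by (rule functional_context)
      (simp add: free_gen_def algebra_simps mult_single rat_linear_add[OF functional_linear]
        rat_linear_diff[OF functional_linear] add scaleQ_add_right)
next
  case (gen_scale c x)
  show ?case
    by (rule functional_context)
      (simp add: free_gen_def algebra_simps mult_single scaleQ_single rat_linear_add[OF functional_linear]
        rat_linear_diff[OF functional_linear] scale scaleQ_scaleQ)
next
  case (gen_bracket x y)
  show ?case
    by (rule functional_context)
      (simp add: free_gen_def algebra_simps mult_single rat_linear_add[OF functional_linear]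
        rat_linear_diff[OF functional_linear] bracket rat_vector.scale_right_diff_distrib)
next
  case zero
  show ?case by (simp add: rat_linear_zero[OF functional_linear])
next
  case (add p q)
  then show ?case by (simp add: distrib_left distrib_right rat_linear_add[OF functional_linear])
next
  case (mult_left p c)
  then show ?case by (metis mult.assoc)
next
  case (mult_right p c)
  then show ?case by (metis mult.assoc)
qed

lemma env_extend_abs: "env_extend \<mu> (abs_envelope p) = functional p"
proof -
  have "rep_envelope (abs_envelope p) - p \<in> envelope_ideal"
    by (simp only: envelope.abs_eq_iff[symmetric] abs_rep_envelope)
  from functional_ideal[OF this, of 1 1] show ?thesis
    by (simp add: env_extend_def rat_linear_diff[OF functional_linear])
qed

lemma env_extend_linear: "rat_linear (env_extend \<mu>)"
proof (rule rat_linearI)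
  fix x y :: "'a envelope" and c
  obtain p q where "x = abs_envelope p" "y = abs_envelope q"
    using abs_rep_envelope by metis
  then show "env_extend \<mu> (x + y) = env_extend \<mu> x + env_extend \<mu> y"
    and "env_extend \<mu> (c *\<^sub>Q x) = c *\<^sub>Q env_extend \<mu> x"
    by (simp_all add: plus_envelope.abs_eq scaleQ_envelope.abs_eq env_extend_abs
        rat_linear_add[OF functional_linear] rat_linear_scale[OF functional_linear])
qed

lemma env_extend_word: "env_extend \<mu> (env_word u) = \<mu> u"
proof -
  have "env_word u = abs_envelope (Poly_Mapping.single (Word u) 1)"
    by (simp add: abs_envelope_single scaleQ_one)
  then show ?thesis by (simp only: env_extend_abs) (simp add: scaleQ_one)
qed

lemma env_extend_env: "env_extend \<mu> (env x) = \<mu> [x]"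
  using env_extend_word[of "[x]"] by simp

lemma env_extend_one: "env_extend \<mu> 1 = \<mu> []"
  using env_extend_word[of "[]"] by simp

end

lemma env_extend_hom:
  fixes f :: "'a::rat_lie_algebra \<Rightarrow> 'b::rat_algebra_1"
  assumes f: "rat_linear f" and bracket: "\<And>x y. f (lie_bracket x y) = f x * f y - f y * f x"
  shows "alg_hom (env_extend (\<lambda>u. prod_list (map f u)))"
    and "env_extend (\<lambda>u. prod_list (map f u)) (env x) = f x"
proof -
  interpret envelope_functional "\<lambda>u. prod_list (map f u)"
    by unfold_locales (simp_all add: rat_linear_add[OF f] rat_linear_scale[OF f] bracket
        algebra_simps mult_scaleQ_left mult_scaleQ_right)
  show "env_extend (\<lambda>u. prod_list (map f u)) (env x) = f x"
    by (simp add: env_extend_env)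
  show "alg_hom (env_extend (\<lambda>u. prod_list (map f u)))"
  proof (rule alg_homI[OF env_extend_linear])
    fix x y :: "'a envelope"
    show "env_extend (\<lambda>u. prod_list (map f u)) (x * y)
      = env_extend (\<lambda>u. prod_list (map f u)) x * env_extend (\<lambda>u. prod_list (map f u)) y"
    proof (induction x rule: envelope_induct)
      case (word c u)
      show ?case
      proof (induction y rule: envelope_induct)
        case (word d v)
        have "c *\<^sub>Q env_word u * d *\<^sub>Q env_word v = (c * d) *\<^sub>Q env_word (u @ v)"
          by (simp add: mult_scaleQ_left mult_scaleQ_right scaleQ_scaleQ)
        then show ?case
          by (simp only: rat_linear_scale[OF env_extend_linear] env_extend_word)
            (simp add: mult_scaleQ_left mult_scaleQ_right scaleQ_scaleQ)
      qed (simp add: distrib_left rat_linear_add[OF env_extend_linear])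
    qed (simp add: distrib_right rat_linear_add[OF env_extend_linear])
  qed (simp add: env_extend_one)
qed

text \<open>Reversing words turns concatenation into the opposite product, which is what the
  antipode requires.\<close>

lemma env_extend_antihom:
  fixes f :: "'a::rat_lie_algebra \<Rightarrow> 'b::rat_algebra_1"
  assumes f: "rat_linear f" and bracket: "\<And>x y. f (lie_bracket x y) = f y * f x - f x * f y"
  shows "rat_linear (env_extend (\<lambda>u. prod_list (rev (map f u))))"
    and "env_extend (\<lambda>u. prod_list (rev (map f u))) 1 = 1"
    and "env_extend (\<lambda>u. prod_list (rev (map f u))) (env x) = f x"
    and "env_extend (\<lambda>u. prod_list (rev (map f u))) (y * z)
      = env_extend (\<lambda>u. prod_list (rev (map f u))) z * env_extend (\<lambda>u. prod_list (rev (map f u))) y"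
proof -
  interpret envelope_functional "\<lambda>u. prod_list (rev (map f u))"
    by unfold_locales (simp_all add: rat_linear_add[OF f] rat_linear_scale[OF f] bracket
        algebra_simps mult_scaleQ_left mult_scaleQ_right)
  show "env_extend (\<lambda>u. prod_list (rev (map f u))) (env x) = f x"
    by (simp add: env_extend_env)
  show "rat_linear (env_extend (\<lambda>u. prod_list (rev (map f u))))"
    by (rule env_extend_linear)
  show "env_extend (\<lambda>u. prod_list (rev (map f u))) 1 = 1"
    by (simp add: env_extend_one)
  show "env_extend (\<lambda>u. prod_list (rev (map f u))) (y * z)
      = env_extend (\<lambda>u. prod_list (rev (map f u))) z * env_extend (\<lambda>u. prod_list (rev (map f u))) y"
  proof (induction y rule: envelope_induct)
    case (word c u)
    show ?case
    proof (induction z rule: envelope_induct)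
      case (word d v)
      have "c *\<^sub>Q env_word u * d *\<^sub>Q env_word v = (c * d) *\<^sub>Q env_word (u @ v)"
        by (simp add: mult_scaleQ_left mult_scaleQ_right scaleQ_scaleQ)
      then show ?case
        by (simp only: rat_linear_scale[OF env_extend_linear] env_extend_word)
          (simp add: mult_scaleQ_left mult_scaleQ_right scaleQ_scaleQ mult.commute)
    qed (simp add: distrib_left distrib_right rat_linear_add[OF env_extend_linear])
  qed (simp add: distrib_left distrib_right rat_linear_add[OF env_extend_linear])
qed

text \<open>The adjoint representation separates enough elements of the enveloping algebra for our
  purposes, so that the Poincare-Birkhoff-Witt theorem is not needed.\<close>

lemma env_extend_adjoint:
  fixes v :: "'a::rat_lie_algebra"
  shows "rat_linear (env_extend (\<lambda>u. foldr lie_bracket u v))"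
    and "env_extend (\<lambda>u. foldr lie_bracket u v) (env x) = lie_bracket x v"
proof -
  have anti: "lie_bracket x y = - lie_bracket y x" for x y :: 'a
  proof -
    have "lie_bracket x y + lie_bracket y x = lie_bracket (x + y) (x + y)"
      by (simp only: lie_add_left lie_add_right lie_self[of x] lie_self[of y]) simp
    also have "\<dots> = 0" by (rule lie_self)
    finally show ?thesis by (rule eq_neg_iff_add_eq_0[THEN iffD2])
  qed
  have add: "foldr lie_bracket u (x + y) = foldr lie_bracket u x + foldr lie_bracket u y" for u and x y :: 'a
    by (induction u) (simp_all add: lie_add_right)
  have scale: "foldr lie_bracket u (c *\<^sub>Q x) = c *\<^sub>Q foldr lie_bracket u x" for u c and x :: 'a
    by (induction u) (simp_all add: lie_scale_right)
  have diff: "foldr lie_bracket u (x - y) = foldr lie_bracket u x - foldr lie_bracket u y" for u and x y :: 'a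
    using add[of u "x - y" y] by (simp add: algebra_simps)
  have jacobi: "lie_bracket (lie_bracket x y) z = lie_bracket x (lie_bracket y z) - lie_bracket y (lie_bracket x z)"
    for x y z :: 'a
  proof -
    have neg: "lie_bracket y (- w) = - lie_bracket y w" for w
      using lie_scale_right[of y "- 1" w] by (simp add: scaleQ_one)
    have "lie_bracket x (lie_bracket y z) + - lie_bracket y (lie_bracket x z) + lie_bracket z (lie_bracket x y) = 0"
      using lie_jacobi[of x y z] unfolding anti[of z x] neg .
    then show ?thesis
      unfolding anti[of "lie_bracket x y" z] by (simp only: add_eq_0_iff2) simp
  qed
  interpret envelope_functional "\<lambda>u. foldr lie_bracket u v"
    by unfold_locales (simp_all add: lie_add_left lie_scale_left add scale jacobi diff)
  show "rat_linear (env_extend (\<lambda>u. foldr lie_bracket u v))"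
    by (rule env_extend_linear)
  show "env_extend (\<lambda>u. foldr lie_bracket u v) (env x) = lie_bracket x v"
    by (simp add: env_extend_env)
qed

lemma envelope_induct_mult [case_names one env mult add]:
  assumes "P 1" and "\<And>x. P (env x)" and "\<And>x y. P x \<Longrightarrow> P y \<Longrightarrow> P (x * y)"
    and "\<And>x y. P x \<Longrightarrow> P y \<Longrightarrow> P (x + y)" and scale: "\<And>c x. P x \<Longrightarrow> P (c *\<^sub>Q x)"
  shows "P z"
proof (induction z rule: envelope_induct)
  case (word c u)
  have "P (env_word u)" by (induction u) (simp_all add: assms)
  then show ?case by (rule scale)
qed (rule assms)

lemma alg_hom_envelope_eqI:
  assumes f: "alg_hom f" and g: "alg_hom g" and eq: "\<And>x. f (env x) = g (env x)"
  shows "f z = g z"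
  by (induction z rule: envelope_induct_mult) (simp_all add: alg_homD[OF f] alg_homD[OF g] eq)


section \<open>The undeformed Hopf structure of an enveloping algebra\<close>

definition env_comult :: "'a::rat_lie_algebra envelope \<Rightarrow> ('a envelope, 'a envelope) tensor"
  where "env_comult = env_extend (\<lambda>u. prod_list (map (\<lambda>x. env x \<otimes> 1 + 1 \<otimes> env x) u))"

text \<open>A product of zeros is 1 on the empty word and 0 on all others, so this is the
  augmentation.\<close>

definition env_counit :: "'a::rat_lie_algebra envelope \<Rightarrow> rat"
  where "env_counit = env_extend (\<lambda>u. prod_list (map (\<lambda>_. 0) u))"

definition env_antipode :: "'a::rat_lie_algebra envelope \<Rightarrow> 'a envelope"
  where "env_antipode = env_extend (\<lambda>u. prod_list (rev (map (\<lambda>x. - env x) u)))"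

lemmas tensor_simps = rat_bilinearD[OF tensor_bilinear] tensor_times

lemma tensor_zero [simp]: "0 \<otimes> b = 0" "a \<otimes> 0 = 0"
  using rat_bilinear_zero[OF tensor_bilinear] by blast+

lemma tensor_uminus [simp]: "(- a) \<otimes> b = - (a \<otimes> b)" "a \<otimes> (- b) = - (a \<otimes> b)"
  by (simp_all add: eq_neg_iff_add_eq_0 flip: tensor_simps(1) tensor_simps(3))

lemma tensor_diff: "(a - a') \<otimes> b = a \<otimes> b - a' \<otimes> b" "a \<otimes> (b - b') = a \<otimes> b - a \<otimes> b'"
  by (simp_all add: diff_conv_add_uminus tensor_simps del: add_uminus_conv_diff)

lemma
  fixes x :: "'a::rat_lie_algebra"
  shows env_comult_hom: "alg_hom (env_comult :: 'a envelope \<Rightarrow> _)"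
    and env_comult_env: "env_comult (env x) = env x \<otimes> 1 + 1 \<otimes> env x"
proof -
  have lin: "rat_linear (\<lambda>x::'a. env x \<otimes> (1 :: 'a envelope) + 1 \<otimes> env x)"
    by (rule rat_linearI) (simp_all add: rat_linear_add[OF env_linear] rat_linear_scale[OF env_linear]
        tensor_simps scaleQ_add_right)
  have bracket: "env (lie_bracket x y) \<otimes> (1 :: 'a envelope) + 1 \<otimes> env (lie_bracket x y) =
      (env x \<otimes> 1 + 1 \<otimes> env x) * (env y \<otimes> 1 + 1 \<otimes> env y)
      - (env y \<otimes> 1 + 1 \<otimes> env y) * (env x \<otimes> 1 + 1 \<otimes> env x)" for x y :: 'a
    by (simp add: env_bracket tensor_diff distrib_left distrib_right tensor_times algebra_simps)
  show "alg_hom (env_comult :: 'a envelope \<Rightarrow> _)"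
    unfolding env_comult_def by (rule env_extend_hom(1)[OF lin bracket])
  show "env_comult (env x) = env x \<otimes> 1 + 1 \<otimes> env x"
    unfolding env_comult_def by (rule env_extend_hom(2)[OF lin bracket])
qed

lemma
  fixes x :: "'a::rat_lie_algebra"
  shows env_counit_hom: "alg_hom (env_counit :: 'a envelope \<Rightarrow> rat)"
    and env_counit_env: "env_counit (env x) = 0"
proof -
  have lin: "rat_linear (\<lambda>x::'a. 0 :: rat)"
    by (rule rat_linearI) simp_all
  show "alg_hom (env_counit :: 'a envelope \<Rightarrow> rat)"
    unfolding env_counit_def by (rule env_extend_hom(1)[OF lin]) simp
  show "env_counit (env x) = 0"
    unfolding env_counit_def by (rule env_extend_hom(2)[OF lin]) simp
qed

lemma
  fixes x :: "'a::rat_lie_algebra"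
  shows env_antipode_linear: "rat_linear (env_antipode :: 'a envelope \<Rightarrow> _)"
    and env_antipode_one: "env_antipode (1 :: 'a envelope) = 1"
    and env_antipode_env: "env_antipode (env x) = - env x"
    and env_antipode_mult: "env_antipode (y * z) = env_antipode z * env_antipode (y :: 'a envelope)"
proof -
  have lin: "rat_linear (\<lambda>x::'a. - env x)"
    by (rule rat_linearI) (simp_all add: rat_linear_add[OF env_linear] rat_linear_scale[OF env_linear])
  have bracket: "- env (lie_bracket x y) = - env y * - env x - - env x * - env y" for x y :: 'a
    by (simp add: env_bracket)
  note * = env_extend_antihom[OF lin bracket, folded env_antipode_def]
  show "rat_linear (env_antipode :: 'a envelope \<Rightarrow> _)" "env_antipode (1 :: 'a envelope) = 1"
    "env_antipode (env x) = - env x" "env_antipode (y * z) = env_antipode z * env_antipode y"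
    by (rule *)+
qed

lemmas env_antipode_simps = rat_linear_add[OF env_antipode_linear] rat_linear_diff[OF env_antipode_linear]
  rat_linear_scale[OF env_antipode_linear] rat_linear_zero[OF env_antipode_linear]
  env_antipode_one env_antipode_env env_antipode_mult

lemma env_antipode_uminus: "env_antipode (- x) = - env_antipode x"
  using env_antipode_simps(2)[of 0 x] by (simp add: env_antipode_simps)

lemma env_antipode_power: "env_antipode (x ^ n) = env_antipode x ^ n"
  by (induction n) (simp_all add: env_antipode_simps power_commutes)

lemma env_antipode_binomial: "env_antipode (alg_binomial x n) = alg_binomial (env_antipode x) n"
  for x :: "'a::rat_lie_algebra envelope"
proof (induction n)
  case (Suc n)
  let ?y = "env_antipode x"
  have "(?y - of_nat n) * alg_binomial ?y n = alg_binomial ?y n * (?y - of_nat n)"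
    by (rule alg_binomial_intertwine) (simp add: algebra_simps of_nat_scale)
  moreover have "env_antipode (of_nat n) = (of_nat n :: 'a envelope)"
    by (induction n) (simp_all add: env_antipode_simps)
  ultimately show ?case
    by (simp add: env_antipode_simps Suc)
qed (simp add: env_antipode_simps)

text \<open>These actions turn the convolution axioms of an antipode into statements about modules
  over the algebra of tensors.\<close>

definition antipode_act_left :: "'a::rat_lie_algebra envelope \<Rightarrow> ('a envelope, 'a envelope) tensor \<Rightarrow> 'a envelope"
  where "antipode_act_left m z = tensor_lift (\<lambda>a b. env_antipode a * m * b) z"

definition antipode_act_right :: "('a::rat_lie_algebra envelope, 'a envelope) tensor \<Rightarrow> 'a envelope \<Rightarrow> 'a envelope"
  where "antipode_act_right z m = tensor_lift (\<lambda>a b. a * m * env_antipode b) z"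

lemma antipode_act_bilinear_aux:
  "rat_bilinear (\<lambda>a b. env_antipode a * m * b)" "rat_bilinear (\<lambda>a b. a * m * env_antipode b)"
  by (rule rat_bilinearI; simp add: env_antipode_simps algebra_simps mult_scaleQ_left mult_scaleQ_right)+

lemma antipode_act_tensor [simp]:
  "antipode_act_left m (a \<otimes> b) = env_antipode a * m * b"
  "antipode_act_right (a \<otimes> b) m = a * m * env_antipode b"
  by (simp_all add: antipode_act_left_def antipode_act_right_def antipode_act_bilinear_aux)

lemma antipode_act_left_add: "antipode_act_left m (z + w) = antipode_act_left m z + antipode_act_left m w"
  and antipode_act_left_scale: "antipode_act_left m (c *\<^sub>Q z) = c *\<^sub>Q antipode_act_left m z"
  and antipode_act_right_add: "antipode_act_right (z + w) m = antipode_act_right z m + antipode_act_right w m"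
  and antipode_act_right_scale: "antipode_act_right (c *\<^sub>Q z) m = c *\<^sub>Q antipode_act_right z m"
  unfolding antipode_act_left_def antipode_act_right_def
  by (simp_all add: rat_linear_add[OF tensor_lift_linear] rat_linear_scale[OF tensor_lift_linear]
      antipode_act_bilinear_aux)

lemma antipode_act_left_bilinear: "rat_bilinear antipode_act_left"
proof (rule rat_bilinearI)
  show "antipode_act_left (x + y) z = antipode_act_left x z + antipode_act_left y z" for x y :: "'a envelope" and z
    by (induction z rule: tensor_induct) (simp_all add: antipode_act_left_add algebra_simps)
  show "antipode_act_left (c *\<^sub>Q x) z = c *\<^sub>Q antipode_act_left x z" for c and x :: "'a envelope" and z
    by (induction z rule: tensor_induct)
      (simp_all add: antipode_act_left_add scaleQ_add_right mult_scaleQ_left mult_scaleQ_right)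
qed (rule antipode_act_left_add antipode_act_left_scale)+

lemma antipode_act_right_bilinear: "rat_bilinear antipode_act_right"
proof (rule rat_bilinearI)
  show "antipode_act_right z (x + y) = antipode_act_right z x + antipode_act_right z y" for x y :: "'a envelope" and z
    by (induction z rule: tensor_induct) (simp_all add: antipode_act_right_add algebra_simps)
  show "antipode_act_right z (c *\<^sub>Q x) = c *\<^sub>Q antipode_act_right z x" for c and x :: "'a envelope" and z
    by (induction z rule: tensor_induct)
      (simp_all add: antipode_act_right_add scaleQ_add_right mult_scaleQ_left mult_scaleQ_right)
qed (rule antipode_act_right_add antipode_act_right_scale)+

text \<open>Since S0(c) S0(a) m b d = S0(ac) m bd, this is a right action of the tensor algebra;
  \<open>antipode_act_right\<close> is a left action for the mirrored reason.\<close>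

lemma antipode_act_left_mult: "antipode_act_left (antipode_act_left m z) w = antipode_act_left m (z * w)"
proof (induction z rule: tensor_induct)
  case (tensor a b)
  show ?case
    by (induction w rule: tensor_induct)
      (simp_all add: antipode_act_left_add distrib_left tensor_times env_antipode_simps mult.assoc)
qed (simp add: antipode_act_left_add distrib_right rat_bilinearD[OF antipode_act_left_bilinear])

lemma antipode_act_right_mult: "antipode_act_right (z * w) m = antipode_act_right z (antipode_act_right w m)"
proof (induction z rule: tensor_induct)
  case (tensor a b)
  show ?case
    by (induction w rule: tensor_induct)
      (simp_all add: antipode_act_right_add distrib_left distrib_right tensor_times env_antipode_simps mult.assoc)
qed (simp add: antipode_act_right_add distrib_right)

text \<open>S0 is no homomorphism, so agreement on generators does not settle the claim. The action
  laws supply the multiplicative step: \<Delta>0(x) turns 1 into the scalar \<epsilon>(x), which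
  passes through the action of \<Delta>0(y).\<close>

lemma env_antipode_convolution:
  "antipode_act_left 1 (env_comult x) = env_counit x *\<^sub>Q 1"
  "antipode_act_right (env_comult x) 1 = env_counit x *\<^sub>Q 1"
proof -
  note [simp] = alg_homD[OF env_comult_hom] alg_homD[OF env_counit_hom]
  have scale: "antipode_act_left (c *\<^sub>Q 1) z = c *\<^sub>Q antipode_act_left 1 z"
    "antipode_act_right z (c *\<^sub>Q 1) = c *\<^sub>Q antipode_act_right z 1" for c and z :: "('a envelope, 'a envelope) tensor"
    by (simp_all add: rat_bilinearD[OF antipode_act_left_bilinear] rat_bilinearD[OF antipode_act_right_bilinear])
  show "antipode_act_left 1 (env_comult x) = env_counit x *\<^sub>Q 1"
  proof (induction x rule: envelope_induct_mult)
    case one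
    show ?case by (simp add: one_tensor_def env_antipode_simps scaleQ_one)
  next
    case (mult x y)
    then show ?case
      by (simp add: scale scaleQ_scaleQ flip: antipode_act_left_mult)
  qed (simp_all add: antipode_act_left_add antipode_act_left_scale env_comult_env env_counit_env
      env_antipode_simps scaleQ_add_left scaleQ_scaleQ scaleQ_rat_def)
  show "antipode_act_right (env_comult x) 1 = env_counit x *\<^sub>Q 1"
  proof (induction x rule: envelope_induct_mult)
    case one
    show ?case by (simp add: one_tensor_def env_antipode_simps scaleQ_one)
  next
    case (mult x y)
    then show ?case
      by (simp add: antipode_act_right_mult scale scaleQ_scaleQ mult.commute)
  qed (simp_all add: antipode_act_right_add antipode_act_right_scale env_comult_env env_counit_env
      env_antipode_simps scaleQ_add_left scaleQ_scaleQ scaleQ_rat_def)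
qed


section \<open>Structural maps on tensor products\<close>

lemma tensor_mult_tensor [simp]: "tensor_mult (a \<otimes> b) = a * b"
  by (simp add: tensor_mult_def rat_bilinear_mult)

lemma tensor_mult_linear: "rat_linear tensor_mult"
  unfolding tensor_mult_def by (rule tensor_lift_linear[OF rat_bilinear_mult])

lemma
  fixes a :: "'a::rat_algebra_1"
  shows tensor_unit_left_hom: "alg_hom (tensor_unit_left :: (rat, 'a) tensor \<Rightarrow> 'a)"
    and tensor_unit_left_tensor [simp]: "tensor_unit_left (c \<otimes> a) = c *\<^sub>Q a"
proof -
  have eq: "tensor_unit_left = tensor_lift (\<lambda>c (a :: 'a). (c *\<^sub>Q 1) * a)"
    by (simp add: tensor_unit_left_def mult_scaleQ_left)
  have hom: "alg_hom (\<lambda>c. c *\<^sub>Q (1 :: 'a))"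
    by (intro alg_homI rat_linearI) (simp_all add: scaleQ_add_left scaleQ_one scaleQ_scaleQ
        scaleQ_rat_def mult_scaleQ_left)
  have comm: "(c *\<^sub>Q 1) * a = a * c *\<^sub>Q (1 :: 'a)" for c a
    by (simp add: mult_scaleQ_left mult_scaleQ_right)
  show "alg_hom (tensor_unit_left :: (rat, 'a) tensor \<Rightarrow> 'a)"
    unfolding eq by (rule alg_hom_tensor_lift(1)[OF hom alg_hom_id comm])
  show "tensor_unit_left (c \<otimes> a) = c *\<^sub>Q a"
    by (simp add: tensor_unit_left_def rat_bilinear_scaleQ)
qed

lemma
  fixes a :: "'a::rat_algebra_1"
  shows tensor_unit_right_hom: "alg_hom (tensor_unit_right :: ('a, rat) tensor \<Rightarrow> 'a)"
    and tensor_unit_right_tensor [simp]: "tensor_unit_right (a \<otimes> c) = c *\<^sub>Q a"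
proof -
  have eq: "(\<lambda>(a :: 'a) c. c *\<^sub>Q a) = (\<lambda>a c. a * (c *\<^sub>Q 1))"
    by (simp add: fun_eq_iff mult_scaleQ_right)
  have hom: "alg_hom (\<lambda>c. c *\<^sub>Q (1 :: 'a))"
    by (intro alg_homI rat_linearI) (simp_all add: scaleQ_add_left scaleQ_one scaleQ_scaleQ
        scaleQ_rat_def mult_scaleQ_left)
  have comm: "a * c *\<^sub>Q 1 = (c *\<^sub>Q 1) * (a :: 'a)" for c a
    by (simp add: mult_scaleQ_left mult_scaleQ_right)
  note * = alg_hom_tensor_lift[OF alg_hom_id hom comm]
  show "alg_hom (tensor_unit_right :: ('a, rat) tensor \<Rightarrow> 'a)"
    unfolding tensor_unit_right_def eq by (rule *(1))
  show "tensor_unit_right (a \<otimes> c) = c *\<^sub>Q a"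
    unfolding tensor_unit_right_def eq tensor_lift_tensor[OF *(2)] by (simp add: mult_scaleQ_right)
qed

lemma tensor_map_bilinear_id:
  assumes "rat_linear f"
  shows "rat_bilinear (\<lambda>a b. f a \<otimes> b)" "rat_bilinear (\<lambda>b a. b \<otimes> f a)"
  by (rule rat_bilinearI; simp add: tensor_simps rat_linear_add[OF assms] rat_linear_scale[OF assms])+

lemma tensor_map_hom:
  assumes "alg_hom f"
  shows "alg_hom (tensor_lift (\<lambda>a b. f a \<otimes> b))" "alg_hom (tensor_lift (\<lambda>b a. b \<otimes> f a))"
proof -
  have "alg_hom (tensor_lift (\<lambda>a b. tensor_left (f a) * tensor_right b))"
    by (rule alg_hom_tensor_lift(1)[OF alg_hom_comp[OF alg_hom_tensor_left assms] alg_hom_tensor_right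
        tensor_left_right_commute])
  then show "alg_hom (tensor_lift (\<lambda>a b. f a \<otimes> b))" by (simp add: tensor_times)
  have "alg_hom (tensor_lift (\<lambda>b a. tensor_left b * tensor_right (f a)))"
    by (rule alg_hom_tensor_lift(1)[OF alg_hom_tensor_left alg_hom_comp[OF alg_hom_tensor_right assms]
        tensor_left_right_commute])
  then show "alg_hom (tensor_lift (\<lambda>b a. b \<otimes> f a))" by (simp add: tensor_times)
qed

lemma
  fixes a :: "'a::rat_algebra_1" and b :: "'b::rat_algebra_1" and c :: "'c::rat_algebra_1"
  shows tensor_assoc_hom: "alg_hom (tensor_assoc :: (('a, 'b) tensor, 'c) tensor \<Rightarrow> _)"
    and tensor_assoc_tensor [simp]: "tensor_assoc ((a \<otimes> b) \<otimes> c) = a \<otimes> (b \<otimes> c)"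
proof -
  let ?A = "tensor_lift (\<lambda>(a::'a) (b::'b). a \<otimes> (b \<otimes> (1::'c)))"
  have B: "rat_bilinear (\<lambda>(a::'a) (b::'b). a \<otimes> (b \<otimes> (c::'c)))" for c
    by (rule rat_bilinearI) (simp_all add: tensor_simps)
  have "alg_hom (tensor_lift (\<lambda>(a::'a) (b::'b). tensor_left a * tensor_right (b \<otimes> (1::'c))))"
    by (rule alg_hom_tensor_lift(1)[OF alg_hom_tensor_left alg_hom_comp[OF alg_hom_tensor_right alg_hom_tensor_left]
        tensor_left_right_commute])
  then have A: "alg_hom ?A" by (simp add: tensor_times)
  have C: "alg_hom (\<lambda>c::'c. (1::'a) \<otimes> ((1::'b) \<otimes> c))"
    by (rule alg_hom_comp[OF alg_hom_tensor_right alg_hom_tensor_right])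
  have comm: "?A u * (1 \<otimes> (1 \<otimes> c)) = (1 \<otimes> (1 \<otimes> c)) * ?A u" for u c
    by (induction u rule: tensor_induct) (simp_all add: B tensor_times alg_homD[OF A] algebra_simps)
  have *: "tensor_lift (\<lambda>a b. a \<otimes> (b \<otimes> c)) u = ?A u * (1 \<otimes> (1 \<otimes> c))" for u c
    by (induction u rule: tensor_induct)
      (simp_all add: B tensor_times alg_homD[OF A] rat_linear_add[OF tensor_lift_linear[OF B]] distrib_right)
  have eq: "tensor_assoc = tensor_lift (\<lambda>u c. ?A u * (1 \<otimes> (1 \<otimes> c)))"
    unfolding tensor_assoc_def by (intro arg_cong[where f = tensor_lift] ext *)
  note * = alg_hom_tensor_lift[OF A C comm]
  show "alg_hom (tensor_assoc :: (('a, 'b) tensor, 'c) tensor \<Rightarrow> _)"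
    unfolding eq by (rule *(1))
  show "tensor_assoc ((a \<otimes> b) \<otimes> c) = a \<otimes> (b \<otimes> c)"
    unfolding eq tensor_lift_tensor[OF *(2)] tensor_lift_tensor[OF B] by (simp add: tensor_times)
qed

lemma fps_map_sandwich_linear:
  fixes X :: "'b::rat_algebra_1 fps"
  assumes f: "rat_linear f"
  shows "rat_linear (\<lambda>a. X * fps_map f (fps_const a) * Y)"
  unfolding fps_map_const[OF f]
  by (rule rat_linearI) (simp_all add: rat_linear_add[OF f] rat_linear_scale[OF f]
      rat_linear_add[OF fps_const_linear] rat_linear_scale[OF fps_const_linear] algebra_simps
      mult_scaleQ_left mult_scaleQ_right del: fps_const_add)

text \<open>All three deformed maps have the form X f(x) Y with f undeformed. Tensoring with the
  identity preserves this form because Y \<otimes> 1 commutes with 1 \<otimes> b.\<close>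

lemma fps_tensor_map_left:
  fixes X :: "'b::rat_algebra_1 fps" and f :: "'a::rat_algebra_1 \<Rightarrow> 'b"
  assumes f: "rat_linear f"
  shows "fps_tensor_map (\<lambda>x. X * fps_map f x * Y) id z = fps_map tensor_left X *
    fps_map (tensor_lift (\<lambda>a (b::'c::rat_algebra_1). f a \<otimes> b)) z * fps_map tensor_left Y"
proof -
  note B1 = tensor_map_bilinear_id(1)[OF f]
  have l: "rat_linear (\<lambda>a. X * fps_map f (fps_const a) * Y)"
    by (rule fps_map_sandwich_linear[OF f])
  note B2 = fps_tensor_bilinear[OF l fps_const_linear]
  have comm: "fps_map tensor_left Y * fps_const (1 \<otimes> b) = fps_const (1 \<otimes> b) * fps_map tensor_left Y" for b :: 'c
    by (simp add: fps_eq_iff tensor_times)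
  have "tensor_lift (\<lambda>a b. (X * fps_map f (fps_const a) * Y) \<otimes>\<^sub>t fps_const b) w
      = fps_map tensor_left X * fps_const (tensor_lift (\<lambda>a (b::'c). f a \<otimes> b) w) * fps_map tensor_left Y" for w
  proof (induction w rule: tensor_induct)
    case (tensor a b)
    have "fps_map tensor_left X * fps_const (f a \<otimes> 1) * fps_map tensor_left Y * fps_const (1 \<otimes> b)
      = fps_map tensor_left X * (fps_const (f a \<otimes> 1) * fps_const (1 \<otimes> b)) * fps_map tensor_left Y"
      unfolding mult.assoc comm ..
    then show ?case
      unfolding tensor_lift_tensor[OF B1] tensor_lift_tensor[OF B2]
      by (simp add: fps_tensor_eq_mult alg_homD[OF fps_map_alg_hom[OF alg_hom_tensor_left]]
          fps_map_const[OF f] fps_map_const[OF alg_homD(1)[OF alg_hom_tensor_left]]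
          fps_map_const[OF alg_homD(1)[OF alg_hom_tensor_right]] tensor_times)
  next
    case (add w w')
    then show ?case
      by (simp add: rat_linear_add[OF tensor_lift_linear[OF B1]] rat_linear_add[OF tensor_lift_linear[OF B2]]
          rat_linear_add[OF fps_const_linear] distrib_left distrib_right del: fps_const_add)
  qed
  moreover have "fps_map (tensor_lift (\<lambda>a (b::'c). f a \<otimes> b)) z
      = fps_tsum (\<lambda>n. fps_const (tensor_lift (\<lambda>a (b::'c). f a \<otimes> b) (fps_nth z n)))"
    by (simp add: fps_tsum_const fps_map_def)
  ultimately show ?thesis
    by (simp add: fps_tensor_map_def fps_extend_tsum fps_mult_tsum fps_tsum_mult)
qed

lemma fps_tensor_map_right:
  fixes X :: "'b::rat_algebra_1 fps" and f :: "'a::rat_algebra_1 \<Rightarrow> 'b"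
  assumes f: "rat_linear f"
  shows "fps_tensor_map id (\<lambda>x. X * fps_map f x * Y) z = fps_map tensor_right X *
    fps_map (tensor_lift (\<lambda>(b::'c::rat_algebra_1) a. b \<otimes> f a)) z * fps_map tensor_right Y"
proof -
  note B1 = tensor_map_bilinear_id(2)[OF f]
  have l: "rat_linear (\<lambda>a. X * fps_map f (fps_const a) * Y)"
    by (rule fps_map_sandwich_linear[OF f])
  note B2 = fps_tensor_bilinear[OF fps_const_linear l]
  have comm: "fps_const (b \<otimes> 1) * fps_map tensor_right X = fps_map tensor_right X * fps_const (b \<otimes> 1)" for b :: 'c
    by (simp add: fps_eq_iff tensor_times)
  have "tensor_lift (\<lambda>b a. fps_const b \<otimes>\<^sub>t (X * fps_map f (fps_const a) * Y)) w
      = fps_map tensor_right X * fps_const (tensor_lift (\<lambda>(b::'c) a. b \<otimes> f a) w) * fps_map tensor_right Y" for w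
  proof (induction w rule: tensor_induct)
    case (tensor b a)
    have "fps_const (b \<otimes> 1) * (fps_map tensor_right X * fps_const (1 \<otimes> f a) * fps_map tensor_right Y)
      = fps_map tensor_right X * (fps_const (b \<otimes> 1) * fps_const (1 \<otimes> f a)) * fps_map tensor_right Y"
      by (simp only: mult.assoc[symmetric] comm)
    then show ?case
      unfolding tensor_lift_tensor[OF B1] tensor_lift_tensor[OF B2]
      by (simp add: fps_tensor_eq_mult alg_homD[OF fps_map_alg_hom[OF alg_hom_tensor_right]]
          fps_map_const[OF f] fps_map_const[OF alg_homD(1)[OF alg_hom_tensor_left]]
          fps_map_const[OF alg_homD(1)[OF alg_hom_tensor_right]] tensor_times)
  next
    case (add w w')
    then show ?case
      by (simp add: rat_linear_add[OF tensor_lift_linear[OF B1]] rat_linear_add[OF tensor_lift_linear[OF B2]]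
          rat_linear_add[OF fps_const_linear] distrib_left distrib_right del: fps_const_add)
  qed
  moreover have "fps_map (tensor_lift (\<lambda>(b::'c) a. b \<otimes> f a)) z
      = fps_tsum (\<lambda>n. fps_const (tensor_lift (\<lambda>(b::'c) a. b \<otimes> f a) (fps_nth z n)))"
    by (simp add: fps_tsum_const fps_map_def)
  ultimately show ?thesis
    by (simp add: fps_tensor_map_def fps_extend_tsum fps_mult_tsum fps_tsum_mult)
qed


section \<open>The Jordanian twist\<close>

lemma fps_conv_tsum_left:
  assumes "rat_bilinear B"
  shows "fps_conv B x y = fps_tsum (\<lambda>n. fps_conv B (fps_const (fps_nth x n)) y)"
  by (simp add: fps_eq_iff fps_tsum_nth fps_conv_nth[of B x] fps_conv_const_left[OF assms])

lemma fps_map_tensor_mult: "fps_map tensor_mult (x \<otimes>\<^sub>t y) = x * y"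
  by (simp add: fps_tensor_conv fps_map_conv[OF tensor_mult_linear] fps_mult_conv)

lemma fps_scale_one_nth: "fps_nth (fps_scale c 1) n = fps_nth c n *\<^sub>Q 1"
  using fps_conv_const_right[OF rat_bilinear_scaleQ, of c 1 n] by (simp add: fps_scale_conv)

lemma rising_hom: "alg_hom f \<Longrightarrow> f (rising a n) = rising (f a) n"
  by (induction n) (simp_all add: alg_homD alg_hom_of_nat)

locale jordanian_twist =
  fixes H E :: "'a::rat_lie_algebra"
  assumes lie_H_E: "lie_bracket H E = E"
begin

abbreviation "h \<equiv> env H"
abbreviation "e \<equiv> env E"

lemma h_e: "h * e - e * h = e"
  using env_bracket[of H E] by (simp add: lie_H_E)

definition "twist = (binomial_series (h \<otimes> 1) (1 \<otimes> e) :: ('a envelope, 'a envelope) tensor fps)"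
definition "twist_inv = (binomial_series (- (h \<otimes> 1)) (1 \<otimes> e) :: ('a envelope, 'a envelope) tensor fps)"
definition "antipode_twist = binomial_series h (- e)"
definition "antipode_twist_inv = binomial_series h e"

definition "comult x = twist * fps_map env_comult x * twist_inv"
definition "antipode x = antipode_twist * fps_map env_antipode x * antipode_twist_inv"
text \<open>The counit is undeformed; the factors 1 give it the shape X f(x) Y to which
  \<open>fps_tensor_map_left\<close>, \<open>fps_tensor_map_right\<close> and
  \<open>module_hom_sandwich\<close> apply.\<close>

definition "counit x = 1 * fps_map env_counit (x :: 'a envelope fps) * 1"

lemma twist_inverse: "twist * twist_inv = 1" "twist_inv * twist = 1"
  unfolding twist_def twist_inv_def by (rule binomial_series_inverse; simp add: tensor_times)+

lemma antipode_twist_inverse: "antipode_twist * antipode_twist_inv = 1"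
proof -
  have "h * - e - - e * h = - (h * e - e * h)" by simp
  then have "h * - e - - e * h = - e" by (simp only: h_e)
  from binomial_series_noncommuting_inverse[OF this] show ?thesis
    by (simp add: antipode_twist_def antipode_twist_inv_def)
qed

lemma twist_nth: "fps_nth twist n = alg_binomial h n \<otimes> (- e) ^ n"
  "fps_nth twist_inv n = alg_binomial (- h) n \<otimes> (- e) ^ n"
proof -
  have "alg_binomial (k \<otimes> 1) n * (- (1 \<otimes> e)) ^ n = alg_binomial k n \<otimes> (- e) ^ n" for k :: "'a envelope"
  proof -
    have "alg_binomial (k \<otimes> 1) n = alg_binomial k n \<otimes> (1 :: 'a envelope)"
      by (rule alg_hom_binomial[OF alg_hom_tensor_left, symmetric])
    moreover have "(- (1 \<otimes> e)) ^ n = (1 :: 'a envelope) \<otimes> (- e) ^ n"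
      unfolding alg_hom_power[OF alg_hom_tensor_right] alg_hom_uminus[OF alg_hom_tensor_right] ..
    ultimately show ?thesis by (simp only: tensor_times mult_1_left mult_1_right)
  qed
  from this[of h] this[of "- h"]
  show "fps_nth twist n = alg_binomial h n \<otimes> (- e) ^ n"
    "fps_nth twist_inv n = alg_binomial (- h) n \<otimes> (- e) ^ n"
    by (simp_all add: twist_def twist_inv_def binomial_series_def)
qed

section \<open>Cocycle identity and coassociativity\<close>

lemma twist_cocycle:
  "fps_map tensor_assoc (fps_map tensor_left twist * fps_map (tensor_lift (\<lambda>a b. env_comult a \<otimes> b)) twist)
    = fps_map tensor_right twist * fps_map (tensor_lift (\<lambda>b a. b \<otimes> env_comult a)) twist"
proof -
  note B = tensor_map_bilinear_id[OF alg_homD(1)[OF env_comult_hom]]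
  have one: "(1 :: ('a envelope, 'a envelope) tensor) = 1 \<otimes> 1" by (rule one_tensor_def)
  \<comment> \<open>\<open>env_comult\<close> applied to the leg of e produces the sum in the base
    on the left; applied to the leg of h it produces the sum in the exponent on the right.\<close>
  have "binomial_series (1 \<otimes> (h \<otimes> 1)) (1 \<otimes> (1 \<otimes> e)) * binomial_series (h \<otimes> (1 \<otimes> 1)) (1 \<otimes> (e \<otimes> 1) + 1 \<otimes> (1 \<otimes> e))
      = binomial_series (h \<otimes> (1 \<otimes> 1)) (1 \<otimes> (e \<otimes> 1))
        * binomial_series (h \<otimes> (1 \<otimes> 1) + 1 \<otimes> (h \<otimes> 1)) (1 \<otimes> (1 \<otimes> (e :: 'a envelope)))"
    by (rule binomial_series_twist)
      (simp_all add: tensor_times h_e flip: tensor_diff)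
  then show ?thesis
    unfolding twist_def alg_homD(3)[OF fps_map_alg_hom[OF tensor_assoc_hom]]
      fps_map_binomial_series[OF tensor_assoc_hom] fps_map_binomial_series[OF alg_hom_tensor_left]
      fps_map_binomial_series[OF alg_hom_tensor_right] fps_map_binomial_series[OF tensor_map_hom(1)[OF env_comult_hom]]
      fps_map_binomial_series[OF tensor_map_hom(2)[OF env_comult_hom]]
      tensor_lift_tensor[OF B(1)] tensor_lift_tensor[OF B(2)]
      env_comult_env alg_homD(2)[OF env_comult_hom] one
      tensor_simps(1,3) alg_homD(4)[OF tensor_assoc_hom] tensor_assoc_tensor
    by simp
qed

lemma env_comult_coassoc: "tensor_assoc (tensor_lift (\<lambda>a b. env_comult a \<otimes> b) (env_comult x))
    = tensor_lift (\<lambda>b a. b \<otimes> env_comult a) (env_comult x)" for x :: "'a envelope"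
proof (rule alg_hom_envelope_eqI)
  note B = tensor_map_bilinear_id[OF alg_homD(1)[OF env_comult_hom]]
  show "alg_hom (\<lambda>x :: 'a envelope. tensor_assoc (tensor_lift (\<lambda>a b. env_comult a \<otimes> b) (env_comult x)))"
    by (rule alg_hom_comp[OF tensor_assoc_hom alg_hom_comp[OF tensor_map_hom(1)[OF env_comult_hom] env_comult_hom]])
  show "alg_hom (\<lambda>x :: 'a envelope. tensor_lift (\<lambda>b a. b \<otimes> env_comult a) (env_comult x))"
    by (rule alg_hom_comp[OF tensor_map_hom(2)[OF env_comult_hom] env_comult_hom])
  have one: "(1 :: ('a envelope, 'a envelope) tensor) = 1 \<otimes> 1" by (rule one_tensor_def)
  show "tensor_assoc (tensor_lift (\<lambda>a b. env_comult a \<otimes> b) (env_comult (env x)))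
    = tensor_lift (\<lambda>b a. b \<otimes> env_comult a) (env_comult (env x))" for x :: 'a
    unfolding env_comult_env rat_linear_add[OF tensor_lift_linear[OF B(1)]] rat_linear_add[OF tensor_lift_linear[OF B(2)]]
      tensor_lift_tensor[OF B(1)] tensor_lift_tensor[OF B(2)] alg_homD(2)[OF env_comult_hom] one tensor_simps(1,3)
      alg_homD(4)[OF tensor_assoc_hom] tensor_assoc_tensor
    by simp
qed

lemma comult_coassoc: "fps_map tensor_assoc (fps_tensor_map comult id (comult x))
    = fps_tensor_map id comult (comult x)"
proof -
  let ?A = "fps_map (tensor_assoc :: (('a envelope, 'a envelope) tensor, 'a envelope) tensor \<Rightarrow> _)"
  let ?l = "fps_map (tensor_left :: _ \<Rightarrow> (('a envelope, 'a envelope) tensor, 'a envelope) tensor)"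
  let ?r = "fps_map (tensor_right :: _ \<Rightarrow> ('a envelope, ('a envelope, 'a envelope) tensor) tensor)"
  let ?D1 = "fps_map (tensor_lift (\<lambda>a (b :: 'a envelope). env_comult (a :: 'a envelope) \<otimes> b))"
  let ?D2 = "fps_map (tensor_lift (\<lambda>(b :: 'a envelope) a. b \<otimes> env_comult (a :: 'a envelope)))"
  note A = alg_homD(2,3)[OF fps_map_alg_hom[OF tensor_assoc_hom]]
    and l = alg_homD(2,3)[OF fps_map_alg_hom[OF alg_hom_tensor_left]]
    and r = alg_homD(2,3)[OF fps_map_alg_hom[OF alg_hom_tensor_right]]
    and D1 = alg_homD(2,3)[OF fps_map_alg_hom[OF tensor_map_hom(1)[OF env_comult_hom]]]
    and D2 = alg_homD(2,3)[OF fps_map_alg_hom[OF tensor_map_hom(2)[OF env_comult_hom]]]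
  define X where "X = ?r twist * ?D2 twist"
  \<comment> \<open>\<open>Y1\<close> is a left and \<open>Y2\<close> a right inverse of the same
    element \<open>X\<close>, so they agree: the identity for F^-1 follows from the cocycle identity
    without a second computation.\<close>
  define Y1 where "Y1 = ?A (?D1 twist_inv * ?l twist_inv)"
  define Y2 where "Y2 = ?D2 twist_inv * ?r twist_inv"
  have X: "X = ?A (?l twist * ?D1 twist)"
    unfolding X_def by (rule twist_cocycle[symmetric])
  have inv: "?l twist_inv * ?l twist = 1" "?r twist * ?r twist_inv = 1"
    "?D1 twist_inv * ?D1 twist = 1" "?D2 twist * ?D2 twist_inv = 1"
    by (simp_all only: l(2)[symmetric] r(2)[symmetric] D1(2)[symmetric] D2(2)[symmetric] twist_inverse
        l(1) r(1) D1(1) D2(1))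
  have "Y1 * X = ?A (?D1 twist_inv * (?l twist_inv * ?l twist) * ?D1 twist)"
    unfolding X Y1_def by (simp only: A mult.assoc)
  then have Y1: "Y1 * X = 1"
    by (simp only: inv mult_1_right A)
  have "X * Y2 = ?r twist * (?D2 twist * ?D2 twist_inv) * ?r twist_inv"
    unfolding X_def Y2_def by (simp only: mult.assoc)
  then have Y2: "X * Y2 = 1"
    by (simp only: inv mult_1_right)
  have "Y1 = Y1 * (X * Y2)"
    by (simp only: Y2 mult_1_right)
  also have "\<dots> = Y1 * X * Y2"
    by (simp only: mult.assoc)
  finally have Y: "Y1 = Y2"
    by (simp only: Y1 mult_1_left)
  have c: "comult = (\<lambda>x. twist * fps_map env_comult x * twist_inv)"
    by (simp add: comult_def fun_eq_iff)
  have mid: "?A (?D1 (fps_map env_comult x)) = ?D2 (fps_map env_comult x)"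
    by (simp only: fps_map_comp env_comult_coassoc)
  have "?A (fps_tensor_map comult id (comult x)) = ?A (?l twist * ?D1 twist) * ?A (?D1 (fps_map env_comult x)) * Y1"
    unfolding c fps_tensor_map_left[OF alg_homD(1)[OF env_comult_hom]] Y1_def by (simp only: A D1 mult.assoc)
  also have "\<dots> = X * ?D2 (fps_map env_comult x) * Y2"
    by (simp only: X mid Y)
  also have "\<dots> = fps_tensor_map id comult (comult x)"
    unfolding c fps_tensor_map_right[OF alg_homD(1)[OF env_comult_hom]] X_def Y2_def by (simp only: D2 mult.assoc)
  finally show ?thesis .
qed

text \<open>The counit on one leg sends F and F^-1 to 1: on the left leg the exponent h becomes 0,
  on the right leg the base e becomes 0. What remains is the undeformed counit law.\<close>

lemma comult_counit:
  "fps_map tensor_unit_left (fps_tensor_map counit id (comult x)) = x"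
  "fps_map tensor_unit_right (fps_tensor_map id counit (comult x)) = x"
proof -
  have c: "counit = (\<lambda>x. 1 * fps_map env_counit x * 1)"
    by (simp add: counit_def fun_eq_iff)
  note B = tensor_map_bilinear_id[OF alg_homD(1)[OF env_counit_hom]]
  let ?l = "\<lambda>z. tensor_unit_left (tensor_lift (\<lambda>a (b :: 'a envelope). env_counit (a :: 'a envelope) \<otimes> b) z)"
  let ?r = "\<lambda>z. tensor_unit_right (tensor_lift (\<lambda>(b :: 'a envelope) a. b \<otimes> env_counit (a :: 'a envelope)) z)"
  have l: "alg_hom ?l"
    by (rule alg_hom_comp[OF tensor_unit_left_hom tensor_map_hom(1)[OF env_counit_hom]])
  have r: "alg_hom ?r"
    by (rule alg_hom_comp[OF tensor_unit_right_hom tensor_map_hom(2)[OF env_counit_hom]])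
  have l': "?l (a \<otimes> b) = env_counit a *\<^sub>Q b" for a b :: "'a envelope"
    unfolding tensor_lift_tensor[OF B(1)] by simp
  have r': "?r (a \<otimes> b) = env_counit b *\<^sub>Q a" for a b :: "'a envelope"
    unfolding tensor_lift_tensor[OF B(2)] by simp
  have lx: "?l (env_comult y) = y" for y
    by (rule alg_hom_envelope_eqI[OF alg_hom_comp[OF l env_comult_hom] alg_hom_id])
      (simp only: env_comult_env alg_homD(4)[OF l] l' env_counit_env alg_homD(2)[OF env_counit_hom] scaleQ_one, simp)
  have rx: "?r (env_comult y) = y" for y
    by (rule alg_hom_envelope_eqI[OF alg_hom_comp[OF r env_comult_hom] alg_hom_id])
      (simp only: env_comult_env alg_homD(4)[OF r] r' env_counit_env alg_homD(2)[OF env_counit_hom] scaleQ_one, simp)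
  have one: "fps_map tensor_left (1 :: rat fps) = 1" "fps_map tensor_right (1 :: rat fps) = 1"
    by (rule alg_homD(2)[OF fps_map_alg_hom[OF alg_hom_tensor_left]]
        alg_homD(2)[OF fps_map_alg_hom[OF alg_hom_tensor_right]])+
  have "fps_map tensor_unit_left (fps_tensor_map counit id (comult x)) = fps_map ?l (comult x)"
    unfolding c fps_tensor_map_left[OF alg_homD(1)[OF env_counit_hom]] one by (simp add: fps_map_comp)
  also have "\<dots> = x"
    unfolding comult_def twist_def twist_inv_def alg_homD(3)[OF fps_map_alg_hom[OF l]] fps_map_binomial_series[OF l]
      alg_hom_uminus[OF l] l' fps_map_comp lx env_counit_env
    by (simp add: binomial_series_0) (simp add: fps_eq_iff)
  finally show "fps_map tensor_unit_left (fps_tensor_map counit id (comult x)) = x" .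
  have "fps_map tensor_unit_right (fps_tensor_map id counit (comult x)) = fps_map ?r (comult x)"
    unfolding c fps_tensor_map_right[OF alg_homD(1)[OF env_counit_hom]] one by (simp add: fps_map_comp)
  also have "\<dots> = x"
    unfolding comult_def twist_def twist_inv_def alg_homD(3)[OF fps_map_alg_hom[OF r]] fps_map_binomial_series[OF r]
      alg_hom_uminus[OF r] r' fps_map_comp rx env_counit_env
    by (simp add: binomial_series_0_right) (simp add: fps_eq_iff)
  finally show "fps_map tensor_unit_right (fps_tensor_map id counit (comult x)) = x" .
qed

section \<open>Antipode axioms\<close>

lemma antipode_convolution_left:
  "fps_map tensor_mult (fps_tensor_map antipode id z) = antipode_twist * fps_conv antipode_act_left antipode_twist_inv z"
proof -
  have l: "rat_linear (\<lambda>a. antipode (fps_const a))"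
    unfolding antipode_def by (rule fps_map_sandwich_linear[OF env_antipode_linear])
  note B = fps_tensor_bilinear[OF l fps_const_linear]
  note [simp] = fps_conv_const_right[OF antipode_act_left_bilinear]
  \<comment> \<open>On a pure tensor, S(a) b = Q S0(a) Q^-1 b, and S0(a) Q^-1 b is the action of a
    \<otimes> b on Q^-1.\<close>
  have "fps_map tensor_mult (tensor_lift (\<lambda>a b. antipode (fps_const a) \<otimes>\<^sub>t fps_const b) w)
    = antipode_twist * fps_conv antipode_act_left antipode_twist_inv (fps_const w)" for w
  proof (induction w rule: tensor_induct)
    case (tensor a b)
    have "fps_conv antipode_act_left antipode_twist_inv (fps_const (a \<otimes> b))
        = fps_const (env_antipode a) * antipode_twist_inv * fps_const b"
      by (simp add: fps_eq_iff)
    then show ?case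
      unfolding tensor_lift_tensor[OF B] fps_map_tensor_mult
      by (simp add: antipode_def fps_map_const[OF env_antipode_linear] mult.assoc)
  next
    case (add w w')
    have "fps_conv antipode_act_left antipode_twist_inv (fps_const (w + w'))
      = fps_conv antipode_act_left antipode_twist_inv (fps_const w)
      + fps_conv antipode_act_left antipode_twist_inv (fps_const w')"
      by (simp add: fps_eq_iff antipode_act_left_add del: fps_const_add)
    with add show ?case
      by (simp add: rat_linear_add[OF tensor_lift_linear[OF B]] fps_map_add[OF tensor_mult_linear] distrib_left)
  qed
  then show ?thesis
    by (simp only: id_apply fps_tensor_map_def fps_extend_tsum fps_map_tsum[OF tensor_mult_linear]
        fps_conv_tsum[OF antipode_act_left_bilinear, of _ z] fps_mult_tsum)
qed

lemma antipode_convolution_right: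
  "fps_map tensor_mult (fps_tensor_map id antipode z) = fps_conv antipode_act_right z antipode_twist * antipode_twist_inv"
proof -
  have l: "rat_linear (\<lambda>a. antipode (fps_const a))"
    unfolding antipode_def by (rule fps_map_sandwich_linear[OF env_antipode_linear])
  note B = fps_tensor_bilinear[OF fps_const_linear l]
  note [simp] = fps_conv_const_left[OF antipode_act_right_bilinear]
  have "fps_map tensor_mult (tensor_lift (\<lambda>b a. fps_const b \<otimes>\<^sub>t antipode (fps_const a)) w)
    = fps_conv antipode_act_right (fps_const w) antipode_twist * antipode_twist_inv" for w
  proof (induction w rule: tensor_induct)
    case (tensor a b)
    have "fps_conv antipode_act_right (fps_const (a \<otimes> b)) antipode_twist
        = fps_const a * antipode_twist * fps_const (env_antipode b)"
      by (simp add: fps_eq_iff)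
    then show ?case
      unfolding tensor_lift_tensor[OF B] fps_map_tensor_mult
      by (simp add: antipode_def fps_map_const[OF env_antipode_linear] mult.assoc)
  next
    case (add w w')
    have "fps_conv antipode_act_right (fps_const (w + w')) antipode_twist
      = fps_conv antipode_act_right (fps_const w) antipode_twist
      + fps_conv antipode_act_right (fps_const w') antipode_twist"
      by (simp add: fps_eq_iff antipode_act_right_add del: fps_const_add)
    with add show ?case
      by (simp add: rat_linear_add[OF tensor_lift_linear[OF B]] fps_map_add[OF tensor_mult_linear] distrib_right)
  qed
  then show ?thesis
    by (simp only: id_apply fps_tensor_map_def fps_extend_tsum fps_map_tsum[OF tensor_mult_linear]
        fps_conv_tsum_left[OF antipode_act_right_bilinear, of z] fps_tsum_mult)
qed

lemma comult_antipode_left: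
  "fps_map tensor_mult (fps_tensor_map antipode id (comult x)) = fps_scale (counit x) 1"
proof -
  let ?C = "fps_conv (antipode_act_left :: 'a envelope \<Rightarrow> _)"
  note B = antipode_act_left_bilinear
  have mult: "?C m (z * w) = ?C (?C m z) w" for m z w
    unfolding fps_mult_conv by (rule fps_conv_assoc[OF B B antipode_act_left_mult, symmetric])
  have const: "?C y (fps_const (a \<otimes> b)) = fps_const (env_antipode a) * y * fps_const b" for y a b
    by (simp add: fps_eq_iff fps_conv_const_right[OF B])
  \<comment> \<open>The factors of the coproduct act in turn: F sends Q^-1 to 1, \<Delta>0(x) sends
    1 to \<epsilon>(x), and F^-1 sends 1 back to Q^-1, which the prefactor Q cancels.\<close>
  have 1: "?C antipode_twist_inv twist = 1"
    using binomial_series_sandwich[of h e]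
    by (subst fps_conv_tsum[OF B])
      (simp add: twist_nth const env_antipode_binomial env_antipode_env antipode_twist_inv_def del: fps_const_power)
  have 2: "?C 1 (fps_map env_comult x) = fps_scale (counit x) 1"
    using fps_conv_const_left[OF B, of "1 :: 'a envelope"]
    by (simp add: fps_eq_iff env_antipode_convolution fps_scale_one_nth counit_def)
  have 3: "?C 1 twist_inv = antipode_twist_inv"
    using fps_conv_const_left[OF B, of "1 :: 'a envelope"]
    by (simp add: fps_eq_iff twist_nth env_antipode_binomial env_antipode_uminus env_antipode_env
        antipode_twist_inv_def binomial_series_def)
  have 4: "?C (fps_scale (counit x) 1) twist_inv = fps_scale (counit x) (?C 1 twist_inv)"
    unfolding fps_scale_conv by (rule fps_conv_assoc[OF B rat_bilinear_scaleQ rat_bilinearD(4)[OF B]])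
  show ?thesis
    unfolding antipode_convolution_left comult_def mult 1 2 4 3
    by (simp add: fps_scale_mult_right antipode_twist_inverse)
qed

text \<open>The mirrored computation: for the left action F^-1 comes first and sends Q to 1, and F
  at the end restores Q.\<close>

lemma comult_antipode_right:
  "fps_map tensor_mult (fps_tensor_map id antipode (comult x)) = fps_scale (counit x) 1"
proof -
  let ?C = "fps_conv (antipode_act_right :: _ \<Rightarrow> 'a envelope \<Rightarrow> _)"
  note B = antipode_act_right_bilinear
  have mult: "?C (z * w) m = ?C z (?C w m)" for m z w
    unfolding fps_mult_conv by (rule fps_conv_assoc[OF B B antipode_act_right_mult])
  have const: "?C (fps_const (a \<otimes> b)) y = fps_const a * y * fps_const (env_antipode b)" for y a b
    by (simp add: fps_eq_iff fps_conv_const_left[OF B])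
  have neg: "env_antipode ((- e) ^ n) = e ^ n" for n
    by (simp add: env_antipode_power env_antipode_uminus env_antipode_env)
  have 1: "?C twist_inv antipode_twist = 1"
    using binomial_series_sandwich[of h "- e"]
    by (subst fps_conv_tsum_left[OF B])
      (simp add: twist_nth const neg antipode_twist_def del: fps_const_power)
  have 2: "?C (fps_map env_comult x) 1 = fps_scale (counit x) 1"
    using fps_conv_const_right[OF B, of _ "1 :: 'a envelope"]
    by (simp add: fps_eq_iff env_antipode_convolution fps_scale_one_nth counit_def)
  have 3: "?C twist 1 = antipode_twist"
    using fps_conv_const_right[OF B, of _ "1 :: 'a envelope"]
    by (simp add: fps_eq_iff twist_nth neg antipode_twist_def binomial_series_def)
  have 4: "?C twist (fps_scale c 1) = fps_scale c (?C twist 1)" for c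
  proof (rule fps_ext)
    fix n
    have "fps_nth (?C twist (fps_scale c 1)) n
        = (\<Sum>k=0..n. fps_nth c (n - k) *\<^sub>Q antipode_act_right (fps_nth twist k) 1)"
      by (simp only: fps_conv_nth fps_scale_one_nth rat_bilinearD(2)[OF B])
    also have "\<dots> = (\<Sum>k=0..n. fps_nth c k *\<^sub>Q antipode_act_right (fps_nth twist (n - k)) 1)"
      by (rule sum.reindex_bij_witness[where i = "\<lambda>k. n - k" and j = "\<lambda>k. n - k"]) auto
    also have "\<dots> = fps_nth (fps_scale c (?C twist 1)) n"
      using fps_conv_const_right[OF B, of _ "1 :: 'a envelope"] by (simp add: fps_scale_def)
    finally show "fps_nth (?C twist (fps_scale c 1)) n = fps_nth (fps_scale c (?C twist 1)) n" .
  qed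
  show ?thesis
    unfolding antipode_convolution_right comult_def mult 1 2 4 3
    by (simp add: fps_scale_mult_left antipode_twist_inverse)
qed

lemma module_hom_sandwich:
  fixes f :: "'b::rat_algebra_1 \<Rightarrow> 'c::rat_algebra_1"
  assumes "rat_linear f"
  shows "module_hom fps_scale fps_scale (\<lambda>x. X * fps_map f x * Y)"
proof (rule module_hom.intro)
  show "module_hom_axioms fps_scale fps_scale (\<lambda>x. X * fps_map f x * Y)"
    by unfold_locales
      (simp_all add: fps_map_add[OF assms] fps_map_scale[OF assms] fps_scale_mult_left fps_scale_mult_right
        distrib_left distrib_right)
qed (rule fps_scale_module)+

lemma hopf_algebra: "fps_hopf_algebra comult antipode counit"
proof (rule fps_hopf_algebra.intro)
  have c: "comult = (\<lambda>x. twist * fps_map env_comult x * twist_inv)"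
    "counit = (\<lambda>x. 1 * fps_map env_counit x * 1)"
    "antipode = (\<lambda>x. antipode_twist * fps_map env_antipode x * antipode_twist_inv)"
    by (simp_all add: comult_def counit_def antipode_def fun_eq_iff)
  show "module_hom fps_scale fps_scale comult" "module_hom fps_scale fps_scale counit"
    "module_hom fps_scale fps_scale antipode"
    unfolding c by (rule module_hom_sandwich alg_homD(1) env_comult_hom env_counit_hom env_antipode_linear)+
  show "comult 1 = 1"
    by (simp add: comult_def alg_homD(2)[OF fps_map_alg_hom[OF env_comult_hom]] twist_inverse)
  show "counit 1 = 1" "counit (x * y) = counit x * counit y" for x y
    by (simp_all add: counit_def alg_homD(2,3)[OF fps_map_alg_hom[OF env_counit_hom]])
  show "comult (x * y) = comult x * comult y" for x y
  proof -
    have "comult x * comult y = twist * fps_map env_comult x * (twist_inv * twist) * fps_map env_comult y * twist_inv"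
      by (simp only: comult_def mult.assoc)
    also have "\<dots> = comult (x * y)"
      unfolding twist_inverse
      by (simp add: comult_def alg_homD(3)[OF fps_map_alg_hom[OF env_comult_hom]] mult.assoc)
    finally show ?thesis ..
  qed
qed (rule comult_coassoc comult_counit comult_antipode_left comult_antipode_right)+

section \<open>Closed formulas on elements of the Lie algebra\<close>

lemma comult_const:
  assumes \<delta>: "\<And>l. e * \<delta> l - \<delta> l * e = of_nat (Suc l) *\<^sub>Q \<delta> (Suc l)"
    and wt: "h * \<delta> 0 - \<delta> 0 * h = \<kappa> *\<^sub>Q \<delta> 0" and x: "\<delta> 0 = env x"
  shows "comult (fps_const (\<delta> 0)) = fps_const (\<delta> 0) \<otimes>\<^sub>t one_minus_pow e \<kappa> +
    fps_tsum (\<lambda>l. (- 1) ^ l *\<^sub>Q (fps_const (rising h l) \<otimes>\<^sub>t (one_minus_pow e (- of_nat l) * fps_const (\<delta> l))))"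
proof -
  let ?l = "tensor_left :: _ \<Rightarrow> ('a envelope, 'a envelope) tensor"
  let ?r = "tensor_right :: _ \<Rightarrow> ('a envelope, 'a envelope) tensor"
  interpret divided_ad "?r e" "\<lambda>l. ?r (\<delta> l)"
    by unfold_locales (simp add: tensor_times \<delta> tensor_simps flip: tensor_diff del: of_nat_Suc)
  have "\<delta> 0 * (h + \<kappa> *\<^sub>Q 1) = h * \<delta> 0"
    using wt by (simp add: distrib_left mult_scaleQ_right algebra_simps)
  then have hd: "?l (\<delta> 0) * (?l h + \<kappa> *\<^sub>Q 1) = ?l h * ?l (\<delta> 0)"
    by (simp only: one_tensor_def tensor_simps(4)[symmetric] tensor_simps(3)[symmetric] tensor_times mult_1_left)
  \<comment> \<open>By its weight, \<delta> 0 in the left leg raises the exponent of F from h to h +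
    \<kappa> when F is moved past it. Then F^-1 cancels all but (1 - et)^\<kappa> in the right
    leg.\<close>
  have "twist * fps_const (?l (\<delta> 0)) * twist_inv
      = fps_const (?l (\<delta> 0)) * (binomial_series (?l h + \<kappa> *\<^sub>Q 1) (?r e) * twist_inv)"
    unfolding twist_def
    by (subst binomial_series_intertwine[symmetric, of _ "?l h + \<kappa> *\<^sub>Q 1" _ "?r e"])
      (simp_all only: hd mult.assoc tensor_left_right_commute)
  also have "binomial_series (?l h + \<kappa> *\<^sub>Q 1) (?r e) * twist_inv = binomial_series (\<kappa> *\<^sub>Q 1) (?r e)"
  proof -
    have "binomial_series (?l h + \<kappa> *\<^sub>Q 1) (?r e) * binomial_series (- ?l h) (?r e)
      = binomial_series (?l h + \<kappa> *\<^sub>Q 1 + - ?l h) (?r e)"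
      by (rule binomial_series_mult)
        (simp_all add: algebra_simps mult_scaleQ_left mult_scaleQ_right tensor_times)
    then show ?thesis by (simp add: twist_inv_def)
  qed
  also have "fps_const (?l (\<delta> 0)) * binomial_series (\<kappa> *\<^sub>Q 1) (?r e) = fps_const (\<delta> 0) \<otimes>\<^sub>t one_minus_pow e \<kappa>"
    by (simp add: fps_tensor_eq_mult one_minus_pow_eq fps_map_binomial_series[OF alg_hom_tensor_right]
        fps_map_const[OF alg_homD(1)[OF alg_hom_tensor_left]] alg_homD[OF alg_hom_tensor_right])
  finally have left: "twist * fps_const (?l (\<delta> 0)) * twist_inv = fps_const (\<delta> 0) \<otimes>\<^sub>t one_minus_pow e \<kappa>" .
  \<comment> \<open>In the right leg \<delta> 0 commutes with the exponent but not with the base.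
    Moving it past F^-1 creates the series in \<delta> l and brings F^-1 next to F.\<close>
  have "twist * fps_const (?r (\<delta> 0)) * twist_inv = twist * (fps_const (?r (\<delta> 0)) * binomial_series (- ?l h) (?r e))"
    by (simp only: twist_inv_def mult.assoc)
  also have "\<dots> = twist * (twist_inv * fps_tsum (\<lambda>l. (- 1) ^ l *\<^sub>Q (fps_const (rising (?l h) l)
      * binomial_series (- of_nat l) (?r e) * fps_const (?r (\<delta> l)))))"
    by (subst conjugate_binomial_series) (simp_all add: tensor_times twist_inv_def)
  also have "\<dots> = fps_tsum (\<lambda>l. (- 1) ^ l *\<^sub>Q (fps_const (rising (?l h) l)
      * binomial_series (- of_nat l) (?r e) * fps_const (?r (\<delta> l))))"
    by (simp only: mult.assoc[symmetric] twist_inverse mult_1_left)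
  also have "\<dots> = fps_tsum (\<lambda>l. (- 1) ^ l *\<^sub>Q
      (fps_const (rising h l) \<otimes>\<^sub>t (one_minus_pow e (- of_nat l) * fps_const (\<delta> l))))"
  proof (intro fps_tsum_cong arg_cong2[where f = scaleQ] refl)
    fix l
    have "(- of_nat l) *\<^sub>Q 1 = (- of_nat l :: 'a envelope)"
      by (simp flip: of_nat_mult_eq_scaleQ)
    moreover have "?r (- of_nat l) = - of_nat l"
      unfolding alg_hom_uminus[OF alg_hom_tensor_right] alg_hom_of_nat[OF alg_hom_tensor_right] ..
    ultimately show "fps_const (rising (?l h) l) * binomial_series (- of_nat l) (?r e) * fps_const (?r (\<delta> l))
      = fps_const (rising h l) \<otimes>\<^sub>t (one_minus_pow e (- of_nat l) * fps_const (\<delta> l))"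
      unfolding fps_tensor_eq_mult one_minus_pow_eq alg_homD(3)[OF fps_map_alg_hom[OF alg_hom_tensor_right]]
        fps_map_binomial_series[OF alg_hom_tensor_right] fps_map_const[OF alg_homD(1)[OF alg_hom_tensor_left]]
        fps_map_const[OF alg_homD(1)[OF alg_hom_tensor_right]] rising_hom[OF alg_hom_tensor_left]
      by (simp only: mult.assoc)
  qed
  finally have right: "twist * fps_const (?r (\<delta> 0)) * twist_inv = fps_tsum (\<lambda>l. (- 1) ^ l *\<^sub>Q
      (fps_const (rising h l) \<otimes>\<^sub>t (one_minus_pow e (- of_nat l) * fps_const (\<delta> l))))" .
  have "fps_map env_comult (fps_const (\<delta> 0)) = fps_const (?l (\<delta> 0)) + fps_const (?r (\<delta> 0))"
    by (simp add: x fps_map_const[OF alg_homD(1)[OF env_comult_hom]] env_comult_env)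
  then show ?thesis
    by (simp only: comult_def distrib_left distrib_right left right)
qed

text \<open>Moving \<delta> 0 past Q^-1 = (1 - et)^h lowers the exponent to h - \<kappa>. That
  series factors as Q^-1 (1 - et)^(-\<kappa>), so the leading Q cancels.\<close>

lemma antipode_const:
  assumes \<delta>: "\<And>l. e * \<delta> l - \<delta> l * e = of_nat (Suc l) *\<^sub>Q \<delta> (Suc l)"
    and wt: "\<And>l. h * \<delta> l - \<delta> l * h = (\<kappa> + of_nat l) *\<^sub>Q \<delta> l" and x: "\<delta> 0 = env x"
  shows "antipode (fps_const (\<delta> 0)) = - one_minus_pow e (- \<kappa>) *
    fps_tsum (\<lambda>l. fps_const (\<delta> l * rising (h + 1) l))"
proof -
  interpret divided_ad e \<delta>
    by unfold_locales (rule \<delta>)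
  have "binomial_series h e * binomial_series (- \<kappa> *\<^sub>Q 1) e = binomial_series (h + - \<kappa> *\<^sub>Q 1) e"
    by (rule binomial_series_mult) (simp_all add: mult_scaleQ_left mult_scaleQ_right)
  then have shift: "binomial_series (h - \<kappa> *\<^sub>Q 1) e = antipode_twist_inv * one_minus_pow e (- \<kappa>)"
    by (simp add: antipode_twist_inv_def one_minus_pow_eq)
  have "antipode (fps_const (\<delta> 0)) = - (antipode_twist * (fps_const (\<delta> 0) * binomial_series h e))"
    by (simp add: antipode_def x fps_map_const[OF env_antipode_linear] env_antipode_env
        antipode_twist_inv_def mult.assoc flip: fps_const_neg)
  also have "\<dots> = - (antipode_twist * antipode_twist_inv * one_minus_pow e (- \<kappa>) *
    fps_tsum (\<lambda>l. fps_const (\<delta> l * rising (h + 1) l)))"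
    by (simp only: mult_binomial_series[OF h_e wt] shift mult.assoc)
  finally show ?thesis
    by (simp add: antipode_twist_inverse)
qed

end


section \<open>The Witt algebra\<close>

text \<open>Linear forms with explicit values on the generators, obtained as matrix entries of the
  adjoint representation. They witness the inequalities behind noncommutativity and
  noncocommutativity.\<close>

lemma witt_functional:
  defines "f v j \<equiv> \<lambda>a. Poly_Mapping.lookup
    (witt_coeffs (env_extend (\<lambda>u. foldr lie_bracket u (witt_basis v)) a)) j"
  shows "rat_linear (f v j)" and "f v j (L r) = (if r + v = j then of_int (v - r) else 0)"
proof -
  note E = env_extend_adjoint[of "witt_basis v"]
  show "rat_linear (f v j)"
    unfolding f_def by (rule rat_linearI)
      (simp_all add: rat_linear_add[OF E(1)] rat_linear_scale[OF E(1)] plus_witt.rep_eq lookup_add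
        scaleQ_witt.rep_eq scaleQ_poly_mapping.rep_eq)
  show "f v j (L r) = (if r + v = j then of_int (v - r) else 0)"
    by (simp add: f_def E(2) lie_bracket_witt_basis scaleQ_witt.rep_eq scaleQ_poly_mapping.rep_eq
        witt_basis.rep_eq lookup_single when_def scaleQ_rat_def)
qed

lemma envelope_witt_noncommutative: "L 0 * L 1 \<noteq> L 1 * L 0"
proof
  assume "L 0 * L 1 = L 1 * L 0"
  then have "env (lie_bracket (witt_basis 0) (witt_basis 1)) = 0"
    by (simp add: env_bracket)
  then have "L 1 = 0"
    by (simp add: lie_bracket_witt_basis scaleQ_one)
  then show False
    using rat_linear_zero[OF witt_functional(1)[of 0 1]] witt_functional(2)[of 0 1 1] by simp
qed

lemma
  fixes a :: "'a::rat_vector" and b :: "'b::rat_vector"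
  shows tensor_flip_tensor: "tensor_flip (a \<otimes> b) = b \<otimes> a"
    and tensor_flip_linear: "rat_linear (tensor_flip :: ('a, 'b) tensor \<Rightarrow> _)"
proof -
  have B: "rat_bilinear (\<lambda>(a::'a) (b::'b). b \<otimes> a)"
    by (rule rat_bilinearI) (simp_all add: rat_bilinearD[OF tensor_bilinear])
  show "tensor_flip (a \<otimes> b) = b \<otimes> a"
    by (simp add: tensor_flip_def B)
  show "rat_linear (tensor_flip :: ('a, 'b) tensor \<Rightarrow> _)"
    unfolding tensor_flip_def by (rule tensor_lift_linear[OF B])
qed

lemma witt_tensor_asymmetric:
  assumes "i \<noteq> 0"
  shows "L 0 \<otimes> L i \<noteq> L i \<otimes> L 0"
proof
  define f where "f v j = (\<lambda>a. Poly_Mapping.lookup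
    (witt_coeffs (env_extend (\<lambda>u. foldr lie_bracket u (witt_basis v)) a)) j)" for v j
  have f: "rat_linear (f v j)" "f v j (L r) = (if r + v = j then of_int (v - r) else 0)" for v j r
    unfolding f_def by (rule witt_functional)+
  \<comment> \<open>\<open>f 1 1\<close> is 1 on \<open>L 0\<close> and 0 on \<open>L i\<close>
    because i is nonzero, while \<open>f 0 i\<close> is -i on \<open>L i\<close>. The product form
    is therefore -i on one tensor and 0 on its flip.\<close>
  have B: "rat_bilinear (\<lambda>a b. f 1 1 a * f 0 i b)"
    by (rule rat_bilinearI)
      (simp_all add: rat_linear_add[OF f(1)] rat_linear_scale[OF f(1)] scaleQ_rat_def algebra_simps)
  assume "L 0 \<otimes> L i = L i \<otimes> L 0"
  then have "tensor_lift (\<lambda>a b. f 1 1 a * f 0 i b) (L 0 \<otimes> L i) = tensor_lift (\<lambda>a b. f 1 1 a * f 0 i b) (L i \<otimes> L 0)"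
    by simp
  then show False
    unfolding tensor_lift_tensor[OF B] f(2) using assms by simp
qed

lemma witt_coeff_0: "witt_coeff i k 0 = 1"
  by (simp add: witt_coeff_def)

lemma witt_coeff_Suc:
  "of_nat (Suc l) * witt_coeff i k (Suc l) = of_int i * of_int (k + int l * i - i) * witt_coeff i k l"
proof -
  \<comment> \<open>The new index is l - 1, and its factor k + (l-1) i is the structure constant of
    [L_i, L_{k+li}].\<close>
  have "{- 1..int (Suc l) - 2} = insert (int l - 1) {- 1..int l - 2}" by auto
  then have "(\<Prod>j = -1..int (Suc l) - 2. of_int (k + j * i)) =
      (of_int (k + (int l - 1) * i) :: rat) * (\<Prod>j = -1..int l - 2. of_int (k + j * i))"
    by simp
  then show ?thesis
    by (simp add: witt_coeff_def field_simps del: of_nat_Suc of_int_add of_int_mult of_int_diff)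
qed

lemma fps_tensor_scale_right: "x \<otimes>\<^sub>t (c *\<^sub>Q y) = c *\<^sub>Q (x \<otimes>\<^sub>t y)"
  by (simp add: fps_eq_iff fps_tensor_def scaleQ_fps_def rat_bilinearD[OF tensor_bilinear]
      rat_vector.scale_sum_right)

theorem theorem1:
  fixes i :: int
  assumes "i \<noteq> 0"
  shows "\<exists>(\<Delta> :: witt envelope fps \<Rightarrow> (witt envelope, witt envelope) tensor fps)
           (S :: witt envelope fps \<Rightarrow> witt envelope fps)
           (\<epsilon> :: witt envelope fps \<Rightarrow> rat fps).
    fps_hopf_algebra \<Delta> S \<epsilon> \<and>
    \<not> (\<forall>x y :: witt envelope fps. x * y = y * x) \<and>
    \<not> fps_cocommutative \<Delta> \<and>
    (\<forall>k.
      (\<exists>D. (\<lambda>l. ((- 1) ^ l * witt_coeff i k l) *\<^sub>Q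
                (fps_const (rising (witt_h i) l) \<otimes>\<^sub>t
                 (one_minus_pow (witt_e i) (- of_nat l) * fps_const (L (k + int l * i))))
                * fps_X ^ l) sums D \<and>
           \<Delta> (fps_const (L k)) =
             fps_const (L k) \<otimes>\<^sub>t one_minus_pow (witt_e i) (of_int k / of_int i) + D) \<and>
      (\<exists>D. (\<lambda>l. witt_coeff i k l *\<^sub>Q
                fps_const (L (k + int l * i) * rising (witt_h i + 1) l)
                * fps_X ^ l) sums D \<and>
           S (fps_const (L k)) = - one_minus_pow (witt_e i) (- (of_int k / of_int i)) * D) \<and>
      \<epsilon> (fps_const (L k)) = 0)"
proof -
  interpret jordanian_twist "(1 / of_int i) *\<^sub>Q witt_basis 0" "of_int i *\<^sub>Q witt_basis i"
    by unfold_locales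
      (use assms in \<open>simp add: lie_scale_left lie_scale_right lie_bracket_witt_basis scaleQ_scaleQ\<close>)
  have h: "h = witt_h i" and e: "e = witt_e i"
    by (simp_all add: rat_linear_scale[OF env_linear] witt_h_def witt_e_def)
  have bracket: "L r * L s - L s * L r = of_int (s - r) *\<^sub>Q L (r + s)" for r s
    unfolding env_bracket[symmetric] lie_bracket_witt_basis by (rule rat_linear_scale[OF env_linear])
  \<comment> \<open>These are the elements ad(e)^l(L_k) / l!, as \<open>ad_e\<close> confirms;
    \<open>ad_h\<close> gives their weights k/i + l.\<close>
  define \<delta> where "\<delta> k l = witt_coeff i k l *\<^sub>Q L (k + int l * i)" for k l
  have \<delta>0: "\<delta> k 0 = L k" for k
    by (simp add: \<delta>_def witt_coeff_0 scaleQ_one)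
  have ad_e: "e * \<delta> k l - \<delta> k l * e = of_nat (Suc l) *\<^sub>Q \<delta> k (Suc l)" for k l
  proof -
    have "e * \<delta> k l - \<delta> k l * e
        = (of_int i * witt_coeff i k l) *\<^sub>Q (L i * L (k + int l * i) - L (k + int l * i) * L i)"
      unfolding e witt_e_def \<delta>_def
      by (simp add: mult_scaleQ_left mult_scaleQ_right scaleQ_scaleQ rat_vector.scale_right_diff_distrib mult.commute)
    also have "\<dots> = (of_nat (Suc l) * witt_coeff i k (Suc l)) *\<^sub>Q L (i + (k + int l * i))"
      unfolding bracket scaleQ_scaleQ witt_coeff_Suc by (simp only: mult.assoc mult.commute mult.left_commute)
    also have "i + (k + int l * i) = k + int (Suc l) * i"
      by (simp add: algebra_simps)
    finally show ?thesis
      by (simp only: \<delta>_def scaleQ_scaleQ)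
  qed
  have ad_h: "h * \<delta> k l - \<delta> k l * h = (of_int k / of_int i + of_nat l) *\<^sub>Q \<delta> k l" for k l
  proof -
    have "h * \<delta> k l - \<delta> k l * h
        = ((1 / of_int i) * witt_coeff i k l) *\<^sub>Q (L 0 * L (k + int l * i) - L (k + int l * i) * L 0)"
      unfolding h witt_h_def \<delta>_def
      by (simp add: mult_scaleQ_left mult_scaleQ_right scaleQ_scaleQ rat_vector.scale_right_diff_distrib mult.commute)
    also have "\<dots> = (of_int k / of_int i + of_nat l) *\<^sub>Q \<delta> k l"
      unfolding bracket scaleQ_scaleQ \<delta>_def using assms by (simp add: field_simps)
    finally show ?thesis .
  qed
  have comult: "comult (fps_const (L k)) = fps_const (L k) \<otimes>\<^sub>t one_minus_pow (witt_e i) (of_int k / of_int i) +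
      fps_tsum (\<lambda>l. ((- 1) ^ l * witt_coeff i k l) *\<^sub>Q (fps_const (rising (witt_h i) l) \<otimes>\<^sub>t
        (one_minus_pow (witt_e i) (- of_nat l) * fps_const (L (k + int l * i)))))" for k
    using comult_const[of "\<delta> k", OF ad_e _ \<delta>0] ad_h[of k 0]
    by (simp add: \<delta>0 e h)
      (simp add: \<delta>_def rat_linear_scale[OF fps_const_linear] mult_scaleQ_right fps_tensor_scale_right scaleQ_scaleQ)
  have antipode: "antipode (fps_const (L k)) = - one_minus_pow (witt_e i) (- (of_int k / of_int i)) *
      fps_tsum (\<lambda>l. witt_coeff i k l *\<^sub>Q fps_const (L (k + int l * i) * rising (witt_h i + 1) l))" for k
    using antipode_const[of "\<delta> k", OF ad_e ad_h \<delta>0]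
    by (simp add: \<delta>0 e h)
      (simp add: \<delta>_def rat_linear_scale[OF fps_const_linear] mult_scaleQ_left)
  have counit: "counit (fps_const (L k)) = 0" for k
    by (simp add: counit_def fps_map_const[OF alg_homD(1)[OF env_counit_hom]] env_counit_env)
  have noncomm: "\<not> (\<forall>x y :: witt envelope fps. x * y = y * x)"
  proof
    assume "\<forall>x y :: witt envelope fps. x * y = y * x"
    then have "fps_nth (fps_const (L 0) * fps_const (L 1)) 0 = fps_nth (fps_const (L 1) * fps_const (L 0)) 0"
      by metis
    then show False
      using envelope_witt_noncommutative by simp
  qed
  have "\<not> fps_cocommutative comult"
  proof
    assume "fps_cocommutative comult"
    then have "tensor_flip (fps_nth (comult (fps_const (L 0))) 1) = fps_nth (comult (fps_const (L 0))) 1"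
      unfolding fps_cocommutative_def by (metis fps_map_nth)
    \<comment> \<open>For k = 0 the factor (1 - et)^0 is 1 and the summand l = 0 is constant, so
      only l = 1 contributes to t: -(-i^2) h \<otimes> L_i with h = L_0 / i.\<close>
    moreover have "fps_nth (comult (fps_const (L 0))) 1 = of_int i *\<^sub>Q (L 0 \<otimes> L i)"
    proof -
      have "witt_coeff i 0 1 = - (of_int i * of_int i)"
        using witt_coeff_Suc[of 0 i 0] by (simp add: witt_coeff_0)
      then show ?thesis
        using assms
        by (simp add: comult fps_tensor_def fps_tsum_nth one_minus_pow_def scaleQ_fps_def witt_h_def
            rat_bilinearD[OF tensor_bilinear] scaleQ_scaleQ witt_coeff_0 scaleQ_one)
    qed
    ultimately have "of_int i *\<^sub>Q (L i \<otimes> L 0) = of_int i *\<^sub>Q (L 0 \<otimes> L i)"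
      by (simp add: rat_linear_scale[OF tensor_flip_linear] tensor_flip_tensor)
    then have "L i \<otimes> L 0 = L 0 \<otimes> L i"
      using assms by (simp only: rat_vector.scale_cancel_left of_int_eq_0_iff simp_thms)
    then show False
      using witt_tensor_asymmetric[OF assms] by metis
  qed
  \<comment> \<open>Both limits \<open>D\<close> are instantiated by \<open>fps_tsum\<close>, with
    convergence from \<open>fps_tsum_sums\<close>.\<close>
  with hopf_algebra noncomm show ?thesis
    by (intro exI[of _ comult] exI[of _ antipode] exI[of _ counit] conjI allI)
      (assumption | rule counit exI conjI fps_tsum_sums comult antipode)+
qed

end
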